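(* Let a group $G$ act without inversion on a CAT(0) cube complex $X$, and suppose $g\in G$ is hyperbolic. The following statements are equivalent. (1) There is an integer $k>0$ such that $\langle g^k\rangle$ acts non-transversely on $X^{\mathrm{ess}}_g$. (2) $X^{\mathrm{ess}}_g=M^{\mathrm{ess}}_{g^k}$ for some $k>0$. (3) $X^{\mathrm{ess}}_g$ is finite-dimensional.
   Context: A half-space $H$ of $X$ is the closure of a component of the complement of a hyperplane, $\overline H$ the complementary half-space, and $\mathcal H(X)$ is ordered by inclusion. $H,H'$ are transverse if $H\cap H'$, $H\cap\overline{H'}$, $\overline H\cap H'$, $\overline H\cap\overline{H'}$ are all nonempty. An action is without inversion if $gH\neq\overline H$ for all $g\in G$, $H\in\mathcal H(X)$. Distances between vertices are combinatorial. $g$ is hyperbolic if $\ell_g=\min_x d(x,gx)>0$ ($x$ ranging over vertices); then it has combinatorial axes (bi-infinite combinatorial geodesics preserved by $g$, on which $g$ translates by $\ell_g$, oriented forward). $A_g^+$ is the set of half-spaces dual to positively oriented edges of a combinatorial axis (independent of the axis; the half-space dual to an oriented edge $(x,y)$ contains $y$ but not $x$), and $A_g=A_g^+\sqcup\{\overline H:H\in A_g^+\}$. For a set $\mathcal A$ of half-spaces closed under $H\mapsto\overline H$, $X(\mathcal A)$ denotes the Sageev construction: vertices are subsets of $\mathcal A$ containing exactly one of each pair $\{H,\overline H\}$, no two elements disjoint, satisfying the descending chain condition; vertices differing on exactly one pair span an edge; cubes are attached whenever their $1$-skeleta are present. The essential characteristic set is $X^{\mathrm{ess}}_g=X(A_g)$,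 a CAT(0) cube complex whose half-spaces are identified with $A_g$. For $k>0$, $A_{g^k}=A_g$ and so $X^{\mathrm{ess}}_{g^k}=X^{\mathrm{ess}}_g$. $M_g$ is the full subcomplex of $X$ spanned by the vertices realizing $\ell_g$, and $X_g$ is its convex hull. Let $T_g$ be the set of half-spaces not in $A_g$ whose bounding hyperplane separates two combinatorial axes of $g$, and $X^{\mathrm{ell}}_g=X(T_g)$. There is a $\langle g\rangle$-equivariant isomorphism $X_g\cong X^{\mathrm{ess}}_g\times X^{\mathrm{ell}}_g$ (send a vertex $v$, regarded as the set of half-spaces containing it, to its intersections with $A_g$ and $T_g$). The essential minimal set $M^{\mathrm{ess}}_g\subseteq X^{\mathrm{ess}}_g$ is the image of $M_g$ under projection to the first factor; $M^{\mathrm{ess}}_{g^k}\subseteq X^{\mathrm{ess}}_{g^k}=X^{\mathrm{ess}}_g$ is the same construction for $g^k$. $\langle g^k\rangle$ acts non-transversely on $X^{\mathrm{ess}}_g$ if for every $H\in A_g$, $H$ and $g^kH$ are not transverse in $X^{\mathrm{ess}}_g$ (equivalently, in $X$). *)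

theory Defs
  imports "HOL-Algebra.Group_Action"
begin

section \<open>Cube complexes\<close>

text \<open>
  A cube complex is given combinatorially, in the style of an abstract simplicial complex, as the
  collection of the vertex sets of its cubes. In a CAT(0) cube complex every cube is embedded and two
  cubes meet in a common face or not at all, so nothing is lost by this encoding. Cubes are
  finite-dimensional, but there is no bound on their dimensions and no local finiteness.
\<close>

definition verts :: "'v set set \<Rightarrow> 'v set" where
  "verts K = \<Union> K"

text \<open>
  The vertices of the standard \<open>n\<close>-cube are the subsets of \<open>{..<n}\<close>; its nonempty faces are the
  intervals \<open>{A..B}\<close> of the subset order. A chart identifies the \<open>n\<close>-cube with \<open>C\<close> such that the
  faces are exactly the cells of \<open>K\<close> contained in \<open>C\<close>.
\<close>

definition cube_chart :: "'v set set \<Rightarrow> nat \<Rightarrow> (nat set \<Rightarrow> 'v) \<Rightarrow> 'v set \<Rightarrow> bool" where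
  "cube_chart K n c C \<longleftrightarrow>
     bij_betw c (Pow {..<n}) C \<and>
     (\<forall>D. D \<subseteq> C \<longrightarrow> (D \<in> K \<longleftrightarrow> (\<exists>A B. A \<subseteq> B \<and> B \<subseteq> {..<n} \<and> D = c ` {A..B})))"

definition cube_complex :: "'v set set \<Rightarrow> bool" where
  "cube_complex K \<longleftrightarrow>
     (\<forall>C\<in>K. \<exists>n c. cube_chart K n c C) \<and>
     (\<forall>C\<in>K. \<forall>D\<in>K. C \<inter> D \<noteq> {} \<longrightarrow> C \<inter> D \<in> K)"

definition finite_dimensional :: "'v set set \<Rightarrow> bool" where
  "finite_dimensional K \<longleftrightarrow> (\<exists>N. \<forall>C\<in>K. \<exists>n\<le>N. \<exists>c. cube_chart K n c C)"

definition full_subcomplex :: "'v set set \<Rightarrow> 'v set \<Rightarrow> 'v set set" where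
  "full_subcomplex K S = {C \<in> K. C \<subseteq> S}"

definition edge :: "'v set set \<Rightarrow> 'v \<Rightarrow> 'v \<Rightarrow> bool" where
  "edge K x y \<longleftrightarrow> x \<noteq> y \<and> {x, y} \<in> K"

text \<open>\<open>a, b, c, d\<close> are the corners of a 2-cube, listed in cyclic order.\<close>

definition square :: "'v set set \<Rightarrow> 'v \<Rightarrow> 'v \<Rightarrow> 'v \<Rightarrow> 'v \<Rightarrow> bool" where
  "square K a b c d \<longleftrightarrow>
     distinct [a, b, c, d] \<and> {a, b, c, d} \<in> K \<and>
     edge K a b \<and> edge K b c \<and> edge K c d \<and> edge K d a"

section \<open>The CAT(0) condition\<close>

text \<open>
  Gromov's criterion: simply connected, with flag vertex links. Simple connectedness is expressed by
  the edge-path group: closed edge paths are contractible through backtracks and squares.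
\<close>

definition edge_path :: "'v set set \<Rightarrow> 'v list \<Rightarrow> bool" where
  "edge_path K p \<longleftrightarrow> p \<noteq> [] \<and> set p \<subseteq> verts K \<and> successively (edge K) p"

inductive elem_homotopy :: "'v set set \<Rightarrow> 'v list \<Rightarrow> 'v list \<Rightarrow> bool" for K where
  backtrack: "edge K x y \<Longrightarrow> elem_homotopy K (p @ [x, y, x] @ q) (p @ [x] @ q)"
| across: "square K a b c d \<Longrightarrow> elem_homotopy K (p @ [a, b, c] @ q) (p @ [a, d, c] @ q)"

definition connected_complex :: "'v set set \<Rightarrow> bool" where
  "connected_complex K \<longleftrightarrow>
     verts K \<noteq> {} \<and>
     (\<forall>x\<in>verts K. \<forall>y\<in>verts K. \<exists>p. edge_path K p \<and> hd p = x \<and> last p = y)"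

definition simply_connected_complex :: "'v set set \<Rightarrow> bool" where
  "simply_connected_complex K \<longleftrightarrow>
     connected_complex K \<and>
     (\<forall>p. edge_path K p \<and> hd p = last p \<longrightarrow> equivclp (elem_homotopy K) p [hd p])"

text \<open>
  The link of \<open>v\<close> as an abstract simplicial complex on the neighbours of \<open>v\<close> (including the empty
  simplex): each cube at \<open>v\<close> contributes the set of its edges at \<open>v\<close>.
\<close>

definition link :: "'v set set \<Rightarrow> 'v \<Rightarrow> 'v set set" where
  "link K v = {{w \<in> C. edge K v w} | C. C \<in> K \<and> v \<in> C}"

definition flag :: "'a set set \<Rightarrow> bool" where
  "flag L \<longleftrightarrow>
     (\<forall>S. finite S \<and> S \<subseteq> \<Union> L \<and> (\<forall>a\<in>S. \<forall>b\<in>S. {a, b} \<in> L) \<longrightarrow> S \<in> L)"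

definition CAT0_cube_complex :: "'v set set \<Rightarrow> bool" where
  "CAT0_cube_complex K \<longleftrightarrow>
     cube_complex K \<and> simply_connected_complex K \<and> (\<forall>v\<in>verts K. flag (link K v))"

section \<open>Hyperplanes and half-spaces\<close>

text \<open>
  A hyperplane is represented by the set of edges it crosses, a class of edges (two-element vertex
  sets) under the equivalence relation generated by being opposite in a square. A half-space is
  represented by its set of vertices.
\<close>

definition opposite :: "'v set set \<Rightarrow> 'v set \<Rightarrow> 'v set \<Rightarrow> bool" where
  "opposite K e e' \<longleftrightarrow> (\<exists>a b c d. square K a b c d \<and> e = {a, b} \<and> e' = {d, c})"

definition dual_hyperplane :: "'v set set \<Rightarrow> 'v set \<Rightarrow> 'v set set" where
  "dual_hyperplane K e = {e'. equivclp (opposite K) e e'}"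

definition hyperplanes :: "'v set set \<Rightarrow> 'v set set set" where
  "hyperplanes K = {dual_hyperplane K {x, y} | x y. edge K x y}"

definition component_avoiding :: "'v set set \<Rightarrow> 'v set set \<Rightarrow> 'v \<Rightarrow> 'v set" where
  "component_avoiding K h v = {w. (\<lambda>x y. edge K x y \<and> {x, y} \<notin> h)\<^sup>*\<^sup>* v w}"

definition half_spaces :: "'v set set \<Rightarrow> 'v set set" where
  "half_spaces K = {component_avoiding K h v | h v. h \<in> hyperplanes K \<and> v \<in> verts K}"

definition co :: "'v set set \<Rightarrow> 'v set \<Rightarrow> 'v set" where
  "co K H = verts K - H"

text \<open>The half-space dual to the oriented edge from \<open>x\<close> to \<open>y\<close>; it contains \<open>y\<close> but not \<open>x\<close>.\<close>

definition dual_half_space :: "'v set set \<Rightarrow> 'v \<Rightarrow> 'v \<Rightarrow> 'v set" where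
  "dual_half_space K x y = component_avoiding K (dual_hyperplane K {x, y}) y"

definition transverse :: "'v set set \<Rightarrow> 'v set \<Rightarrow> 'v set \<Rightarrow> bool" where
  "transverse K H H' \<longleftrightarrow>
     H \<inter> H' \<noteq> {} \<and> H \<inter> co K H' \<noteq> {} \<and> co K H \<inter> H' \<noteq> {} \<and> co K H \<inter> co K H' \<noteq> {}"

section \<open>Actions\<close>

text \<open>
  A group acts by cubical automorphisms, which are recorded by their effect on vertices. Mapping
  cubes to cubes is required of every group element, hence also of inverses.
\<close>

definition acts_on_complex ::
    "('g, 'm) monoid_scheme \<Rightarrow> 'v set set \<Rightarrow> ('g \<Rightarrow> 'v \<Rightarrow> 'v) \<Rightarrow> bool" where
  "acts_on_complex G K \<phi> \<longleftrightarrow>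
     group_action G (verts K) \<phi> \<and> (\<forall>g\<in>carrier G. \<forall>C\<in>K. \<phi> g ` C \<in> K)"

definition without_inversion ::
    "('g, 'm) monoid_scheme \<Rightarrow> 'v set set \<Rightarrow> ('g \<Rightarrow> 'v \<Rightarrow> 'v) \<Rightarrow> bool" where
  "without_inversion G K \<phi> \<longleftrightarrow>
     (\<forall>g\<in>carrier G. \<forall>H\<in>half_spaces K. \<phi> g ` H \<noteq> co K H)"

text \<open>In the rest of the theory \<open>f\<close> is the vertex map of an automorphism of \<open>K\<close>.\<close>

definition vdist :: "'v set set \<Rightarrow> 'v \<Rightarrow> 'v \<Rightarrow> nat" where
  "vdist K x y = (LEAST n. (edge K ^^ n) x y)"

definition translation_length :: "'v set set \<Rightarrow> ('v \<Rightarrow> 'v) \<Rightarrow> nat" where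
  "translation_length K f = (LEAST n. \<exists>x\<in>verts K. vdist K x (f x) = n)"

definition hyperbolic :: "'v set set \<Rightarrow> ('v \<Rightarrow> 'v) \<Rightarrow> bool" where
  "hyperbolic K f \<longleftrightarrow> translation_length K f > 0"

definition combinatorial_axis :: "'v set set \<Rightarrow> ('v \<Rightarrow> 'v) \<Rightarrow> (int \<Rightarrow> 'v) \<Rightarrow> bool" where
  "combinatorial_axis K f \<gamma> \<longleftrightarrow>
     range \<gamma> \<subseteq> verts K \<and>
     (\<forall>i j. vdist K (\<gamma> i) (\<gamma> j) = nat \<bar>i - j\<bar>) \<and>
     (\<forall>i. f (\<gamma> i) = \<gamma> (i + int (translation_length K f)))"

text \<open>
  All axes of a hyperbolic automorphism have the same dual half-spaces, so the union over all axes
  in the following definition is the contribution of any single one.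
\<close>

definition char_set_pos :: "'v set set \<Rightarrow> ('v \<Rightarrow> 'v) \<Rightarrow> 'v set set" where
  "char_set_pos K f =
     {dual_half_space K (\<gamma> i) (\<gamma> (i + 1)) | \<gamma> i. combinatorial_axis K f \<gamma>}"

definition char_set :: "'v set set \<Rightarrow> ('v \<Rightarrow> 'v) \<Rightarrow> 'v set set" where
  "char_set K f = char_set_pos K f \<union> co K ` char_set_pos K f"

section \<open>The Sageev construction\<close>

text \<open>Here \<open>\<A>\<close> is a set of half-spaces of \<open>K\<close> closed under \<open>co K\<close>.\<close>

definition sageev_verts :: "'v set set \<Rightarrow> 'v set set \<Rightarrow> 'v set set set" where
  "sageev_verts K \<A> =
     {v. v \<subseteq> \<A> \<and>
         (\<forall>H\<in>\<A>. (H \<in> v) \<noteq> (co K H \<in> v)) \<and>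
         (\<forall>H\<in>v. \<forall>H'\<in>v. H \<inter> H' \<noteq> {}) \<and>
         \<not> (\<exists>s :: nat \<Rightarrow> 'v set. \<forall>n. s n \<in> v \<and> s (Suc n) \<subset> s n)}"

definition sageev_edge :: "'v set set \<Rightarrow> 'v set set \<Rightarrow> 'v set set \<Rightarrow> bool" where
  "sageev_edge K u v \<longleftrightarrow> (\<exists>H. u - v = {H} \<and> v - u = {co K H})"

text \<open>Cubes are attached exactly where the graph contains the 1-skeleton of a cube.\<close>

definition sageev :: "'v set set \<Rightarrow> 'v set set \<Rightarrow> 'v set set set set" where
  "sageev K \<A> =
     {C. \<exists>(n::nat) c. bij_betw c (Pow {..<n}) C \<and> C \<subseteq> sageev_verts K \<A> \<and>
           (\<forall>S i. S \<subseteq> {..<n} \<and> i < n \<and> i \<notin> S \<longrightarrow> sageev_edge K (c S) (c (insert i S)))}"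

text \<open>The half-space of the Sageev complex that corresponds to a half-space \<open>H \<in> \<A>\<close> of \<open>K\<close>.\<close>

definition sageev_half_space :: "'v set set \<Rightarrow> 'v set set \<Rightarrow> 'v set \<Rightarrow> 'v set set set" where
  "sageev_half_space K \<A> H = {v \<in> verts (sageev K \<A>). H \<in> v}"

section \<open>Essential characteristic set and essential minimal set\<close>

definition ess :: "'v set set \<Rightarrow> ('v \<Rightarrow> 'v) \<Rightarrow> 'v set set set set" where
  "ess K f = sageev K (char_set K f)"

definition min_set :: "'v set set \<Rightarrow> ('v \<Rightarrow> 'v) \<Rightarrow> 'v set set" where
  "min_set K f = full_subcomplex K {x \<in> verts K. vdist K x (f x) = translation_length K f}"

text \<open>
  The projection to the essential factor: a vertex, regarded as the set of half-spaces containing it,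
  is sent to its intersection with the characteristic set.
\<close>

definition ess_proj :: "'v set set \<Rightarrow> ('v \<Rightarrow> 'v) \<Rightarrow> 'v \<Rightarrow> 'v set set" where
  "ess_proj K f x = {H \<in> half_spaces K. x \<in> H} \<inter> char_set K f"

definition ess_min_set :: "'v set set \<Rightarrow> ('v \<Rightarrow> 'v) \<Rightarrow> 'v set set set set" where
  "ess_min_set K f = (\<lambda>C. ess_proj K f ` C) ` min_set K f"

text \<open>\<open>f'\<close> is a power of \<open>f\<close>; the cyclic group it generates acts non-transversely on \<open>ess K f\<close>.\<close>

definition acts_nontransversely_on_ess ::
    "'v set set \<Rightarrow> ('v \<Rightarrow> 'v) \<Rightarrow> ('v \<Rightarrow> 'v) \<Rightarrow> bool" where
  "acts_nontransversely_on_ess K f f' \<longleftrightarrow>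
     (\<forall>H\<in>char_set K f.
        \<not> transverse (ess K f)
            (sageev_half_space K (char_set K f) H)
            (sageev_half_space K (char_set K f) (f' ` H)))"

end

theory Submission
  imports Defs
begin

text \<open>
  Edge paths in a complex satisfying Gromov's criterion are considered up to flips across squares.
  By flagness, two flip-equivalent paths with different last edges differ by a single flip at the
  end, so that a reduced path (one whose flip class contains no backtrack) behaves like a reduced
  word of a Coxeter group. By van der Waerden's trick the edges act on the flip classes of reduced
  paths, and simple connectedness makes reduced paths unique up to flips. They are therefore the
  geodesics, and the quadrangle condition follows; it yields the half-spaces as the sets of vertices
  closer to one end of an edge than to the other, the formula for the distance as the number of
  separating hyperplanes, and the realization of consistent orientations by vertices.

  Along an axis, number the crossed half-spaces \<open>h j\<close> so that \<open>g\<close> maps \<open>h j\<close> to \<open>h (j + L)\<close>.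
  All three statements say that for some \<open>k\<close> each \<open>g\<close>-orbit is nested,
  \<open>h (j + L * k) \<subseteq> h j\<close>. Nestedness leaves room for at most \<open>L * k\<close> pairwise transverse
  half-spaces, and conversely in dimension \<open>N\<close> two among \<open>N + 1\<close> consecutive half-spaces of an orbit
  are nested, so that \<open>k = N!\<close> works for all orbits. A vertex has minimal displacement under
  \<open>g ^ k\<close> iff it orients every orbit monotonically and is separated from its image by no hyperplane
  off the axis, so that the essential minimal set is everything iff the orbits are nested.
\<close>

section \<open>Cubes\<close>

text \<open>Simple connectedness is given only as contractibility of edge loops, so reduced paths
  have to be controlled by an invariant of homotopies. The action on flip classes is one because
  neither a backtrack nor a change of side in a square alters its result. Flagness enters through
  the completion of three squares at a vertex to a 3-cube.

  A vertex of the essential complex need not come from a vertex of \<open>X\<close>: the descending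
  chain condition alone does not prevent it from differing from a vertex of the axis on infinitely
  many half-spaces. Nestedness turns such an infinite difference into an infinite descending chain.
  The half-spaces off the axis can then be oriented towards the axis, as none of them separates two
  of its vertices.

  The constant \<open>L\<close> counts the orbits of half-spaces crossed by the axis, one for each
  residue modulo \<open>L\<close>. An axis of \<open>g\<close> is also a line for
  \<open>g ^ k\<close>, with shift \<open>L * k\<close>; hence one set \<open>cuts p\<close> serves
  all powers.\<close>

abbreviation sd :: "'a set \<Rightarrow> 'a set \<Rightarrow> 'a set" where "sd S T \<equiv> (S - T) \<union> (T - S)"

lemma edge_sym: "edge K x y \<Longrightarrow> edge K y x"
  by (auto simp: edge_def insert_commute)

lemma square_rotate: "square K a b c d \<Longrightarrow> square K b c d a"
  by (auto simp: square_def insert_commute)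

lemma square_reflect: "square K a b c d \<Longrightarrow> square K a d c b"
  by (auto simp: square_def insert_commute edge_sym)

text \<open>Weaker than a chart, but symmetric in the corners: edges and squares are written with
  symmetric differences, so that any corner can be moved to \<open>{}\<close>.\<close>

definition cube_frame :: "'v set set \<Rightarrow> nat \<Rightarrow> (nat set \<Rightarrow> 'v) \<Rightarrow> 'v set \<Rightarrow> bool" where
  "cube_frame K n c C \<longleftrightarrow>
     bij_betw c (Pow {..<n}) C \<and>
     (\<forall>S T. S \<subseteq> {..<n} \<and> T \<subseteq> {..<n} \<longrightarrow> (edge K (c S) (c T) \<longleftrightarrow> (\<exists>i<n. T = sd S {i}))) \<and>
     (\<forall>S i j. S \<subseteq> {..<n} \<and> i < n \<and> j < n \<and> i \<noteq> j \<longrightarrow>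
        square K (c S) (c (sd S {i})) (c (sd S {i, j})) (c (sd S {j})))"

lemma interval_insert: "i \<notin> A \<Longrightarrow> {A..insert i A} = {A, insert i A}"
  by auto

lemma sd_interval2: "{S, sd S {i}, sd S {i, j}, sd S {j}} = {S - {i, j}..S \<union> {i, j}}"
proof (intro equalityI subsetI)
  fix T assume "T \<in> {S - {i, j}..S \<union> {i, j}}"
  then have "sd S T \<subseteq> {i, j}" by auto
  then obtain U where U: "U \<subseteq> {i, j}" "T = sd S U" by blast
  from U(1) have "U \<in> {{}, {i}, {i, j}, {j}}"
    by (cases "i \<in> U"; cases "j \<in> U") auto
  then show "T \<in> {S, sd S {i}, sd S {i, j}, sd S {j}}" using U(2) by (elim insertE) simp_all
qed auto

lemma cube_frame_of_chart:
  assumes "cube_chart K n c C"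
  shows "cube_frame K n c C"
proof -
  have bij: "bij_betw c (Pow {..<n}) C"
    and face: "\<And>D. D \<subseteq> C \<Longrightarrow> D \<in> K \<longleftrightarrow> (\<exists>A B. A \<subseteq> B \<and> B \<subseteq> {..<n} \<and> D = c ` {A..B})"
    using assms unfolding cube_chart_def by auto
  have inj: "\<And>S T. S \<subseteq> {..<n} \<Longrightarrow> T \<subseteq> {..<n} \<Longrightarrow> c S = c T \<longleftrightarrow> S = T"
    using bij unfolding bij_betw_def inj_on_def by blast
  have img: "\<And>S. S \<subseteq> {..<n} \<Longrightarrow> c S \<in> C"
    using bij unfolding bij_betw_def by blast
  have edge: "edge K (c S) (c T) \<longleftrightarrow> (\<exists>i<n. T = sd S {i})"
    if S: "S \<subseteq> {..<n}" and T: "T \<subseteq> {..<n}" for S T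
  proof
    assume e: "edge K (c S) (c T)"
    then have "S \<noteq> T" and "{c S, c T} \<in> K" by (auto simp: edge_def)
    then obtain A B where AB: "A \<subseteq> B" "B \<subseteq> {..<n}" "{c S, c T} = c ` {A..B}"
      using face[of "{c S, c T}"] img S T by auto
    have inj': "inj_on c (Pow {..<n})" using bij by (simp add: bij_betw_def)
    have sub1: "{S, T} \<subseteq> Pow {..<n}" using S T by auto
    have sub2: "{A..B} \<subseteq> Pow {..<n}" using AB(2) by fastforce
    have eq: "{S, T} = {A..B}"
      using inj_on_image_eq_iff[OF inj' sub1 sub2] AB(3) by simp
    have "A \<in> {S,T}" "B \<in> {S,T}" using eq AB by auto
    moreover have "A \<noteq> B" using eq \<open>S \<noteq> T\<close> by auto
    ultimately have cases: "(S = A \<and> T = B) \<or> (S = B \<and> T = A)" by auto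
    obtain i where i: "i \<in> B" "i \<notin> A" using AB \<open>A \<noteq> B\<close> by auto
    have "insert i A \<in> {S, T}" unfolding eq using AB i by auto
    then have "B = insert i A" using cases i by auto
    then show "\<exists>i<n. T = sd S {i}" using cases i AB by (intro exI[of _ i]) auto
  next
    assume "\<exists>i<n. T = sd S {i}"
    then obtain i where i: "i < n" "T = sd S {i}" by auto
    have "{S, T} = {S - {i}, insert i (S - {i})}" using i by (cases "i \<in> S") auto
    also have "\<dots> = {S - {i}..insert i (S - {i})}" by (rule interval_insert[symmetric]) auto
    finally have eq0: "{S, T} = {S - {i}..insert i (S - {i})}" .
    have "{c S, c T} = c ` {S - {i}..insert i (S - {i})}"
      unfolding eq0[symmetric] image_insert image_empty ..
    moreover have "{c S, c T} \<subseteq> C" using img S T by simp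
    moreover have "S - {i} \<subseteq> insert i (S - {i})" "insert i (S - {i}) \<subseteq> {..<n}" using S i by auto
    ultimately have "{c S, c T} \<in> K" using face[of "{c S, c T}"] by blast
    moreover have "S \<noteq> T" using i by auto
    ultimately show "edge K (c S) (c T)" using inj S T by (auto simp: edge_def)
  qed
  have square: "square K (c S) (c (sd S {i})) (c (sd S {i, j})) (c (sd S {j}))"
    if S: "S \<subseteq> {..<n}" and ij: "i < n" "j < n" "i \<noteq> j" for S i j
  proof -
    have sub: "sd S {i} \<subseteq> {..<n}" "sd S {j} \<subseteq> {..<n}" "sd S {i,j} \<subseteq> {..<n}" using S ij by auto
    let ?Q = "{c S, c (sd S {i}), c (sd S {i,j}), c (sd S {j})}"
    have "?Q = c ` {S - {i,j}..S \<union> {i,j}}"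
      unfolding sd_interval2[symmetric] image_insert image_empty ..
    moreover have "?Q \<subseteq> C" using img S sub by simp
    moreover have "S - {i,j} \<subseteq> S \<union> {i,j}" "S \<union> {i,j} \<subseteq> {..<n}" using S ij by auto
    ultimately have cell: "?Q \<in> K"
      using face[of "?Q"] by blast
    have "S \<noteq> sd S {i}" "S \<noteq> sd S {i,j}" "S \<noteq> sd S {j}" "sd S {i} \<noteq> sd S {i,j}"
      "sd S {i} \<noteq> sd S {j}" "sd S {i,j} \<noteq> sd S {j}" using ij by blast+
    then have dist: "distinct [c S, c (sd S {i}), c (sd S {i,j}), c (sd S {j})]"
      using inj[OF S sub(1)] inj[OF S sub(2)] inj[OF S sub(3)]
        inj[OF sub(1,2)] inj[OF sub(1,3)] inj[OF sub(3,2)] by simp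
    have eqs: "sd S {i,j} = sd (sd S {i}) {j}" "sd S {j} = sd (sd S {i,j}) {i}" "S = sd (sd S {j}) {j}"
      using ij by auto
    have "edge K (c S) (c (sd S {i}))" "edge K (c (sd S {i})) (c (sd S {i,j}))"
      "edge K (c (sd S {i,j})) (c (sd S {j}))" "edge K (c (sd S {j})) (c S)"
      using edge[OF S sub(1)] edge[OF sub(1,3)] edge[OF sub(3,2)] edge[OF sub(2) S] ij eqs
      by metis+
    then show ?thesis unfolding square_def using cell dist by (intro conjI)
  qed
  show ?thesis unfolding cube_frame_def
    by (intro conjI allI impI bij; (elim conjE)?; rule edge square; assumption)
qed

text \<open>Symmetric difference with the coordinates \<open>A\<close> of \<open>y\<close> is an
  automorphism of the standard cube that exchanges \<open>A\<close> and \<open>{}\<close> and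
  commutes with the change of a coordinate.\<close>

lemma cube_frame_rebase:
  assumes "cube_frame K n c C" and y: "y \<in> C"
  shows "\<exists>c'. cube_frame K n c' C \<and> c' {} = y"
proof -
  have bij: "bij_betw c (Pow {..<n}) C"
    and edge: "\<And>S T. S \<subseteq> {..<n} \<Longrightarrow> T \<subseteq> {..<n} \<Longrightarrow> (edge K (c S) (c T) \<longleftrightarrow> (\<exists>i<n. T = sd S {i}))"
    and sq: "\<And>S i j. S \<subseteq> {..<n} \<Longrightarrow> i < n \<Longrightarrow> j < n \<Longrightarrow> i \<noteq> j \<Longrightarrow>
        square K (c S) (c (sd S {i})) (c (sd S {i, j})) (c (sd S {j}))"
    using assms unfolding cube_frame_def by auto
  obtain A where A: "A \<subseteq> {..<n}" "c A = y" using bij y unfolding bij_betw_def by blast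
  let ?t = "\<lambda>S. sd S A"
  have t_sub: "\<And>S. S \<subseteq> {..<n} \<Longrightarrow> ?t S \<subseteq> {..<n}" using A by auto
  have t_sd: "\<And>S T. ?t (sd S T) = sd (?t S) T" by auto
  have "bij_betw ?t (Pow {..<n}) (Pow {..<n})"
    by (rule bij_betw_byWitness[where f' = ?t]) (use t_sub in auto)
  then have b: "bij_betw (c \<circ> ?t) (Pow {..<n}) C" using bij by (rule bij_betw_trans)
  have e: "edge K (c (?t S)) (c (?t T)) \<longleftrightarrow> (\<exists>i<n. T = sd S {i})"
    if "S \<subseteq> {..<n}" "T \<subseteq> {..<n}" for S T
  proof -
    have "\<And>i. ?t T = sd (?t S) {i} \<longleftrightarrow> T = sd S {i}" by blast
    then show ?thesis using edge[OF t_sub t_sub] that by simp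
  qed
  have "cube_frame K n (c \<circ> ?t) C" unfolding cube_frame_def
    using b e sq[OF t_sub] by (simp add: t_sd)
  moreover have "(c \<circ> ?t) {} = y" using A by simp
  ultimately show ?thesis by blast
qed

locale cube_cx =
  fixes K :: "'v set set"
  assumes cc: "cube_complex K"
begin

lemma frame_at:
  assumes "C \<in> K" "y \<in> C"
  obtains n c where "cube_frame K n c C" "c {} = y"
  using assms cc cube_frame_of_chart cube_frame_rebase unfolding cube_complex_def by metis

lemma card_cell: "C \<in> K \<Longrightarrow> \<exists>n. card C = 2 ^ n"
  using cc unfolding cube_complex_def cube_chart_def
  by (metis bij_betw_same_card card_Pow finite_lessThan card_lessThan)

text \<open>Two different squares with three common corners would meet in a cell with three
  vertices, but the number of vertices of a cell is a power of two.\<close>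

lemma square_unique:
  assumes "square K a b c d" "square K a b c e"
  shows "d = e"
proof (rule ccontr)
  assume "d \<noteq> e"
  have D: "distinct [a,b,c,d]" "{a,b,c,d} \<in> K" "distinct [a,b,c,e]" "{a,b,c,e} \<in> K"
    using assms by (auto simp: square_def)
  have "{a,b,c,d} \<inter> {a,b,c,e} = {a,b,c}" using \<open>d \<noteq> e\<close> D by auto
  then have "{a,b,c} \<in> K" using cc D unfolding cube_complex_def
    by (metis insert_not_empty)
  then obtain n where "card {a,b,c} = 2 ^ n" using card_cell by blast
  moreover have "card {a,b,c} = 3" using D by auto
  ultimately have n: "(2::nat) ^ n = 3" by simp
  moreover have "odd (3::nat)" by simp
  ultimately have "n = 0" by (metis even_power even_numeral neq0_conv)
  with n show False by simp
qed

lemma frame_neighbours: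
  assumes "cube_frame K n c C" "c {} = y"
  shows "{z \<in> C. edge K y z} = (\<lambda>i. c {i}) ` {..<n}" and "inj_on (\<lambda>i. c {i}) {..<n}"
proof -
  have bij: "bij_betw c (Pow {..<n}) C"
    and edge: "\<And>S T. S \<subseteq> {..<n} \<Longrightarrow> T \<subseteq> {..<n} \<Longrightarrow> (edge K (c S) (c T) \<longleftrightarrow> (\<exists>i<n. T = sd S {i}))"
    using assms unfolding cube_frame_def by auto
  show "{z \<in> C. edge K y z} = (\<lambda>i. c {i}) ` {..<n}"
  proof (intro equalityI subsetI)
    fix z assume z: "z \<in> {z \<in> C. edge K y z}"
    then have "z \<in> c ` Pow {..<n}" using bij by (simp add: bij_betw_def)
    then obtain T where T: "T \<subseteq> {..<n}" "z = c T" by auto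
    then have "edge K (c {}) (c T)" using z assms(2) by simp
    then show "z \<in> (\<lambda>i. c {i}) ` {..<n}" using edge[of "{}" T] T by auto
  next
    fix z assume "z \<in> (\<lambda>i. c {i}) ` {..<n}"
    then obtain i where i: "i < n" "z = c {i}" by auto
    then have "z \<in> C" using bij_betwE[OF bij] by simp
    moreover have "edge K y z" using edge[of "{}" "{i}"] i assms(2) by auto
    ultimately show "z \<in> {z \<in> C. edge K y z}" by auto
  qed
  show "inj_on (\<lambda>i. c {i}) {..<n}"
    using bij unfolding bij_betw_def inj_on_def by blast
qed

text \<open>A cell with four vertices is a 2-cube, so \<open>y\<close> has exactly two neighbours in
  it.\<close>

lemma square_link:
  assumes sq: "square K u x w y"
  shows "{u, w} \<in> link K y"
proof -
  let ?C = "{u,x,w,y}"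
  have C: "?C \<in> K" "distinct [u,x,w,y]" "edge K y u" "edge K w y"
    using sq by (auto simp: square_def)
  obtain n c where nc: "cube_frame K n c ?C" "c {} = y" using frame_at[OF C(1)] by blast
  have "bij_betw c (Pow {..<n}) ?C" using nc unfolding cube_frame_def by blast
  then have "2 ^ n = card ?C" by (metis bij_betw_same_card card_Pow finite_lessThan card_lessThan)
  also have "\<dots> = 4" using C by auto
  finally have n: "n = 2" using power_inject_exp[of "2::nat" n 2] by simp
  have card: "card {z \<in> ?C. edge K y z} = 2"
    using frame_neighbours[OF nc] n by (simp add: card_image)
  have "{u, w} \<subseteq> {z \<in> ?C. edge K y z}" using C edge_sym by auto
  moreover have "card {u,w} = 2" using C by auto
  ultimately have "{z \<in> ?C. edge K y z} = {u,w}"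
    using card by (metis (no_types, lifting) card_subset_eq card.infinite zero_neq_numeral)
  then show ?thesis unfolding link_def using C(1) by blast
qed

lemma edge_link:
  assumes "edge K y a"
  shows "{a} \<in> link K y"
proof -
  have "{z \<in> {y,a}. edge K y z} = {a}" using assms by (auto simp: edge_def)
  then show ?thesis unfolding link_def using assms by (auto simp: edge_def intro!: exI[of _ "{y,a}"])
qed

end

section \<open>Flips of edge paths\<close>

lemma square_perms:
  assumes "square K a b c d"
  shows "square K b c d a" "square K c d a b" "square K d a b c"
    "square K a d c b" "square K b a d c" "square K c b a d" "square K d c b a"
proof -
  show 1: "square K b c d a" "square K c d a b" "square K d a b c"
    using square_rotate[OF assms] square_rotate[OF square_rotate[OF assms]]
      square_rotate[OF square_rotate[OF square_rotate[OF assms]]] by simp_all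
  show "square K a d c b" "square K b a d c" "square K c b a d" "square K d c b a"
    using square_reflect[OF assms] square_reflect[OF 1(1)] square_reflect[OF 1(2)] square_reflect[OF 1(3)]
    by simp_all
qed

text \<open>The homotopies across squares, without the backtracks. They keep the length and both
  ends, and play the part of the commutation relations in a right-angled Coxeter group.\<close>

inductive flip :: "'v set set \<Rightarrow> 'v list \<Rightarrow> 'v list \<Rightarrow> bool" for K where
  flipI: "square K a b c d \<Longrightarrow> flip K (p @ [a, b, c] @ q) (p @ [a, d, c] @ q)"

abbreviation flips :: "'v set set \<Rightarrow> 'v list \<Rightarrow> 'v list \<Rightarrow> bool" where
  "flips K \<equiv> (flip K)\<^sup>*\<^sup>*"

lemma flip_sym: "flip K p q \<Longrightarrow> flip K q p"
  by (auto elim!: flip.cases intro!: flipI[simplified] square_reflect)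

lemma flips_sym: "flips K p q \<Longrightarrow> flips K q p"
  by (induction rule: rtranclp_induct) (auto intro: flip_sym converse_rtranclp_into_rtranclp)

lemma flip_length: "flip K p q \<Longrightarrow> length p = length q"
  and flip_hd: "flip K p q \<Longrightarrow> hd p = hd q"
  and flip_last: "flip K p q \<Longrightarrow> last p = last q"
  by (auto elim!: flip.cases simp: hd_append last_append)

lemma flips_length: "flips K p q \<Longrightarrow> length p = length q"
  by (induction rule: rtranclp_induct) (auto dest: flip_length)

lemma flips_hd: "flips K p q \<Longrightarrow> hd p = hd q"
  by (induction rule: rtranclp_induct) (auto dest: flip_hd)

lemma flips_last: "flips K p q \<Longrightarrow> last p = last q"
  by (induction rule: rtranclp_induct) (auto dest: flip_last)

lemma flip_append: "flip K p q \<Longrightarrow> flip K (p @ s) (q @ s)"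
  by (auto elim!: flip.cases) (metis append.assoc append_Cons append_Nil flipI)

lemma flips_append: "flips K p q \<Longrightarrow> flips K (p @ s) (q @ s)"
  by (induction rule: rtranclp_induct) (auto dest: flip_append intro: rtranclp.rtrancl_into_rtrancl)

lemma flips_square: "square K a b c d \<Longrightarrow> flips K (p @ [a, b, c]) (p @ [a, d, c])"
  using flipI[of K a b c d p "[]"] by auto

lemma flip_edge_path: "flip K p q \<Longrightarrow> edge_path K p \<Longrightarrow> edge_path K q"
proof (induction rule: flip.induct)
  case (flipI a b c d p q)
  then have "edge K a d" "edge K d c" "d \<in> verts K"
    by (auto simp: square_def edge_sym verts_def intro!: bexI[of _ "{a,b,c,d}"])
  then show ?case using flipI(2)
    by (auto simp: edge_path_def successively_append_iff successively_Cons)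
qed

lemma flips_edge_path: "flips K p q \<Longrightarrow> edge_path K p \<Longrightarrow> edge_path K q"
  by (induction rule: rtranclp_induct) (auto dest: flip_edge_path)

text \<open>Only a flip at the last corner changes the last edge; all others take place in the path
  without its last vertex.\<close>

lemma flip_snoc_cases:
  assumes "flip K (p @ [x, w]) Q"
  obtains (inner) q where "Q = q @ [x, w]" "flip K (p @ [x]) (q @ [x])"
  | (corner) r u y where "p = r @ [u]" "Q = r @ [u, y, w]" "square K u x w y"
  using assms
proof (cases rule: flip.cases)
  case (flipI a b c d p' q')
  show thesis
  proof (cases q' rule: rev_cases)
    case Nil
    then have "p = p' @ [a]" "x = b" "w = c" using flipI by auto
    then show thesis using flipI Nil corner by auto
  next
    case (snoc q'' z)
    then have z: "z = w" "p @ [x] = p' @ [a,b,c] @ q''" using flipI by auto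
    show thesis
    proof (cases q'' rule: rev_cases)
      case Nil
      then have "x = c" "p = p' @ [a,b]" using z by auto
      then show thesis using inner[of "p' @ [a,d]"] flipI snoc Nil z flip.flipI[OF flipI(3), of p' "[]"] by auto
    next
      case (snoc q3 z')
      then have "z' = x" "p = p' @ [a,b,c] @ q3" using z by auto
      then show thesis using inner[of "p' @ [a,d,c] @ q3"] flipI \<open>q' = q'' @ [z]\<close> snoc z
        flip.flipI[OF flipI(3), of p' "q3 @ [x]"] by auto
    qed
  qed
qed

lemma snoc2_cases:
  assumes "length Q = n + 2" "last Q = w"
  obtains q y where "Q = q @ [y, w]"
proof (cases Q rule: rev_cases)
  case (snoc Q' z)
  then show thesis using assms that by (cases Q' rule: rev_cases) auto
qed (use assms in auto)

definition backtracks :: "'v list \<Rightarrow> bool" where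
  "backtracks p \<longleftrightarrow> (\<exists>r x y s. p = r @ [x, y, x] @ s)"

definition reduced :: "'v set set \<Rightarrow> 'v list \<Rightarrow> bool" where
  "reduced K p \<longleftrightarrow> (\<forall>q. flips K p q \<longrightarrow> \<not> backtracks q)"

lemma reduced_no_backtracks: "reduced K p \<Longrightarrow> \<not> backtracks p"
  unfolding reduced_def by blast

lemma reduced_flips: "flips K p q \<Longrightarrow> reduced K p \<Longrightarrow> reduced K q"
  unfolding reduced_def by (meson rtranclp_trans)

lemma backtracks_append: "backtracks p \<Longrightarrow> backtracks (p @ s)"
  unfolding backtracks_def by (metis append.assoc)

lemma reduced_prefix: "reduced K (p @ s) \<Longrightarrow> reduced K p"
  unfolding reduced_def by (meson flips_append backtracks_append)

lemma not_reduced_flipsI: "flips K p q \<Longrightarrow> backtracks q \<Longrightarrow> \<not> reduced K p"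
  unfolding reduced_def by blast

lemma backtracks_end: "backtracks (r @ [x, y, x])"
  unfolding backtracks_def by (metis append_Nil2)

lemma backtracks_snoc:
  assumes "backtracks (q @ [y, x])" "\<not> backtracks (q @ [y])"
  shows "\<exists>r. q = r @ [x]"
proof -
  obtain r a b s where e: "q @ [y, x] = r @ [a, b, a] @ s" using assms unfolding backtracks_def by blast
  show ?thesis
  proof (cases s rule: rev_cases)
    case Nil then show ?thesis using e by auto
  next
    case (snoc s' z)
    then have "q @ [y] = r @ [a, b, a] @ s'" using e by auto
    then show ?thesis using assms(2) unfolding backtracks_def by blast
  qed
qed

section \<open>Last edges of flip-equivalent paths\<close>

locale cat0 = cube_cx K for K :: "'v set set" +
  assumes flag_links: "v \<in> verts K \<Longrightarrow> flag (link K v)"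
    and sc: "simply_connected_complex K"
begin

lemma edge_verts: "edge K x y \<Longrightarrow> x \<in> verts K \<and> y \<in> verts K"
  by (auto simp: edge_def verts_def)

text \<open>The neighbours \<open>u\<close>, \<open>u'\<close> and \<open>w\<close> of
  \<open>y\<close> pairwise span squares with it. Flagness provides a 3-cube at \<open>y\<close> in
  these directions, and uniqueness of squares identifies \<open>x\<close>, \<open>z\<close> and
  \<open>t\<close> with its corners; \<open>s\<close> is the corner opposite to
  \<open>y\<close>.\<close>

lemma three_squares:
  assumes s1: "square K u x w y" and s2: "square K u' y w z" and s3: "square K t u y u'"
  shows "\<exists>s. square K s x w z \<and> square K t u x s \<and> square K t u' z s"
proof -
  have e: "edge K y u" "edge K y u'" "edge K y w"
    using s1 s2 s3 by (auto simp: square_def edge_sym)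
  have y: "y \<in> verts K" using e edge_verts by blast
  have d: "u \<noteq> u'" "u \<noteq> w" "u' \<noteq> w" using s1 s2 s3 by (auto simp: square_def)
  have l1: "{u, w} \<in> link K y" using square_link[OF s1] .
  have l2: "{u', w} \<in> link K y" using square_link[of u' z w y] square_reflect[OF s2] by blast
  have "square K u t u' y" by (rule square_perms(5)[OF s3])
  then have l3: "{u, u'} \<in> link K y" by (rule square_link)
  have l4: "{u} \<in> link K y" "{u'} \<in> link K y" "{w} \<in> link K y" using edge_link e by auto
  let ?S = "{u, u', w}"
  have "?S \<subseteq> \<Union> (link K y)" using l4 by blast
  moreover have "\<forall>a\<in>?S. \<forall>b\<in>?S. {a, b} \<in> link K y" using l1 l2 l3 l4 by (auto simp: insert_commute)
  moreover have "finite ?S" by simp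
  ultimately have "?S \<in> link K y" using flag_links[OF y] unfolding flag_def by blast
  then obtain C where C: "C \<in> K" "y \<in> C" "?S = {z \<in> C. edge K y z}" unfolding link_def by blast
  obtain n c where nc: "cube_frame K n c C" "c {} = y" using frame_at[OF C(1,2)] by blast
  have S: "?S = (\<lambda>i. c {i}) ` {..<n}" using C(3) frame_neighbours(1)[OF nc] by simp
  obtain i where i: "i < n" "u = c {i}" using S by blast
  obtain j where j: "j < n" "u' = c {j}" using S by blast
  obtain k where k: "k < n" "w = c {k}" using S by blast
  have ijk: "i \<noteq> j" "i \<noteq> k" "j \<noteq> k" using d i j k by auto
  have sq: "\<And>S i j. S \<subseteq> {..<n} \<Longrightarrow> i < n \<Longrightarrow> j < n \<Longrightarrow> i \<noteq> j \<Longrightarrow>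
        square K (c S) (c (sd S {i})) (c (sd S {i, j})) (c (sd S {j}))"
    using nc(1) unfolding cube_frame_def by auto
  have "square K y u (c {i,k}) w" using sq[of "{}" i k] i k nc(2) ijk by simp
  from square_unique[OF square_perms(2)[OF s1] square_perms(3)[OF this]] have x: "x = c {i,k}" .
  have "square K y u' (c {j,k}) w" using sq[of "{}" j k] j k nc(2) ijk by simp
  from square_unique[OF s2 square_perms(5)[OF this]] have z: "z = c {j,k}" .
  have "square K y u (c {i,j}) u'" using sq[of "{}" i j] j i nc(2) ijk by simp
  from square_unique[OF square_perms(1)[OF s3] square_perms(5)[OF this]] have t: "t = c {i,j}" .
  have e1: "sd {k} {i} = {i,k}" "sd {k} {j} = {j,k}" "sd {k} {i,j} = {i,j,k}"
    "sd {i} {j} = {i,j}" "sd {i} {k} = {i,k}" "sd {i} {j,k} = {i,j,k}"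
    "sd {j} {i} = {i,j}" "sd {j} {k} = {j,k}" "sd {j} {i,k} = {i,j,k}"
    using ijk by auto
  have a: "square K w x (c {i,j,k}) z"
    using sq[of "{k}" i j] i(1) j(1) k(1) ijk unfolding e1 x z k(2) by simp
  have b: "square K u t (c {i,j,k}) x"
    using sq[of "{i}" j k] i(1) j(1) k(1) ijk unfolding e1 x t i(2) by simp
  have c: "square K u' t (c {i,j,k}) z"
    using sq[of "{j}" i k] i(1) j(1) k(1) ijk unfolding e1 t z j(2) by simp
  show ?thesis
    using square_perms(6)[OF a] square_perms(5)[OF b] square_perms(5)[OF c] by blast
qed

text \<open>In the transitivity step, two squares below a common vertex are completed to a 3-cube.\<close>

lemma flips_last_step:
  assumes "flips K (p @ [x, w]) (q @ [y, w])"
  shows "(x = y \<and> flips K (p @ [x]) (q @ [x])) \<or>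
    (\<exists>r u. square K u x w y \<and> flips K (r @ [u, x]) (p @ [x]) \<and> flips K (r @ [u, y]) (q @ [y]))"
  using assms
proof (induction "length p" arbitrary: p x w q y rule: less_induct)
  case less
  let ?alt = "\<lambda>q y. (x = y \<and> flips K (p @ [x]) (q @ [x])) \<or>
    (\<exists>r u. square K u x w y \<and> flips K (r @ [u, x]) (p @ [x]) \<and> flips K (r @ [u, y]) (q @ [y]))"
  have "\<forall>q y. Q = q @ [y, w] \<longrightarrow> ?alt q y" if "flips K (p @ [x, w]) Q" for Q
    using that
  proof (induction rule: rtranclp_induct)
    case base
    then show ?case by auto
  next
    case (step Q Q')
    have "length Q = length p + 2" "last Q = w"
      using flips_length[OF step(1)] flips_last[OF step(1)] by auto
    then obtain q y where Q: "Q = q @ [y, w]"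
      using snoc2_cases by metis
    then have alt: "?alt q y" using step.IH by blast
    show ?case
    proof (intro allI impI)
      fix q' z assume Q': "Q' = q' @ [z, w]"
      from step(2)[unfolded Q] show "?alt q' z"
      proof (cases rule: flip_snoc_cases)
        case (inner q2)
        then have e: "q2 = q'" "y = z" using Q' by auto
        have "flips K (q @ [z]) (q' @ [z])" using inner(2) e by simp
        then show ?thesis using alt unfolding e by (metis rtranclp_trans)
      next
        case (corner r' u' y')
        then have e: "y' = z" "q' = r' @ [u']" using Q' by auto
        have sq': "square K u' y w z" using corner e by simp
        from alt show ?thesis
        proof
          assume "x = y \<and> flips K (p @ [x]) (q @ [x])"
          then have "square K u' x w z" "flips K (r' @ [u', x]) (p @ [x])"
            using sq' corner(1) flips_sym by auto
          then show ?thesis using e by auto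
        next
          assume "\<exists>r u. square K u x w y \<and> flips K (r @ [u, x]) (p @ [x]) \<and> flips K (r @ [u, y]) (q @ [y])"
          then obtain r u where ru: "square K u x w y" "flips K (r @ [u, x]) (p @ [x])"
            "flips K (r @ [u, y]) (r' @ [u', y])" using corner(1) by auto
          \<comment> \<open>Both paths in \<open>ru(3)\<close> end at \<open>y\<close>, so the
            induction hypothesis compares their last edges, which start at \<open>u\<close> and
            \<open>u'\<close>.\<close>
          have len: "length r < length p" using flips_length[OF ru(2)] by auto
          from less.hyps[OF len ru(3)] show ?thesis
          proof
            assume "u = u' \<and> flips K (r @ [u]) (r' @ [u])"
            then have a: "u' = u" "flips K (r @ [u]) (r' @ [u])" by auto
            have "square K u y w z" using sq' a by simp
            from square_unique[OF square_perms(2)[OF ru(1)] square_perms(6)[OF this]] have "x = z" .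
            moreover have "flips K (r @ [u, x]) (r' @ [u, x])"
              using flips_append[OF a(2), of "[x]"] by simp
            ultimately have "flips K (p @ [x]) (q' @ [x])"
              using flips_sym[OF ru(2)] e a by simp
            then show ?thesis using \<open>x = z\<close> by simp
          next
            assume "\<exists>s t. square K t u y u' \<and> flips K (s @ [t, u]) (r @ [u]) \<and> flips K (s @ [t, u']) (r' @ [u'])"
            then obtain s t where st: "square K t u y u'" "flips K (s @ [t, u]) (r @ [u])"
              "flips K (s @ [t, u']) (r' @ [u'])" by blast
            obtain s0 where s0: "square K s0 x w z" "square K t u x s0" "square K t u' z s0"
              using three_squares[OF ru(1) sq' st(1)] by blast
            have "flips K (s @ [t, s0, x]) (s @ [t, u, x])"
              by (rule flips_square[OF square_reflect[OF s0(2)]])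
            moreover have "flips K (s @ [t, u, x]) (r @ [u, x])"
              using flips_append[OF st(2), of "[x]"] by simp
            ultimately have f1: "flips K ((s @ [t]) @ [s0, x]) (p @ [x])" using ru(2) by simp
            have "flips K (s @ [t, s0, z]) (s @ [t, u', z])"
              by (rule flips_square[OF square_reflect[OF s0(3)]])
            moreover have "flips K (s @ [t, u', z]) (r' @ [u', z])"
              using flips_append[OF st(3), of "[z]"] by simp
            ultimately have f2: "flips K ((s @ [t]) @ [s0, z]) (q' @ [z])" using e by simp
            show ?thesis using s0(1) f1 f2 by blast
          qed
        qed
      qed
    qed
  qed
  then show ?case using less.prems by blast
qed

text \<open>The exchange condition of Coxeter groups, for edge paths.\<close>

lemma reduced_snoc:
  assumes "reduced K (p @ [w])" "\<not> reduced K (p @ [w, x])"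
  shows "\<exists>q. flips K (p @ [w]) (q @ [x, w])"
  using assms
proof (induction "length p" arbitrary: p w x rule: less_induct)
  case less
  obtain Q where Q: "flips K (p @ [w, x]) Q" "backtracks Q"
    using less.prems(2) unfolding reduced_def by blast
  have "length Q = length p + 2" "last Q = x"
    using flips_length[OF Q(1)] flips_last[OF Q(1)] by auto
  then obtain q' y where Q': "Q = q' @ [y, x]"
    using snoc2_cases by metis
  have nb: "\<exists>q''. q' = q'' @ [x]" if "reduced K (q' @ [y])"
    using backtracks_snoc[of q' y x] Q(2) Q' reduced_no_backtracks[OF that] by blast
  from flips_last_step[OF Q(1)[unfolded Q']] show ?case
  proof
    assume a: "w = y \<and> flips K (p @ [w]) (q' @ [w])"
    then have "reduced K (q' @ [y])" using less.prems(1) reduced_flips by blast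
    then show ?thesis using nb a by auto
  next
    assume "\<exists>r u. square K u w x y \<and> flips K (r @ [u, w]) (p @ [w]) \<and> flips K (r @ [u, y]) (q' @ [y])"
    then obtain r u where ru: "square K u w x y" "flips K (r @ [u, w]) (p @ [w])" "flips K (r @ [u, y]) (q' @ [y])"
      by blast
    show ?thesis
    proof (cases "reduced K (q' @ [y])")
      case True
      then obtain q'' where q'': "q' = q'' @ [x]" using nb by blast
      have "u \<noteq> x" using ru(1) by (auto simp: square_def)
      then obtain s t where st: "square K t u y x" "flips K (s @ [t, u]) (r @ [u])"
        using flips_last_step[of r u y q'' x] ru(3) q'' by auto
      \<comment> \<open>The two squares share \<open>u\<close>, \<open>x\<close> and
        \<open>y\<close>. Hence \<open>w\<close> precedes \<open>u\<close> on a path in the class of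
        \<open>r @ [u]\<close>, and going on to \<open>w\<close> is a backtrack.\<close>
      have "t = w" by (rule square_unique[OF square_perms(7)[OF st(1)] square_perms(2)[OF ru(1)]])
      then have "flips K (s @ [w, u, w]) (r @ [u, w])" using flips_append[OF st(2), of "[w]"] by simp
      from rtranclp_trans[OF flips_sym[OF ru(2)] flips_sym[OF this]]
      have "\<not> reduced K (p @ [w])" using not_reduced_flipsI backtracks_end by metis
      then show ?thesis using less.prems(1) by blast
    next
      case False
      \<comment> \<open>Appending \<open>y\<close> fails to be reduced already after
        \<open>r @ [u]\<close>. The induction hypothesis rewrites this shorter path so that it ends
        in \<open>y, u\<close>, and the square turns \<open>y, u, w\<close> into
        \<open>y, x, w\<close>.\<close>
      have nr: "\<not> reduced K (r @ [u, y])" using False ru(3) reduced_flips by blast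
      have "reduced K ((r @ [u]) @ [w])" using less.prems(1) ru(2) reduced_flips flips_sym by fastforce
      then have r: "reduced K (r @ [u])" by (rule reduced_prefix)
      have "length r < length p" using flips_length[OF ru(2)] by auto
      then obtain q2 where q2: "flips K (r @ [u]) (q2 @ [y, u])" using less.hyps r nr by blast
      have "flips K (p @ [w]) (r @ [u, w])" using ru(2) flips_sym by blast
      also have "flips K (r @ [u, w]) (q2 @ [y, u, w])" using flips_append[OF q2, of "[w]"] by simp
      also have "flips K (q2 @ [y, u, w]) (q2 @ [y, x, w])"
        by (rule flips_square[OF square_perms(3)[OF ru(1)]])
      finally have "flips K (p @ [w]) ((q2 @ [y]) @ [x, w])" by simp
      then show ?thesis by blast
    qed
  qed
qed

end

section \<open>Uniqueness of reduced paths\<close>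

text \<open>
  The edges act on the flip classes of reduced paths: \<open>p'\<close> arises from \<open>p\<close> by appending an edge or
  by cancelling one. This relation is symmetric, so every move can be undone.
\<close>

definition moves :: "'v set set \<Rightarrow> 'v list \<Rightarrow> 'v list \<Rightarrow> bool" where
  "moves K p p' \<longleftrightarrow> edge_path K p \<and> edge_path K p' \<and> reduced K p \<and> reduced K p' \<and>
     (flips K (p @ [last p']) p' \<or> flips K (p' @ [last p]) p)"

primrec follows :: "'v set set \<Rightarrow> 'v list \<Rightarrow> 'v list \<Rightarrow> 'v list \<Rightarrow> bool" where
  "follows K p [] p' \<longleftrightarrow> edge_path K p \<and> reduced K p \<and> flips K p p'"
| "follows K p (x # xs) p' \<longleftrightarrow> (\<exists>q. moves K p q \<and> last q = x \<and> follows K q xs p')"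

lemma moves_sym: "moves K p p' \<Longrightarrow> moves K p' p"
  unfolding moves_def by blast

lemma moves_flips:
  assumes m: "moves K p p'" and f: "flips K p q" "flips K p' q'"
  shows "moves K q q'"
proof -
  have "flips K (q @ [last q']) q'" if "flips K (p @ [last p']) p'"
    using flips_append[OF flips_sym[OF f(1)], of "[last p']"] that f(2) flips_last[OF f(2)] by simp
  moreover have "flips K (q' @ [last q]) q" if "flips K (p' @ [last p]) p"
    using flips_append[OF flips_sym[OF f(2)], of "[last p]"] that f(1) flips_last[OF f(1)] by simp
  ultimately show ?thesis using m f flips_edge_path reduced_flips unfolding moves_def by metis
qed

lemma follows_flips_left: "flips K p q \<Longrightarrow> follows K p xs p' \<Longrightarrow> follows K q xs p'"
proof (cases xs)
  case Nil
  assume f: "flips K p q" "follows K p xs p'"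
  have "flips K q p'" using flips_sym[OF f(1)] f(2) Nil by auto
  then show ?thesis using f Nil flips_edge_path reduced_flips by auto
next
  case (Cons x l)
  assume f: "flips K p q" "follows K p xs p'"
  then show ?thesis using Cons moves_flips[OF _ f(1)] by auto
qed

lemma follows_append: "follows K p (xs @ ys) p' \<longleftrightarrow> (\<exists>q. follows K p xs q \<and> follows K q ys p')"
proof (induction xs arbitrary: p)
  case Nil
  have "follows K p ys p' \<Longrightarrow> \<exists>q. (edge_path K p \<and> reduced K p \<and> flips K p q) \<and> follows K q ys p'"
    by (rule exI[of _ p], cases ys) (auto simp: moves_def)
  then show ?case by (auto intro: follows_flips_left flips_sym)
qed auto

lemma follows_reduced: "follows K p xs p' \<Longrightarrow> edge_path K p \<and> reduced K p \<and> edge_path K p' \<and> reduced K p'"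
proof (induction xs arbitrary: p)
  case Nil
  then show ?case using flips_edge_path reduced_flips by auto
next
  case (Cons x xs)
  then show ?case by (auto simp: moves_def)
qed

lemma follows_last: "follows K p xs p' \<Longrightarrow> last p' = last (last p # xs)"
  by (induction xs arbitrary: p) (auto dest: flips_last)

lemma follows_rev: "follows K p xs q \<Longrightarrow> follows K q (tl (rev (last p # xs))) p"
proof (induction xs arbitrary: p)
  case Nil
  then show ?case using flips_sym flips_edge_path reduced_flips by auto
next
  case (Cons x xs)
  then obtain r where r: "moves K p r" "last r = x" "follows K r xs q" by auto
  have "follows K q (tl (rev (x # xs))) r" using Cons.IH[OF r(3)] r(2) by simp
  moreover have "follows K r [last p] p" using moves_sym[OF r(1)] by (auto simp: moves_def)
  moreover have "tl (rev (last p # x # xs)) = tl (rev (x # xs)) @ [last p]"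
    by (cases "rev xs") auto
  ultimately show ?case using follows_append by metis
qed

lemma edge_path_prefix: "edge_path K (p @ s) \<Longrightarrow> p \<noteq> [] \<Longrightarrow> edge_path K p"
  by (auto simp: edge_path_def successively_append_iff)

lemma last_snoc_ex: "p \<noteq> [] \<Longrightarrow> \<exists>q. p = q @ [last p]"
  by (metis append_butlast_last_id)

context cat0
begin

text \<open>If appending \<open>x\<close> does not give a reduced path, the exchange condition
  brings the edge from \<open>x\<close> to the end of \<open>p\<close>, where it can be
  cancelled.\<close>

lemma moves_ex:
  assumes p: "edge_path K p" "reduced K p" and e: "edge K (last p) x"
  shows "\<exists>q. moves K p q \<and> last q = x"
proof (cases "reduced K (p @ [x])")
  case True
  have "edge_path K (p @ [x])" using p e edge_verts[OF e]
    by (auto simp: edge_path_def successively_append_iff)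
  then show ?thesis using True p by (intro exI[of _ "p @ [x]"]) (auto simp: moves_def)
next
  case False
  obtain p0 where p0: "p = p0 @ [last p]" using p last_snoc_ex unfolding edge_path_def by blast
  obtain q where q: "flips K p (q @ [x, last p])"
    using reduced_snoc[of p0 "last p" x] p0 p(2) False by (metis append.assoc append_Cons append_Nil)
  have "edge_path K ((q @ [x]) @ [last p])" "reduced K ((q @ [x]) @ [last p])"
    using q p flips_edge_path reduced_flips by fastforce+
  then have "edge_path K (q @ [x])" "reduced K (q @ [x])"
    using edge_path_prefix reduced_prefix by blast+
  then show ?thesis using p flips_sym[OF q] by (intro exI[of _ "q @ [x]"]) (auto simp: moves_def)
qed

lemma flips_snoc_cancel: "flips K (p @ [x, w]) (q @ [x, w]) \<Longrightarrow> flips K (p @ [x]) (q @ [x])"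
  using flips_last_step[of p x w q x] by (auto simp: square_def)

text \<open>Appending and cancelling the same edge exclude each other: if the class of
  \<open>p\<close> contains a path ending in \<open>x, w\<close>, then \<open>p @ [x]\<close> flips
  to a path with a backtrack. Two cancellations agree because flip-equivalent paths with the same
  last edge stay equivalent without it.\<close>

lemma moves_unique:
  assumes m1: "moves K p p1" and m2: "moves K p p2" and l: "last p1 = last p2"
  shows "flips K p1 p2"
proof -
  let ?x = "last p1" and ?w = "last p"
  have red: "reduced K p1" "reduced K p2" "reduced K p" "p1 \<noteq> []" "p2 \<noteq> []"
    using m1 m2 by (auto simp: moves_def edge_path_def)
  have key: False if a: "flips K (p @ [?x]) r" "reduced K r" and b: "flips K (s @ [?w]) p"
    and s: "s \<noteq> []" "last s = ?x" for r s
  proof -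
    obtain s0 where s0: "s = s0 @ [?x]" using s last_snoc_ex by metis
    have "flips K (s0 @ [?x, ?w, ?x]) (p @ [?x])" using flips_append[OF b, of "[?x]"] s0 by simp
    then have "flips K r (s0 @ [?x, ?w, ?x])" using flips_sym a(1) by (meson rtranclp_trans)
    then show False using a(2) not_reduced_flipsI backtracks_end by metis
  qed
  consider "flips K (p @ [?x]) p1" "flips K (p @ [?x]) p2" | "flips K (p @ [?x]) p1" "flips K (p2 @ [?w]) p"
    | "flips K (p1 @ [?w]) p" "flips K (p @ [?x]) p2" | "flips K (p1 @ [?w]) p" "flips K (p2 @ [?w]) p"
    using m1 m2 l unfolding moves_def by metis
  then show ?thesis
  proof cases
    case 1
    then show ?thesis using flips_sym by (meson rtranclp_trans)
  next
    case 2
    then show ?thesis using key[OF 2(1) red(1) 2(2) red(5)] l by simp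
  next
    case 3
    then show ?thesis using key[OF 3(2) red(2) 3(1) red(4)] l by simp
  next
    case 4
    obtain a b where ab: "p1 = a @ [?x]" "p2 = b @ [?x]" using red l last_snoc_ex by metis
    have "flips K (p1 @ [?w]) (p2 @ [?w])" using 4 flips_sym by (meson rtranclp_trans)
    then have "flips K (a @ [?x, ?w]) (b @ [?x, ?w])"
      using ab by (metis append.assoc append_Cons append_Nil)
    then show ?thesis using flips_snoc_cancel ab by metis
  qed
qed

text \<open>Since moves are unique up to flips, it suffices to find one path \<open>r\<close> ending
  in \<open>z\<close> to which both \<open>p1\<close> and \<open>p3\<close> move. In the case names,
  R stands for appending and D for cancelling, first for the move to \<open>x\<close> and then for
  the move to \<open>y\<close>.\<close>

lemma moves_square:
  assumes sq: "square K (last p) x z y"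
    and m1: "moves K p p1" "last p1 = x" and m2: "moves K p1 p2" "last p2 = z"
    and m3: "moves K p p3" "last p3 = y"
  shows "moves K p3 p2"
proof -
  let ?w = "last p"
  have ep: "edge_path K p" "edge_path K p1" "edge_path K p2" "edge_path K p3" and
    red: "reduced K p" "reduced K p1" "reduced K p2" "reduced K p3"
    using m1 m2 m3 by (auto simp: moves_def)
  then have ne: "p \<noteq> []" "p1 \<noteq> []" "p2 \<noteq> []" "p3 \<noteq> []" by (auto simp: edge_path_def)
  obtain p0 where p0: "p = p0 @ [?w]" using last_snoc_ex ne by blast
  have xy: "x \<noteq> y" "?w \<noteq> z" using sq by (auto simp: square_def)
  have suff: ?thesis if "moves K p1 r" "moves K p3 r" "last r = z" for r
    using moves_flips[OF that(2) _ moves_unique[OF that(1) m2(1)]] that(3) m2(2) by auto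
  have mixed: "\<exists>r. moves K q1 r \<and> moves K q3 r \<and> last r = z"
    if sq: "square K ?w x z y" and q: "edge_path K q1" "edge_path K q3" "reduced K q1" "reduced K q3"
    "last q1 = x" "last q3 = y" and R: "flips K (p @ [x]) q1" and D: "flips K (q3 @ [?w]) p" for q1 q3 x y
  proof -
    have "q3 \<noteq> []" using q by (auto simp: edge_path_def)
    then obtain b where b: "q3 = b @ [y]" using last_snoc_ex q(6) by metis
    have "flips K (b @ [y, ?w, x]) (p @ [x])" using flips_append[OF D, of "[x]"] b by simp
    then have "flips K (b @ [y, ?w, x]) q1" using R by simp
    moreover have "flips K (b @ [y, z, x]) (b @ [y, ?w, x])"
      by (rule flips_square[OF square_perms(7)[OF sq]])
    ultimately have f: "flips K ((b @ [y, z]) @ [x]) q1" by simp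
    have "edge_path K ((b @ [y, z]) @ [x])" "reduced K ((b @ [y, z]) @ [x])"
      using flips_edge_path[OF flips_sym[OF f]] reduced_flips[OF flips_sym[OF f]] q by auto
    then have r: "edge_path K (b @ [y, z])" "reduced K (b @ [y, z])"
      using edge_path_prefix[of K "b @ [y, z]"] reduced_prefix by blast+
    have "moves K q1 (b @ [y, z])" unfolding moves_def using r q f by simp
    moreover have "moves K q3 (b @ [y, z])" unfolding moves_def using r q b by simp
    ultimately show ?thesis by (intro exI[of _ "b @ [y, z]"]) simp
  qed
  consider (RR) "flips K (p @ [x]) p1" "flips K (p @ [y]) p3" | (RD) "flips K (p @ [x]) p1" "flips K (p3 @ [?w]) p"
    | (DR) "flips K (p1 @ [?w]) p" "flips K (p @ [y]) p3" | (DD) "flips K (p1 @ [?w]) p" "flips K (p3 @ [?w]) p"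
    using m1 m3 unfolding moves_def by metis
  then show ?thesis
  proof cases
    case RD
    then show ?thesis using mixed[OF sq ep(2,4) red(2,4) m1(2) m3(2)] suff by blast
  next
    case DR
    then show ?thesis using mixed[OF square_reflect[OF sq] ep(4,2) red(4,2) m3(2) m1(2)] suff by blast
  next
    case DD
    obtain a where a: "p1 = a @ [x]" using last_snoc_ex[OF ne(2)] m1(2) by auto
    obtain b where b: "p3 = b @ [y]" using last_snoc_ex[OF ne(4)] m3(2) by auto
    have "flips K (p1 @ [?w]) (p3 @ [?w])" using DD flips_sym by (meson rtranclp_trans)
    then have "flips K (a @ [x, ?w]) (b @ [y, ?w])" using a b by simp
    from flips_last_step[OF this] xy obtain r u where ru: "square K u x ?w y"
      "flips K (r @ [u, x]) p1" "flips K (r @ [u, y]) p3" using a b by auto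
    have "u = z" by (rule square_unique[OF square_perms(1)[OF ru(1)] square_perms(5)[OF sq]])
    then have f: "flips K ((r @ [z]) @ [x]) p1" "flips K ((r @ [z]) @ [y]) p3" using ru by auto
    have "edge_path K ((r @ [z]) @ [x])" "reduced K ((r @ [z]) @ [x])"
      using flips_edge_path[OF flips_sym[OF f(1)]] reduced_flips[OF flips_sym[OF f(1)]] ep red by auto
    then have r: "edge_path K (r @ [z])" "reduced K (r @ [z])"
      using edge_path_prefix reduced_prefix by blast+
    have "moves K p1 (r @ [z])" "moves K p3 (r @ [z])" unfolding moves_def using r ep red f m1 m3 by auto
    then show ?thesis using suff by simp
  next
    case RR
    have rx: "reduced K (p @ [x])" "reduced K (p @ [y])"
      using RR red reduced_flips flips_sym by blast+
    have exy: "edge_path K (p @ [x])" "edge_path K (p @ [y])"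
      using RR ep flips_edge_path flips_sym by blast+
    have ez: "edge K x z" "edge K y z" "z \<in> verts K" using sq edge_verts by (auto simp: square_def edge_sym)
    have exz: "edge_path K (p @ [x, z])" "edge_path K (p @ [y, z])"
      using exy ez by (auto simp: edge_path_def successively_append_iff)
    have fxy: "flips K (p @ [x, z]) (p @ [y, z])"
      using flips_square[OF sq, of p0] p0 by (metis append.assoc append_Cons append_Nil)
    show ?thesis
    proof (cases "reduced K (p @ [x, z])")
      case True
      then have "reduced K (p @ [y, z])" using fxy reduced_flips by blast
      have f1: "flips K (p1 @ [z]) (p @ [x, z])" using flips_append[OF flips_sym[OF RR(1)], of "[z]"] by simp
      have "flips K (p3 @ [z]) (p @ [y, z])" using flips_append[OF flips_sym[OF RR(2)], of "[z]"] by simp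
      then have "flips K (p3 @ [z]) (p @ [x, z])" using flips_sym[OF fxy] by simp
      then have "moves K p1 (p @ [x, z])" "moves K p3 (p @ [x, z])"
        unfolding moves_def using f1 ep red exz True by auto
      then show ?thesis using suff by simp
    next
      case False
      \<comment> \<open>By the exchange condition \<open>z\<close> can precede \<open>x\<close>. The
        resulting square has \<open>y\<close> as its fourth corner, so that \<open>p\<close> flips
        to a path whose last but one vertex is \<open>y\<close>; appending \<open>y\<close> would
        then be a backtrack.\<close>
      then obtain q where q: "flips K (p @ [x]) (q @ [z, x])" using reduced_snoc[of p x z] rx by auto
      then have "flips K (p0 @ [?w, x]) (q @ [z, x])" using p0 by (metis append.assoc append_Cons append_Nil)
      from flips_last_step[OF this] xy p0 obtain r u where ru: "square K u ?w x z"
        "flips K (r @ [u, ?w]) p" by auto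
      have "u = y" by (rule square_unique[OF square_perms(1)[OF ru(1)] sq])
      then have "flips K (r @ [y, ?w, y]) (p @ [y])" using flips_append[OF ru(2), of "[y]"] by simp
      then have "\<not> reduced K (p @ [y])" using flips_sym not_reduced_flipsI backtracks_end by metis
      then show ?thesis using rx by blast
    qed
  qed
qed

section \<open>Homotopic edge paths act alike\<close>

lemma follows_unique:
  "follows K p xs p1 \<Longrightarrow> follows K p xs p2 \<Longrightarrow> flips K p1 p2"
proof (induction xs arbitrary: p)
  case Nil
  then have "flips K p p1" "flips K p p2" by auto
  then show ?case using flips_sym by (meson rtranclp_trans)
next
  case (Cons x xs)
  then obtain q1 q2 where q: "moves K p q1" "last q1 = x" "follows K q1 xs p1"
    "moves K p q2" "last q2 = x" "follows K q2 xs p2" by auto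
  have "flips K q2 q1" using moves_unique q by metis
  then show ?case using Cons.IH[OF q(3)] follows_flips_left q(6) by blast
qed

lemma follows_backtrack:
  assumes p: "edge_path K p" "reduced K p" and e: "edge K (last p) y"
  shows "follows K p (y # last p # q) p' \<longleftrightarrow> follows K p q p'"
proof
  assume "follows K p (y # last p # q) p'"
  then obtain r s where r: "moves K p r" "last r = y" "moves K r s" "last s = last p" "follows K s q p'" by auto
  then have "flips K s p" using moves_unique[of r s p] moves_sym by blast
  then show "follows K p q p'" using r(5) follows_flips_left by blast
next
  assume a: "follows K p q p'"
  obtain r where r: "moves K p r" "last r = y" using moves_ex[OF p e] by blast
  then have "moves K r p" using moves_sym by blast
  then show "follows K p (y # last p # q) p'" using r a by auto
qed

lemma follows_square:
  assumes sq: "square K (last p) b c d" and f: "follows K p (b # c # q) p'"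
  shows "follows K p (d # c # q) p'"
proof -
  obtain r s where r: "moves K p r" "last r = b" "moves K r s" "last s = c" "follows K s q p'"
    using f by auto
  have "edge K (last p) d" using sq by (auto simp: square_def edge_sym)
  then obtain r' where r': "moves K p r'" "last r' = d" using moves_ex r(1) unfolding moves_def by blast
  have "moves K r' s" using moves_square[OF sq r(1-4) r'] .
  then show ?thesis using r r' by auto
qed

lemma follows_elem_homotopy:
  assumes "elem_homotopy K P Q" and v: "hd P = v" "v \<in> verts K"
  shows "hd Q = v \<and> (follows K [v] (tl P) p' \<longleftrightarrow> follows K [v] (tl Q) p')"
proof -
  \<comment> \<open>The path is cut at the vertex where the homotopy begins. Every class reached
    there ends in that vertex, so \<open>follows_backtrack\<close> and \<open>follows_square\<close>
    apply to the rest.\<close>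
  have split: "follows K [v] (tl (p @ [a] @ l)) p' \<longleftrightarrow> (\<exists>r. last r = a \<and> edge_path K r \<and> reduced K r \<and>
      follows K [v] (tl (p @ [a])) r \<and> follows K r l p')" if "hd (p @ [a]) = v" for p a l
  proof -
    have t: "tl (p @ [a] @ l) = tl (p @ [a]) @ l" by (cases p) auto
    have "last r = a" if "follows K [v] (tl (p @ [a])) r" for r
      using follows_last[OF that] \<open>hd (p @ [a]) = v\<close> by (cases p) auto
    then show ?thesis unfolding t follows_append using follows_reduced by blast
  qed
  from assms(1) show ?thesis
  proof cases
    case (backtrack x y p q)
    have h: "hd (p @ [x]) = v" using v backtrack by (cases p) auto
    have "follows K r (y # x # q) p' \<longleftrightarrow> follows K r q p'" if "last r = x" "edge_path K r" "reduced K r" for r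
      using follows_backtrack[of r y] that backtrack by auto
    moreover have "P = p @ [x] @ y # x # q" "Q = p @ [x] @ q" using backtrack by auto
    ultimately have "follows K [v] (tl P) p' \<longleftrightarrow> follows K [v] (tl Q) p'"
      by (simp only: split[OF h] cong: conj_cong)
    then show ?thesis using h backtrack by (cases p) auto
  next
    case (across a b c d p q)
    have h: "hd (p @ [a]) = v" using v across by (cases p) auto
    have "follows K r (b # c # q) p' \<longleftrightarrow> follows K r (d # c # q) p'" if "last r = a" for r
      using follows_square[of r b c d q p'] follows_square[of r d c b q p'] that across(3)
        square_reflect[OF across(3)] by blast
    moreover have "P = p @ [a] @ b # c # q" "Q = p @ [a] @ d # c # q" using across by auto
    ultimately have "follows K [v] (tl P) p' \<longleftrightarrow> follows K [v] (tl Q) p'"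
      by (simp only: split[OF h] cong: conj_cong)
    then show ?thesis using h across by (cases p) auto
  qed
qed

lemma reduced_singleton: "reduced K [v]"
proof -
  have "\<not> backtracks q" if "flips K [v] q" for q
    using flips_length[OF that] unfolding backtracks_def by auto
  then show ?thesis unfolding reduced_def by auto
qed

lemma follows_homotopic:
  assumes "equivclp (elem_homotopy K) P Q" and v: "hd P = v" "v \<in> verts K"
  shows "hd Q = v \<and> (follows K [v] (tl P) p' \<longleftrightarrow> follows K [v] (tl Q) p')"
  using assms(1)
proof (induction rule: equivclp_induct)
  case base
  then show ?case using v by auto
next
  case (step Q R)
  from step(2) show ?case
  proof
    assume "elem_homotopy K Q R"
    then show ?thesis using follows_elem_homotopy[of Q R v p'] step(3) v by auto
  next
    assume e: "elem_homotopy K R Q"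
    then have "hd R = hd Q"
      by cases (auto simp: hd_append)
    then show ?thesis using follows_elem_homotopy[of R Q v p'] step(3) v e by auto
  qed
qed

lemma follows_self:
  assumes "edge_path K (v # xs)" "reduced K (v # xs)"
  shows "follows K [v] xs (v # xs)"
  using assms
proof (induction xs rule: rev_induct)
  case Nil
  then show ?case by auto
next
  case (snoc x xs)
  have "edge_path K (v # xs)" "reduced K (v # xs)"
    using snoc.prems reduced_prefix[of K "v # xs" "[x]"] edge_path_prefix[of K "v # xs" "[x]"] by auto
  moreover from this have "moves K (v # xs) (v # xs @ [x])" using snoc.prems unfolding moves_def by auto
  then have "follows K (v # xs) [x] (v # xs @ [x])" using snoc.prems by auto
  ultimately show ?case using snoc.IH follows_append by metis
qed

lemma edge_path_rev: "edge_path K P \<Longrightarrow> edge_path K (rev P)"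
  unfolding edge_path_def by (auto intro: successively_mono edge_sym)

text \<open>The loop along \<open>P\<close> and back along \<open>Q\<close> is contractible, hence
  brings the class of the constant path back to itself. Its first half leads to the class of
  \<open>P\<close>; undoing its second half shows that \<open>Q\<close> leads to the same
  class.\<close>

lemma reduced_paths_unique:
  assumes P: "edge_path K P" "reduced K P" and Q: "edge_path K Q" "reduced K Q"
    and ends: "hd P = hd Q" "last P = last Q"
  shows "flips K P Q"
proof -
  obtain v ps where ps: "P = v # ps" using P unfolding edge_path_def by (cases P) auto
  obtain qs where qs: "Q = v # qs" using Q ends ps unfolding edge_path_def by (cases Q) auto
  have v: "v \<in> verts K" using P ps by (auto simp: edge_path_def)
  let ?L = "P @ tl (rev Q)"
  obtain w l where rQ: "rev Q = w # l" using qs by (cases "rev Q") auto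
  then have w: "w = last P" using ends(2) by (metis hd_rev list.sel(1))
  have eL: "edge_path K ?L"
    using P edge_path_rev[OF Q(1)] rQ w unfolding edge_path_def
    by (cases l) (auto simp: successively_append_iff successively_Cons)
  have lL: "last ?L = v"
  proof (cases l)
    case Nil
    then have "Q = [w]" using rQ by (metis rev_singleton_conv)
    then show ?thesis using qs w Nil rQ by auto
  next
    case (Cons a b)
    then have "last ?L = last (rev Q)" using rQ by auto
    then show ?thesis using qs by (simp add: last_rev)
  qed
  have hL: "hd ?L = v" using ps by simp
  have "equivclp (elem_homotopy K) ?L [v]"
    using sc eL lL hL unfolding simply_connected_complex_def by metis
  from follows_homotopic[OF this hL v, of "[v]"]
  have "follows K [v] (tl ?L) [v] \<longleftrightarrow> follows K [v] [] [v]" by simp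
  moreover have "follows K [v] [] [v]" using v reduced_singleton by (auto simp: edge_path_def)
  ultimately have "follows K [v] (ps @ tl (rev Q)) [v]" using ps by simp
  then obtain R where R: "follows K [v] ps R" "follows K R (tl (rev Q)) [v]" using follows_append by metis
  have PR: "flips K R P" using follows_unique[OF R(1)] follows_self P ps by auto
  have lR: "last R = last Q" using flips_last[OF PR] ends by simp
  have "tl (rev (last R # tl (rev Q))) = qs"
  proof -
    have "last R # tl (rev Q) = rev Q" unfolding rQ using lR w ends by simp
    then show ?thesis using qs by (metis list.sel(3) rev_rev_ident)
  qed
  then have "follows K [v] qs R" using follows_rev[OF R(2)] by simp
  then have "flips K R Q" using follows_unique follows_self Q qs by metis
  then show ?thesis using flips_sym[OF PR] by simp
qed

end

section \<open>Distances and half-spaces\<close>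

lemma relpowp_edge_path:
  assumes "x \<in> verts K"
  shows "(edge K ^^ n) x y \<longleftrightarrow> (\<exists>P. edge_path K P \<and> hd P = x \<and> last P = y \<and> length P = Suc n)"
proof (induction n arbitrary: y)
  case 0
  show ?case
  proof
    assume "(edge K ^^ 0) x y"
    then show "\<exists>P. edge_path K P \<and> hd P = x \<and> last P = y \<and> length P = Suc 0"
      using assms by (intro exI[of _ "[x]"]) (auto simp: edge_path_def)
  qed (auto simp: length_Suc_conv)
next
  case (Suc n)
  show ?case
  proof
    assume "(edge K ^^ Suc n) x y"
    then obtain z where z: "(edge K ^^ n) x z" "edge K z y" by auto
    then obtain P where P: "edge_path K P" "hd P = x" "last P = z" "length P = Suc n" using Suc by auto
    have "y \<in> verts K" using z(2) by (auto simp: edge_def verts_def)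
    then have "edge_path K (P @ [y])" using P z by (auto simp: edge_path_def successively_append_iff)
    then show "\<exists>P. edge_path K P \<and> hd P = x \<and> last P = y \<and> length P = Suc (Suc n)"
      using P by (intro exI[of _ "P @ [y]"]) (auto simp: edge_path_def hd_append)
  next
    assume "\<exists>P. edge_path K P \<and> hd P = x \<and> last P = y \<and> length P = Suc (Suc n)"
    then obtain P where P: "edge_path K P" "hd P = x" "last P = y" "length P = Suc (Suc n)" by blast
    obtain Q where Q: "P = Q @ [y]" using P last_snoc_ex[of P] unfolding edge_path_def by auto
    then have "Q \<noteq> []" using P by auto
    moreover from this have "edge_path K Q" using P Q edge_path_prefix[of K Q "[y]"] by auto
    moreover have "edge K (last Q) y" using P Q calculation by (auto simp: edge_path_def successively_append_iff)
    moreover have "(edge K ^^ n) x (last Q)" using Suc P Q calculation by auto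
    ultimately show "(edge K ^^ Suc n) x y" by auto
  qed
qed

lemma relpowp_edge_sym: "(edge K ^^ n) x y \<Longrightarrow> (edge K ^^ n) y x"
proof (induction n arbitrary: y)
  case (Suc n)
  then obtain z where "(edge K ^^ n) x z" "edge K z y" by auto
  then show ?case using Suc.IH edge_sym relpowp_Suc_I2 by metis
qed auto

definition side :: "'v set set \<Rightarrow> 'v \<Rightarrow> 'v \<Rightarrow> 'v set" where
  "side K x y = {w \<in> verts K. vdist K w y < vdist K w x}"

text \<open>Each hyperplane between \<open>x\<close> and \<open>y\<close> is represented once, by
  its half-space on the side of \<open>y\<close>, so that the cardinality is the distance without a
  factor 2.\<close>

definition seps :: "'v set set \<Rightarrow> 'v \<Rightarrow> 'v \<Rightarrow> 'v set set" where
  "seps K x y = {H \<in> half_spaces K. x \<notin> H \<and> y \<in> H}"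

definition hs_of :: "'v set set \<Rightarrow> 'v \<Rightarrow> 'v set set" where
  "hs_of K x = {H \<in> half_spaces K. x \<in> H}"

context cat0
begin

section \<open>Distance, geodesics and the quadrangle condition\<close>

lemma dist_le: "(edge K ^^ n) x y \<Longrightarrow> vdist K x y \<le> n"
  unfolding vdist_def by (rule Least_le)

lemma dist_path:
  assumes "x \<in> verts K" "y \<in> verts K"
  shows "(edge K ^^ vdist K x y) x y"
proof -
  obtain p where p: "edge_path K p" "hd p = x" "last p = y"
    using sc assms unfolding simply_connected_complex_def connected_complex_def by blast
  then have "(edge K ^^ (length p - 1)) x y" using relpowp_edge_path[OF assms(1)]
    unfolding edge_path_def by auto
  then show ?thesis unfolding vdist_def by (rule LeastI)
qed

lemma dist_self [simp]: "vdist K x x = 0"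
  using dist_le[of 0 x x] by simp

lemma dist_eq_0: "x \<in> verts K \<Longrightarrow> y \<in> verts K \<Longrightarrow> vdist K x y = 0 \<longleftrightarrow> x = y"
  using dist_path[of x y] by auto

lemma dist_sym: "x \<in> verts K \<Longrightarrow> y \<in> verts K \<Longrightarrow> vdist K x y = vdist K y x"
  by (meson dist_le dist_path relpowp_edge_sym le_antisym)

lemma dist_triangle:
  assumes "x \<in> verts K" "y \<in> verts K" "z \<in> verts K"
  shows "vdist K x z \<le> vdist K x y + vdist K y z"
  using dist_path[OF assms(1,2)] dist_path[OF assms(2,3)]
  by (intro dist_le) (auto simp: relpowp_add)

lemma dist_edge:
  assumes "edge K x y"
  shows "vdist K x y = 1"
proof -
  have "(edge K ^^ 1) x y" using assms by (simp only: relpowp_1)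
  then have "vdist K x y \<le> 1" by (rule dist_le)
  moreover have "vdist K x y \<noteq> 0" using dist_eq_0 edge_verts[OF assms] assms by (auto simp: edge_def)
  ultimately show ?thesis by simp
qed

lemma dist_1_edge: "x \<in> verts K \<Longrightarrow> y \<in> verts K \<Longrightarrow> vdist K x y = 1 \<Longrightarrow> edge K x y"
  using dist_path[of x y] by (simp only: relpowp_1)

lemma geodesic_reduced:
  assumes P: "edge_path K P" and len: "length P = Suc (vdist K (hd P) (last P))"
  shows "reduced K P"
proof (rule ccontr)
  assume "\<not> reduced K P"
  then obtain r x y s where f: "flips K P (r @ [x, y, x] @ s)"
    unfolding reduced_def backtracks_def by blast
  have e: "edge_path K (r @ [x, y, x] @ s)" using flips_edge_path[OF f P] .
  have e': "edge_path K (r @ [x] @ s)"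
    using e by (auto simp: edge_path_def successively_append_iff successively_Cons)
  have "hd (r @ [x] @ s) = hd P" "last (r @ [x] @ s) = last P"
    using flips_hd[OF f] flips_last[OF f] by (auto simp: hd_append)
  moreover have "hd P \<in> verts K" using P by (auto simp: edge_path_def)
  ultimately have "(edge K ^^ (length (r @ [x] @ s) - 1)) (hd P) (last P)"
    using e' relpowp_edge_path[of "hd P" K] by auto
  then have "vdist K (hd P) (last P) \<le> length (r @ [x] @ s) - 1" by (rule dist_le)
  then show False using len flips_length[OF f] by simp
qed

lemma geodesic_ex:
  assumes "x \<in> verts K" "y \<in> verts K"
  obtains P where "edge_path K P" "hd P = x" "last P = y" "length P = Suc (vdist K x y)" "reduced K P"
  using dist_path[OF assms] relpowp_edge_path[OF assms(1)] geodesic_reduced by metis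

text \<open>A reduced path is a flip of a geodesic with the same ends, and flips preserve the
  length.\<close>

lemma reduced_length:
  assumes "edge_path K P" "reduced K P"
  shows "length P = Suc (vdist K (hd P) (last P))"
proof -
  have "hd P \<in> verts K" "last P \<in> verts K" using assms by (auto simp: edge_path_def)
  then obtain Q where Q: "edge_path K Q" "hd Q = hd P" "last Q = last P"
    "length Q = Suc (vdist K (hd P) (last P))" "reduced K Q" using geodesic_ex by metis
  then show ?thesis using flips_length[OF reduced_paths_unique[OF assms Q(1,5)]] by simp
qed

text \<open>A move along an edge either appends one vertex to a reduced path or cancels one;
  adjacent vertices are thus never equally far from \<open>v\<close>.\<close>

lemma dist_parity:
  assumes v: "v \<in> verts K" and e: "edge K w x"
  shows "vdist K v x = Suc (vdist K v w) \<or> vdist K v w = Suc (vdist K v x)"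
proof -
  obtain p where p: "edge_path K p" "hd p = v" "last p = w" "length p = Suc (vdist K v w)" "reduced K p"
    using geodesic_ex v e edge_verts by metis
  obtain q where q: "moves K p q" "last q = x" using moves_ex p e by blast
  then have q': "edge_path K q" "reduced K q" "flips K (p @ [x]) q \<or> flips K (q @ [w]) p"
    using p by (auto simp: moves_def)
  have ne: "p \<noteq> []" "q \<noteq> []" using p q' by (auto simp: edge_path_def)
  have "hd q = v" using q'(3) flips_hd p(2) ne by (metis hd_append2)
  then have "length q = Suc (vdist K v x)" using reduced_length q' q by metis
  moreover have "length q = Suc (length p) \<or> length p = Suc (length q)"
    using q'(3) flips_length by force
  ultimately show ?thesis using p(4) by auto
qed

lemma down_neighbour:
  assumes "v \<in> verts K" "w \<in> verts K" "vdist K v w = Suc n"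
  obtains x where "edge K x w" "vdist K v x = n"
proof -
  have "(edge K ^^ Suc n) v w" using dist_path assms by metis
  then obtain x where x: "(edge K ^^ n) v x" "edge K x w" by auto
  have "vdist K v x \<le> n" using dist_le x by blast
  then have "vdist K v x = n" using dist_parity[OF assms(1) x(2)] assms(3) by auto
  then show thesis using that x by blast
qed

text \<open>The geodesics to \<open>w\<close> through \<open>x\<close> and through \<open>y\<close>
  are reduced, hence flip-equivalent, and comparing their last edges yields the square. The path to
  \<open>u\<close> obtained on the way is one edge shorter than the one to \<open>x\<close>.\<close>

lemma quadrangle:
  assumes v: "v \<in> verts K" and e: "edge K x w" "edge K y w" and xy: "x \<noteq> y"
    and d: "vdist K v w = Suc (vdist K v x)" "vdist K v w = Suc (vdist K v y)"
  obtains u where "square K u x w y" "Suc (vdist K v u) = vdist K v x"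
proof -
  have geo: "\<exists>p. edge_path K (p @ [x, w]) \<and> hd (p @ [x, w]) = v \<and> reduced K (p @ [x, w]) \<and> length p = vdist K v x"
    if e: "edge K x w" and d: "vdist K v w = Suc (vdist K v x)" for x
  proof -
    obtain P where P: "edge_path K P" "hd P = v" "last P = x" "length P = Suc (vdist K v x)" "reduced K P"
      using geodesic_ex v e edge_verts by metis
    obtain p where p: "P = p @ [x]" using P last_snoc_ex unfolding edge_path_def by metis
    have "edge_path K (P @ [w])" using P e edge_verts by (auto simp: edge_path_def successively_append_iff)
    moreover have "hd (P @ [w]) = v" using P p by (cases p) auto
    moreover have "reduced K (P @ [w])" using geodesic_reduced calculation P d by auto
    ultimately show ?thesis using p P by auto
  qed
  obtain p where p: "edge_path K (p @ [x, w])" "hd (p @ [x, w]) = v" "reduced K (p @ [x, w])" "length p = vdist K v x"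
    using geo[OF e(1) d(1)] by blast
  obtain q where q: "edge_path K (q @ [y, w])" "hd (q @ [y, w]) = v" "reduced K (q @ [y, w])"
    using geo[OF e(2) d(2)] by blast
  have "flips K (p @ [x, w]) (q @ [y, w])" using reduced_paths_unique p q by simp
  then obtain r u where ru: "square K u x w y" "flips K (r @ [u, x]) (p @ [x])"
    using flips_last_step xy by blast
  have "edge_path K ((p @ [x]) @ [w])" using p by simp
  then have "edge_path K (p @ [x])" by (rule edge_path_prefix) simp
  then have "edge_path K ((r @ [u]) @ [x])" using flips_edge_path[OF flips_sym[OF ru(2)]] by simp
  then have eru: "edge_path K (r @ [u])" by (rule edge_path_prefix) simp
  have "hd (r @ [u, x]) = hd (p @ [x])" using flips_hd[OF ru(2)] .
  also have "\<dots> = v" using p(2) by (cases p) auto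
  finally have "hd (r @ [u]) = v" by (cases r) auto
  then have "(edge K ^^ length r) v u" using relpowp_edge_path[OF v, of "length r" u] eru by auto
  then have "vdist K v u \<le> length r" by (rule dist_le)
  moreover have "Suc (length r) = vdist K v x" using flips_length[OF ru(2)] p(4) by simp
  moreover have "edge K u x" using ru(1) by (auto simp: square_def)
  then have "vdist K v x = Suc (vdist K v u) \<or> vdist K v u = Suc (vdist K v x)" using dist_parity[OF v] by blast
  ultimately have "Suc (vdist K v u) = vdist K v x" by linarith
  then show thesis using that ru(1) by blast
qed

section \<open>Half-spaces as sides of edges\<close>

lemma square_side_aux:
  assumes sq: "square K a b c d" and w: "w \<in> verts K" and l: "vdist K w b < vdist K w a"
  shows "vdist K w c < vdist K w d"
proof (rule ccontr)
  assume n: "\<not> vdist K w c < vdist K w d"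
  have e: "edge K a b" "edge K b c" "edge K c d" "edge K d a" using sq by (auto simp: square_def)
  have 1: "vdist K w a = Suc (vdist K w b)" "vdist K w c = Suc (vdist K w d)"
    using l n dist_parity[OF w e(1)] dist_parity[OF w e(3)] by auto
  then have 2: "vdist K w d = vdist K w b"
    using dist_parity[OF w e(2)] dist_parity[OF w e(4)] by arith
  \<comment> \<open>Now \<open>b\<close> and \<open>d\<close> are both nearer to \<open>w\<close>
    than \<open>a\<close>. The quadrangle condition closes them to a square whose fourth corner must
    be \<open>c\<close>, and this would make \<open>c\<close> nearer than \<open>d\<close>.\<close>
  have bd: "b \<noteq> d" using sq by (auto simp: square_def)
  have wd: "vdist K w a = Suc (vdist K w d)" using 1 2 by simp
  obtain u where u: "square K u b a d" "Suc (vdist K w u) = vdist K w b"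
    by (rule quadrangle[OF w edge_sym[OF e(1)] e(4) bd 1(1) wd])
  have "c = u" by (rule square_unique[OF square_perms(5)[OF sq] square_perms(1)[OF u(1)]])
  then show False using u 1 2 by simp
qed

lemma square_side:
  assumes sq: "square K a b c d"
  shows "side K a b = side K d c"
  using square_side_aux[OF sq] square_side_aux[OF square_perms(7)[OF sq]] by (auto simp: side_def)

lemma opposite_sym:
  assumes "opposite K e e'"
  shows "opposite K e' e"
proof -
  obtain a b c d where "square K a b c d" "e = {a, b}" "e' = {d, c}"
    using assms unfolding opposite_def by blast
  then show ?thesis unfolding opposite_def using square_perms(7)[of K a b c d] by blast
qed

lemma opposite_side:
  assumes "opposite K e e'" "e = {p, q}" "edge K p q"
  shows "\<exists>p' q'. e' = {p', q'} \<and> edge K p' q' \<and> side K p' q' = side K p q"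
proof -
  obtain a b c d where s: "square K a b c d" "e = {a, b}" "e' = {d, c}"
    using assms(1) unfolding opposite_def by blast
  have e: "edge K d c" "edge K c d" using s(1) edge_sym by (auto simp: square_def)
  have "(p = a \<and> q = b) \<or> (p = b \<and> q = a)" using assms(2) s(2) by (auto simp: doubleton_eq_iff)
  then show ?thesis
  proof
    assume "p = a \<and> q = b"
    then show ?thesis using s e square_side[OF s(1)] by metis
  next
    assume "p = b \<and> q = a"
    then show ?thesis using s e square_side[OF square_perms(5)[OF s(1)]] by (metis insert_commute)
  qed
qed

lemma hyperplane_side:
  assumes "edge K x y" "e \<in> dual_hyperplane K {x, y}"
  shows "\<exists>p q. e = {p, q} \<and> edge K p q \<and> side K p q = side K x y"
proof -
  have "equivclp (opposite K) {x, y} e" using assms(2) by (simp add: dual_hyperplane_def)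
  then show ?thesis
  proof (induction rule: equivclp_induct)
    case base
    then show ?case using assms(1) by blast
  next
    case (step e e')
    then show ?case using opposite_side opposite_sym by metis
  qed
qed

lemma side_cases:
  assumes "edge K x y" "w \<in> verts K"
  shows "w \<in> side K x y \<longleftrightarrow> w \<notin> side K y x"
  using dist_parity[OF assms(2,1)] assms(2) unfolding side_def by auto

lemma side_ends:
  assumes "edge K x y"
  shows "y \<in> side K x y" "x \<notin> side K x y"
  using dist_edge[OF assms] dist_edge[OF edge_sym[OF assms]] edge_verts[OF assms] unfolding side_def by auto

text \<open>Induction on the distance from \<open>p\<close> to \<open>y\<close>. A neighbour
  \<open>p'\<close> of \<open>p\<close> nearer to \<open>y\<close> is, like \<open>q\<close>, nearer
  to \<open>x\<close> than \<open>p\<close>; the quadrangle condition towards \<open>x\<close> gives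
  a square in which \<open>{p', u}\<close> is opposite to \<open>{p, q}\<close>. This edge again
  leaves the side, one step closer to \<open>y\<close>.\<close>

lemma crossing_edge:
  assumes xy: "edge K x y" and pq: "edge K p q" and p: "p \<in> side K x y" and q: "q \<notin> side K x y"
  shows "{p, q} \<in> dual_hyperplane K {x, y}"
  using pq p q
proof (induction "vdist K p y" arbitrary: p q)
  case 0
  note v = edge_verts[OF xy] edge_verts[OF "0.prems"(1)]
  have p: "p = y" using 0 v dist_eq_0 by auto
  have "vdist K q x < vdist K q y" using 0 side_cases[OF xy] v by (auto simp: side_def)
  moreover have "vdist K q y = 1" using dist_edge[OF edge_sym[OF "0.prems"(1)]] p by simp
  ultimately have "q = x" using v dist_eq_0 by auto
  then show ?case using p by (auto simp: dual_hyperplane_def insert_commute)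
next
  case (Suc n)
  note pq = Suc.prems(1)
  note v = edge_verts[OF xy] edge_verts[OF pq]
  have px: "vdist K p x = Suc (Suc n)"
    using Suc.hyps(2) Suc.prems(2) dist_parity[of p x y] v xy unfolding side_def by auto
  have qx0: "vdist K q y = Suc (vdist K q x)"
    using Suc.prems(3) dist_parity[of q x y] v xy unfolding side_def by auto
  have "vdist K y p = Suc n" using Suc.hyps(2) v dist_sym by auto
  then obtain p' where p': "edge K p' p" "vdist K y p' = n" using down_neighbour v by metis
  note v' = edge_verts[OF p'(1)]
  have dqx: "vdist K x q = Suc n"
  proof -
    have "vdist K x p = Suc (vdist K x q) \<or> vdist K x q = Suc (vdist K x p)"
      "vdist K y p = Suc (vdist K y q) \<or> vdist K y q = Suc (vdist K y p)"
      using dist_parity[OF _ pq] v by auto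
    moreover have "vdist K x p = vdist K p x" "vdist K y p = vdist K p y"
      "vdist K x q = vdist K q x" "vdist K y q = vdist K q y" using v dist_sym by blast+
    ultimately show ?thesis using px qx0 Suc.hyps(2) by arith
  qed
  have dp'x: "vdist K x p' = Suc n"
  proof -
    have "vdist K x p = Suc (vdist K x p') \<or> vdist K x p' = Suc (vdist K x p)"
      using dist_parity[of x p' p] p' v by auto
    moreover have "vdist K p' x \<le> Suc n"
      using dist_triangle[of p' y x] p' v v' dist_edge[OF edge_sym[OF xy]] dist_sym[of p' y] by auto
    moreover have "vdist K x p = vdist K p x" "vdist K x p' = vdist K p' x" using v v' dist_sym by blast+
    ultimately show ?thesis using px by arith
  qed
  have dqy: "vdist K q y = Suc (Suc n)" using qx0 dqx v dist_sym[of q] by simp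
  have "p' \<noteq> q" using dqy p'(2) v dist_sym[of q y] by auto
  then obtain u where u: "square K u q p p'" "Suc (vdist K x u) = Suc n"
    using quadrangle[of x q p p'] v v' edge_sym[OF pq] p'(1) dqx dp'x px dist_sym[of p x] by metis
  have eu: "edge K u q" "edge K p' u" using u(1) by (auto simp: square_def)
  note v'' = edge_verts[OF eu(1)]
  have p's: "p' \<in> side K x y" unfolding side_def using v v' p'(2) dp'x dist_sym[of p'] by simp
  have "vdist K u y = Suc (vdist K q y) \<or> vdist K q y = Suc (vdist K u y)"
    using dist_parity[of y q u] edge_sym[OF eu(1)] v v'' dist_sym[of y] by auto
  then have us: "u \<notin> side K x y" unfolding side_def using dqy u(2) v v'' dist_sym[of u x] by auto
  have "n = vdist K p' y" using p'(2) v v' dist_sym by simp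
  from Suc.hyps(1)[OF this eu(2) p's us] have "equivclp (opposite K) {x, y} {p', u}"
    by (simp add: dual_hyperplane_def)
  moreover have "opposite K {p', u} {p, q}" unfolding opposite_def
    using square_perms(3)[OF u(1)] by blast
  ultimately show ?case unfolding dual_hyperplane_def
    by (auto intro: equivclp_into_equivclp)
qed

text \<open>Paths avoiding the hyperplane cannot leave the side, since every edge that leaves it
  belongs to the hyperplane. Conversely, geodesics to \<open>y\<close> from a vertex of the side
  stay in it, and an edge of the hyperplane never has both ends on one side.\<close>

lemma component_eq_side:
  assumes xy: "edge K x y" and w: "w \<in> side K x y"
  shows "component_avoiding K (dual_hyperplane K {x, y}) w = side K x y"
proof -
  let ?h = "dual_hyperplane K {x, y}"
  let ?R = "\<lambda>a b. edge K a b \<and> {a, b} \<notin> ?h"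
  note v = edge_verts[OF xy]
  have Rsym: "?R a b \<Longrightarrow> ?R b a" for a b using edge_sym by (auto simp: insert_commute)
  have sub: "?R\<^sup>*\<^sup>* w a \<Longrightarrow> a \<in> side K x y" for a
  proof (induction rule: rtranclp_induct)
    case (step a b)
    then show ?case using crossing_edge[OF xy] by blast
  qed (use w in simp)
  have y: "?R\<^sup>*\<^sup>* a y" if "a \<in> side K x y" for a
    using that
  proof (induction "vdist K y a" arbitrary: a)
    case 0
    then show ?case using dist_eq_0 v by (auto simp: side_def)
  next
    case (Suc n)
    then have a: "a \<in> verts K" "vdist K a y < vdist K a x" by (auto simp: side_def)
    obtain b where b: "edge K b a" "vdist K y b = n" using down_neighbour Suc.hyps(2) v a by metis
    note vb = edge_verts[OF b(1)]
    have "vdist K a x \<le> 1 + vdist K b x" using dist_triangle[of a b x] dist_edge[OF edge_sym[OF b(1)]] vb v by auto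
    then have bs: "b \<in> side K x y" unfolding side_def using a vb v b(2) Suc.hyps(2) dist_sym[of a y] dist_sym[of b y] by auto
    have "{a, b} \<notin> ?h"
    proof
      assume "{a, b} \<in> ?h"
      then obtain p q where pq: "{a, b} = {p, q}" "edge K p q" "side K p q = side K x y"
        using hyperplane_side xy by blast
      then have "p \<in> side K x y" using Suc.prems bs by (metis insertCI insertE singletonD)
      then show False using side_ends(2)[OF pq(2)] pq(3) by simp
    qed
    then have "?R a b" using b edge_sym by auto
    moreover have "?R\<^sup>*\<^sup>* b y" using Suc.hyps(1) bs b(2) by simp
    ultimately show ?case by (rule converse_rtranclp_into_rtranclp)
  qed
  have sym: "?R\<^sup>*\<^sup>* a b \<Longrightarrow> ?R\<^sup>*\<^sup>* b a" for a b
  proof (induction rule: rtranclp_induct)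
    case (step b c)
    then show ?case using converse_rtranclp_into_rtranclp[of ?R c b a] Rsym by blast
  qed simp
  show ?thesis unfolding component_avoiding_def
  proof (intro equalityI subsetI)
    fix a assume "a \<in> {b. ?R\<^sup>*\<^sup>* w b}" then show "a \<in> side K x y" using sub by simp
  next
    fix a assume "a \<in> side K x y"
    then have "?R\<^sup>*\<^sup>* w a" using y[OF w] sym[OF y] by (metis (no_types, lifting) rtranclp_trans)
    then show "a \<in> {b. ?R\<^sup>*\<^sup>* w b}" by simp
  qed
qed

lemma dual_half_space_side: "edge K x y \<Longrightarrow> dual_half_space K x y = side K x y"
  unfolding dual_half_space_def using component_eq_side side_ends(1) by blast

lemma half_spaces_eq: "half_spaces K = {side K x y | x y. edge K x y}"
proof (intro equalityI subsetI)
  fix H assume "H \<in> half_spaces K"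
  then obtain x y w where h: "edge K x y" "w \<in> verts K" "H = component_avoiding K (dual_hyperplane K {x, y}) w"
    unfolding half_spaces_def hyperplanes_def by blast
  show "H \<in> {side K x y | x y. edge K x y}"
  proof (cases "w \<in> side K x y")
    case True
    then show ?thesis using h component_eq_side by blast
  next
    case False
    then have "w \<in> side K y x" using side_cases h by blast
    then have "H = side K y x" using component_eq_side[OF edge_sym[OF h(1)]] h by (simp add: insert_commute)
    then show ?thesis using edge_sym[OF h(1)] by blast
  qed
next
  fix H assume "H \<in> {side K x y | x y. edge K x y}"
  then obtain x y where h: "edge K x y" "H = side K x y" by blast
  then have "H = component_avoiding K (dual_hyperplane K {x, y}) y" "dual_hyperplane K {x,y} \<in> hyperplanes K" "y \<in> verts K"
    using component_eq_side side_ends(1) edge_verts unfolding hyperplanes_def by auto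
  then show "H \<in> half_spaces K" unfolding half_spaces_def by blast
qed

lemma side_half_space: "edge K x y \<Longrightarrow> side K x y \<in> half_spaces K"
  unfolding half_spaces_eq by blast

lemma co_side: "edge K x y \<Longrightarrow> co K (side K x y) = side K y x"
  unfolding co_def using side_cases by (auto simp: side_def)

lemma half_space_sub: "H \<in> half_spaces K \<Longrightarrow> H \<subseteq> verts K"
  unfolding half_spaces_eq side_def by auto

lemma co_half_space: "H \<in> half_spaces K \<Longrightarrow> co K H \<in> half_spaces K"
  unfolding half_spaces_eq using co_side edge_sym by fastforce

lemma co_co: "H \<in> half_spaces K \<Longrightarrow> co K (co K H) = H"
  using half_space_sub unfolding co_def by blast

lemma half_space_ne: "H \<in> half_spaces K \<Longrightarrow> H \<noteq> {}"
  unfolding half_spaces_eq using side_ends(1) by blast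

lemma co_mem: "x \<in> verts K \<Longrightarrow> x \<in> co K H \<longleftrightarrow> x \<notin> H"
  by (simp add: co_def)

section \<open>Distance and separating half-spaces\<close>

lemma crossed_half_space:
  assumes "H \<in> half_spaces K" "edge K p q" "p \<notin> H" "q \<in> H"
  shows "H = side K p q"
proof -
  obtain x y where xy: "edge K x y" "H = side K x y" using assms(1) unfolding half_spaces_eq by blast
  have "{q, p} \<in> dual_hyperplane K {x, y}"
    using crossing_edge[OF xy(1) edge_sym[OF assms(2)]] assms xy by blast
  then obtain p' q' where pq: "{q, p} = {p', q'}" "edge K p' q'" "side K p' q' = side K x y"
    using hyperplane_side xy by blast
  have "q' \<in> H" "p' \<notin> H" using side_ends[OF pq(2)] pq(3) xy by auto
  then have "p' = p" "q' = q" using pq(1) assms(3,4) by (auto simp: doubleton_eq_iff)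
  then show ?thesis using pq xy by simp
qed

text \<open>The last edge of a geodesic crosses only its own hyperplane, and this one has not been
  crossed before: \<open>z\<close> and \<open>x\<close> are both outside
  \<open>side K z y\<close>.\<close>

lemma card_seps_aux:
  assumes x: "x \<in> verts K"
  shows "y \<in> verts K \<Longrightarrow> vdist K x y = n \<Longrightarrow> finite (seps K x y) \<and> card (seps K x y) = n"
proof (induction n arbitrary: y)
  case 0
  then have "x = y" using x dist_eq_0 by simp
  then show ?case by (auto simp: seps_def)
next
  case (Suc n)
  obtain z where z: "edge K z y" "vdist K x z = n" using down_neighbour x Suc.prems by metis
  note vz = edge_verts[OF z(1)]
  have xs: "x \<notin> side K z y" "x \<in> side K y z" using z Suc.prems x unfolding side_def by auto
  have "seps K x y = insert (side K z y) (seps K x z)"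
  proof (intro equalityI subsetI)
    fix H assume "H \<in> seps K x y"
    then show "H \<in> insert (side K z y) (seps K x z)"
      using crossed_half_space[OF _ z(1)] unfolding seps_def by auto
  next
    fix H assume H: "H \<in> insert (side K z y) (seps K x z)"
    show "H \<in> seps K x y"
    proof (cases "H = side K z y")
      case True
      then show ?thesis using xs side_ends[OF z(1)] side_half_space[OF z(1)] by (auto simp: seps_def)
    next
      case False
      then have H: "H \<in> half_spaces K" "x \<notin> H" "z \<in> H" using H by (auto simp: seps_def)
      then have "y \<in> H" using crossed_half_space[OF H(1) edge_sym[OF z(1)]] xs by blast
      then show ?thesis using H by (auto simp: seps_def)
    qed
  qed
  moreover have "side K z y \<notin> seps K x z" using side_ends[OF z(1)] by (auto simp: seps_def)
  ultimately show ?case using Suc.IH vz z(2) by simp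
qed

lemma finite_seps: "x \<in> verts K \<Longrightarrow> y \<in> verts K \<Longrightarrow> finite (seps K x y)"
  and card_seps: "x \<in> verts K \<Longrightarrow> y \<in> verts K \<Longrightarrow> card (seps K x y) = vdist K x y"
  using card_seps_aux by blast+

lemma seps_edge: "edge K x y \<Longrightarrow> seps K x y = {side K x y}"
  using crossed_half_space side_half_space side_ends unfolding seps_def by blast

section \<open>Realizing orientations by vertices\<close>

lemma hs_of_diff: "hs_of K y - hs_of K x = seps K x y"
  unfolding hs_of_def seps_def by blast

lemma hs_of_inj: "x \<in> verts K \<Longrightarrow> y \<in> verts K \<Longrightarrow> hs_of K x = hs_of K y \<Longrightarrow> x = y"
  using card_seps[of x y] hs_of_diff[of y x] dist_eq_0 by simp

text \<open>Among the members of \<open>u\<close> that miss \<open>x\<close>, choose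
  \<open>H\<close> containing a vertex \<open>y\<close> nearest to \<open>x\<close>. If a geodesic
  from \<open>x\<close> ended in \<open>b, a, y\<close>, minimality would keep
  \<open>side K b a\<close> out of \<open>u\<close>, so that \<open>side K a b\<close> and
  \<open>H = side K a y\<close> meet. From a common vertex, the quadrangle condition at
  \<open>a\<close> yields a neighbour \<open>v\<close> of \<open>b\<close> that lies in
  \<open>H\<close> and is nearer to \<open>x\<close> than \<open>y\<close>.\<close>

lemma realization_aux:
  assumes u: "u \<subseteq> half_spaces K" "\<And>H. H \<in> half_spaces K \<Longrightarrow> (H \<in> u) \<noteq> (co K H \<in> u)"
    and int: "\<And>H H'. H \<in> u \<Longrightarrow> H' \<in> u \<Longrightarrow> H \<inter> H' \<noteq> {}"
    and x: "x \<in> verts K" and ne: "u - hs_of K x \<noteq> {}"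
  shows "\<exists>x'. edge K x x' \<and> side K x x' \<in> u"
proof -
  let ?P = "\<lambda>n. \<exists>H y. H \<in> u \<and> x \<notin> H \<and> y \<in> H \<and> vdist K x y = n"
  have "\<exists>n. ?P n" using ne u(1) half_space_ne unfolding hs_of_def by blast
  then obtain n where n: "?P n" "\<And>m. m < n \<Longrightarrow> \<not> ?P m"
    using exists_least_iff[of ?P] by blast
  then obtain H y where H: "H \<in> u" "x \<notin> H" "y \<in> H" "vdist K x y = n" by blast
  have hH: "H \<in> half_spaces K" using H u by blast
  have y: "y \<in> verts K" using half_space_sub hH H by blast
  have "n \<noteq> 0" using H x y dist_eq_0 by blast
  then obtain m where m: "n = Suc m" by (cases n) auto
  obtain a where a: "edge K a y" "vdist K x a = m" using down_neighbour x y H(4) m by metis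
  note va = edge_verts[OF a(1)]
  have "a \<notin> H" using n(2)[of m] H a m by auto
  then have Hs: "H = side K a y" using crossed_half_space hH a(1) H(3) by blast
  show ?thesis
  proof (cases m)
    case 0
    then have "a = x" using a x va dist_eq_0 by auto
    then show ?thesis using a Hs H by blast
  next
    case (Suc k)
    obtain b where b: "edge K b a" "vdist K x b = k" using down_neighbour x va a(2) Suc by metis
    note vb = edge_verts[OF b(1)]
    let ?N = "side K b a"
    have xN: "x \<notin> ?N" using x b a Suc unfolding side_def by auto
    have "?N \<notin> u" using n(2)[of m] xN side_ends(1)[OF b(1)] a m by blast
    then have "co K ?N \<in> u" using u(2) side_half_space[OF b(1)] by blast
    then have "side K a b \<in> u" using co_side[OF b(1)] by simp
    then obtain z where z: "z \<in> side K a y" "z \<in> side K a b" using int[OF H(1)] Hs by blast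
    then have zv: "z \<in> verts K" by (auto simp: side_def)
    have "vdist K z a = Suc (vdist K z y)" "vdist K z a = Suc (vdist K z b)"
      using z dist_parity[OF zv a(1)] dist_parity[OF zv b(1)] unfolding side_def by auto
    moreover have "y \<noteq> b" using b(2) H(4) m Suc by auto
    ultimately obtain v where v: "square K v y a b"
      using quadrangle[OF zv edge_sym[OF a(1)] b(1)] by blast
    have "side K a y = side K b v" using square_side[OF square_perms(6)[OF v]] by simp
    moreover have ebv: "edge K b v" using v by (auto simp: square_def)
    ultimately have "v \<in> H" using Hs side_ends(1) by simp
    moreover have "vdist K x v \<le> Suc k" using dist_triangle[of x b v] x vb edge_verts[OF ebv] b dist_edge[OF ebv] by simp
    ultimately show ?thesis using n(2)[of "vdist K x v"] H m Suc by auto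
  qed
qed

text \<open>Crossing the edge found by \<open>realization_aux\<close> removes exactly one half-space
  from the finite difference. Once it is empty, equality follows, as both sets choose one half-space
  from each pair.\<close>

lemma realization:
  assumes u: "u \<subseteq> half_spaces K" "\<And>H. H \<in> half_spaces K \<Longrightarrow> (H \<in> u) \<noteq> (co K H \<in> u)"
    and int: "\<And>H H'. H \<in> u \<Longrightarrow> H' \<in> u \<Longrightarrow> H \<inter> H' \<noteq> {}"
  shows "x \<in> verts K \<Longrightarrow> finite (u - hs_of K x) \<Longrightarrow> \<exists>y \<in> verts K. hs_of K y = u"
proof (induction "card (u - hs_of K x)" arbitrary: x)
  case 0
  then have sub: "u \<subseteq> hs_of K x" by simp
  have "hs_of K x \<subseteq> u"
  proof
    fix H assume H: "H \<in> hs_of K x"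
    then have "co K H \<notin> hs_of K x" by (auto simp: hs_of_def co_def)
    then show "H \<in> u" using H u(2)[of H] sub unfolding hs_of_def by blast
  qed
  then show ?case using sub 0 by blast
next
  case (Suc n)
  have "u - hs_of K x \<noteq> {}" using Suc.hyps(2) by (metis card.empty nat.distinct(1))
  then obtain x' where x': "edge K x x'" "side K x x' \<in> u"
    using realization_aux[OF u int Suc.prems(1)] by blast
  note v = edge_verts[OF x'(1)]
  have A: "H \<in> hs_of K x' \<and> H \<notin> hs_of K x \<longleftrightarrow> H = side K x x'" for H
    using hs_of_diff[of x' x] seps_edge[OF x'(1)] by (metis Diff_iff singleton_iff)
  have B: "H \<in> hs_of K x \<and> H \<notin> hs_of K x' \<longleftrightarrow> H = side K x' x" for H
    using hs_of_diff[of x x'] seps_edge[OF edge_sym[OF x'(1)]] by (metis Diff_iff singleton_iff)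
  have C: "side K x' x \<notin> u" using u(2)[OF side_half_space[OF x'(1)]] x'(2) co_side[OF x'(1)] by simp
  have eq: "u - hs_of K x' = (u - hs_of K x) - {side K x x'}"
  proof (intro equalityI subsetI)
    fix H assume "H \<in> u - hs_of K x'"
    then show "H \<in> (u - hs_of K x) - {side K x x'}" using A[of H] B[of H] C by auto
  next
    fix H assume "H \<in> (u - hs_of K x) - {side K x x'}"
    then show "H \<in> u - hs_of K x'" using A[of H] by auto
  qed
  have "side K x x' \<in> u - hs_of K x" using x' side_ends(2)[OF x'(1)] by (auto simp: hs_of_def)
  then have "n = card (u - hs_of K x')" using eq Suc.hyps(2) Suc.prems(2) by simp
  then show ?case using Suc.hyps(1)[of x'] v eq Suc.prems(2) by simp
qed

end

section \<open>Cubes of the Sageev construction\<close>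

text \<open>Crossing the hyperplanes of \<open>F\<close>. For \<open>F\<close> ranging over the
  subsets of a finite \<open>L \<subseteq> v\<close> this parametrizes a cube at \<open>v\<close>,
  with the half-spaces themselves as coordinates.\<close>

definition toggle :: "'v set set \<Rightarrow> 'v set set \<Rightarrow> 'v set set \<Rightarrow> 'v set set" where
  "toggle K v F = (v - F) \<union> co K ` F"

text \<open>The part of \<open>sageev_verts\<close> that toggling always preserves; pairwise
  intersection and the chain condition are left out. It also holds for the sets
  \<open>hs_of K x\<close>, so one calculus serves the cells of \<open>K\<close> and of the Sageev
  complex.\<close>

definition orientation :: "'v set set \<Rightarrow> 'v set set \<Rightarrow> 'v set set \<Rightarrow> bool" where
  "orientation K A v \<longleftrightarrow> v \<subseteq> A \<and> (\<forall>H\<in>A. (H \<in> v) \<noteq> (co K H \<in> v))"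

lemma orientationD:
  "orientation K A v \<Longrightarrow> H \<in> v \<Longrightarrow> H \<in> A"
  "orientation K A v \<Longrightarrow> H \<in> A \<Longrightarrow> co K H \<in> v \<longleftrightarrow> H \<notin> v"
  by (auto simp: orientation_def)

lemma toggle_empty [simp]: "toggle K v {} = v"
  by (simp add: toggle_def)

lemma sageev_verts_orientation: "v \<in> sageev_verts K A \<Longrightarrow> orientation K A v"
  by (simp add: sageev_verts_def orientation_def)

section \<open>Calculus of toggling\<close>

context cat0
begin

definition co_closed :: "'v set set \<Rightarrow> bool" where
  "co_closed A \<longleftrightarrow> A \<subseteq> half_spaces K \<and> (\<forall>H\<in>A. co K H \<in> A)"

lemma co_closed_half_spaces: "co_closed (half_spaces K)"
  using co_half_space by (auto simp: co_closed_def)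

lemma co_closedD:
  assumes "co_closed A" "H \<in> A"
  shows "co K H \<in> A" "co K (co K H) = H" "H \<in> half_spaces K" "co K H \<noteq> H"
proof -
  show "co K H \<in> A" "H \<in> half_spaces K" using assms by (auto simp: co_closed_def)
  then show "co K (co K H) = H" using co_co by blast
  show "co K H \<noteq> H" using half_space_ne[OF \<open>H \<in> half_spaces K\<close>] by (auto simp: co_def)
qed

lemma mem_toggle:
  assumes A: "co_closed A" and v: "orientation K A v" and F: "F \<subseteq> v" and H: "H \<in> A"
  shows "H \<in> toggle K v F \<longleftrightarrow> (if H \<in> F then False else if co K H \<in> F then True else H \<in> v)"
proof -
  have "H \<in> co K ` F \<longleftrightarrow> co K H \<in> F"
    using co_closedD[OF A] F orientationD(1)[OF v] H by (metis (no_types, lifting) image_iff subsetD)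
  moreover have "\<not> (H \<in> F \<and> co K H \<in> F)" using F orientationD[OF v] H by blast
  moreover have "co K H \<in> F \<Longrightarrow> H \<notin> v" using F orientationD[OF v] H by blast
  ultimately show ?thesis unfolding toggle_def by auto
qed

lemma toggle_orientation:
  assumes A: "co_closed A" and v: "orientation K A v" and F: "F \<subseteq> v"
  shows "orientation K A (toggle K v F)"
  unfolding orientation_def
proof (intro conjI ballI)
  show "toggle K v F \<subseteq> A" using co_closedD(1)[OF A] orientationD(1)[OF v] F unfolding toggle_def by blast
  fix H assume H: "H \<in> A"
  show "(H \<in> toggle K v F) \<noteq> (co K H \<in> toggle K v F)"
    using mem_toggle[OF A v F H] mem_toggle[OF A v F co_closedD(1)[OF A H]] co_closedD[OF A H]
      orientationD[OF v] F H by (auto split: if_splits)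
qed

lemma orientation_eqI:
  assumes "orientation K A v" "orientation K A w" "\<And>H. H \<in> A \<Longrightarrow> H \<in> v \<longleftrightarrow> H \<in> w"
  shows "v = w"
  using assms orientationD(1) by blast

lemma diff_toggle:
  assumes A: "co_closed A" and v: "orientation K A v" and F: "F \<subseteq> v"
  shows "v - toggle K v F = F"
proof (intro equalityI subsetI)
  fix H assume H: "H \<in> v - toggle K v F"
  then show "H \<in> F" using mem_toggle[OF A v F, of H] orientationD[OF v] by (auto split: if_splits)
next
  fix H assume H: "H \<in> F"
  then show "H \<in> v - toggle K v F" using mem_toggle[OF A v F, of H] orientationD[OF v] F by (auto split: if_splits)
qed

lemma toggle_inj:
  assumes "co_closed A" "orientation K A v" "F \<subseteq> v" "F' \<subseteq> v" "toggle K v F = toggle K v F'"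
  shows "F = F'"
  using assms diff_toggle by metis

lemma toggle_edge:
  assumes A: "co_closed A" and v: "orientation K A v" and F: "F \<subseteq> v" and H: "H \<in> v" "H \<notin> F"
  shows "sageev_edge K (toggle K v F) (toggle K v (insert H F))"
proof -
  have HA: "H \<in> A" using orientationD[OF v] H by blast
  have F': "insert H F \<subseteq> v" using F H by blast
  have coH: "co K H \<notin> v" using orientationD[OF v] HA H by blast
  have sub: "toggle K v F \<subseteq> A" "toggle K v (insert H F) \<subseteq> A"
    using toggle_orientation[OF A v] F F' by (auto simp: orientation_def)
  have "J \<in> toggle K v F - toggle K v (insert H F) \<longleftrightarrow> J = H" if "J \<in> A" for J
    using mem_toggle[OF A v F that] mem_toggle[OF A v F' that] co_closedD[OF A that] co_closedD[OF A HA] coH H F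
    by (auto split: if_splits)
  then have 1: "toggle K v F - toggle K v (insert H F) = {H}" using sub HA by blast
  have "J \<in> toggle K v (insert H F) - toggle K v F \<longleftrightarrow> J = co K H" if "J \<in> A" for J
  proof -
    have "co K J = H \<longleftrightarrow> J = co K H" using co_closedD[OF A that] co_closedD[OF A HA] by metis
    then show ?thesis
      using mem_toggle[OF A v F that] mem_toggle[OF A v F' that] co_closedD[OF A that] co_closedD[OF A HA] coH H F
      by (auto split: if_splits)
  qed
  then have 2: "toggle K v (insert H F) - toggle K v F = {co K H}" using sub co_closedD[OF A HA] by blast
  show ?thesis unfolding sageev_edge_def using 1 2 by blast
qed

section \<open>Labels of the directions of a cube\<close>

lemma toggle_single:
  "w - x = {P} \<Longrightarrow> x - w = {co K P} \<Longrightarrow> x = toggle K w {P}"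
  unfolding toggle_def by blast

text \<open>Opposite edges of a square cross the same hyperplane. The half-space \<open>P\<close> is
  lost on the way over the first corner and not regained, because the path does not return to
  \<open>w\<close>; it is still present at the other corner, so the last edge there has to toggle
  it.\<close>

lemma square_labels:
  assumes A: "co_closed A" and w: "orientation K A w"
    and P: "P \<in> w" and Q: "Q \<in> w" and R: "R \<in> toggle K w {P}" and T: "T \<in> toggle K w {Q}"
    and PQ: "P \<noteq> Q" and z: "toggle K (toggle K w {P}) {R} = toggle K (toggle K w {Q}) {T}"
    and ne: "toggle K (toggle K w {P}) {R} \<noteq> w"
  shows "T = P"
proof -
  have o: "orientation K A (toggle K w {P})" "orientation K A (toggle K w {Q})"
    using toggle_orientation[OF A w] P Q by auto
  have in_A: "P \<in> A" "Q \<in> A" using P Q orientationD(1)[OF w] by auto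
  have coP: "co K P \<notin> w" using orientationD(2)[OF w in_A(1)] P by simp
  have Px: "P \<notin> toggle K w {P}" using mem_toggle[OF A w _ in_A(1), of "{P}"] P by simp
  have Py: "P \<in> toggle K w {Q}" using mem_toggle[OF A w _ in_A(1), of "{Q}"] P Q PQ coP by auto
  have "co K P \<noteq> R"
  proof
    assume R': "co K P = R"
    have "toggle K (toggle K w {P}) {R} = w"
    proof (rule orientation_eqI[OF _ w])
      show "orientation K A (toggle K (toggle K w {P}) {R})" using toggle_orientation[OF A o(1)] R by simp
      fix J assume J: "J \<in> A"
      have "co K J = co K P \<longleftrightarrow> J = P" using co_closedD[OF A J] co_closedD[OF A in_A(1)] by metis
      then show "J \<in> toggle K (toggle K w {P}) {R} \<longleftrightarrow> J \<in> w"
        using mem_toggle[OF A o(1) _ J, of "{R}"] mem_toggle[OF A w _ J, of "{P}"] R R' P coP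
          co_closedD[OF A J] co_closedD[OF A in_A(1)] by (auto split: if_splits)
    qed
    then show False using ne by simp
  qed
  then have "P \<notin> toggle K (toggle K w {P}) {R}"
    using mem_toggle[OF A o(1) _ in_A(1), of "{R}"] R Px by auto
  then have "P \<notin> toggle K (toggle K w {Q}) {T}" using z by simp
  then show "T = P"
    using mem_toggle[OF A o(2) _ in_A(1), of "{T}"] T Py by (auto split: if_splits)
qed

text \<open>The 1-skeleton condition of \<open>sageev\<close>, imposed on mere orientations so that
  it also applies to the half-space sets of the corners of a cell of \<open>K\<close>.\<close>

definition set_cube :: "'v set set \<Rightarrow> nat \<Rightarrow> (nat set \<Rightarrow> 'v set set) \<Rightarrow> bool" where
  "set_cube A n c \<longleftrightarrow> inj_on c (Pow {..<n}) \<and> (\<forall>S\<subseteq>{..<n}. orientation K A (c S)) \<and>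
     (\<forall>S i. S \<subseteq> {..<n} \<and> i < n \<and> i \<notin> S \<longrightarrow> sageev_edge K (c S) (c (insert i S)))"

lemma set_cube_labels:
  assumes A: "co_closed A" and c: "set_cube A n c"
  obtains lab where "inj_on lab {..<n}" "lab ` {..<n} \<subseteq> c {}"
    "\<And>S. S \<subseteq> {..<n} \<Longrightarrow> c S = toggle K (c {}) (lab ` S)"
proof -
  have inj: "\<And>S T. S \<subseteq> {..<n} \<Longrightarrow> T \<subseteq> {..<n} \<Longrightarrow> c S = c T \<Longrightarrow> S = T"
    and o: "\<And>S. S \<subseteq> {..<n} \<Longrightarrow> orientation K A (c S)"
    and e: "\<And>S i. S \<subseteq> {..<n} \<Longrightarrow> i < n \<Longrightarrow> i \<notin> S \<Longrightarrow> sageev_edge K (c S) (c (insert i S))"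
    using c unfolding set_cube_def inj_on_def by auto
  have ex: "\<exists>H. H \<in> c S \<and> c (insert i S) = toggle K (c S) {H}" if "S \<subseteq> {..<n}" "i < n" "i \<notin> S" for S i
  proof -
    have "sageev_edge K (c S) (c (insert i S))" using e[OF that] .
    then obtain H where H: "c S - c (insert i S) = {H}" "c (insert i S) - c S = {co K H}"
      unfolding sageev_edge_def by blast
    then have "H \<in> c S" by blast
    then show ?thesis using toggle_single[OF H] by blast
  qed
  have "\<forall>i. \<exists>H. i < n \<longrightarrow> H \<in> c {} \<and> c {i} = toggle K (c {}) {H}" using ex[of "{}"] by auto
  then obtain lab where lab: "\<And>i. i < n \<Longrightarrow> lab i \<in> c {} \<and> c {i} = toggle K (c {}) {lab i}" by metis
  \<comment> \<open>The label read off at \<open>{}\<close> is carried along through one square for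
    each further element of \<open>S\<close>.\<close>
  have step: "lab i \<in> c S \<and> c (insert i S) = toggle K (c S) {lab i}"
    if "S \<subseteq> {..<n}" "i < n" "i \<notin> S" for S i
  proof -
    have "finite S" using that finite_subset by blast
    then show ?thesis using that
    proof (induction S rule: finite_induct)
      case empty
      then show ?case using lab by simp
    next
      case (insert j S)
      have IH: "lab i \<in> c S" "c (insert i S) = toggle K (c S) {lab i}" using insert by auto
      have S: "S \<subseteq> {..<n}" "j < n" "i \<noteq> j" "insert i S \<subseteq> {..<n}" using insert by auto
      have n: "j \<notin> S" "i \<notin> S" "i < n" "j \<notin> insert i S" "i \<notin> insert j S" "insert j S \<subseteq> {..<n}"
        using insert.hyps(2) insert.prems S(3) by auto
      obtain Q where Q: "Q \<in> c S" "c (insert j S) = toggle K (c S) {Q}"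
        using ex[OF S(1,2) n(1)] by blast
      obtain R where R: "R \<in> c (insert i S)" "c (insert j (insert i S)) = toggle K (c (insert i S)) {R}"
        using ex[OF S(4,2) n(4)] by blast
      obtain T where T: "T \<in> c (insert j S)" "c (insert i (insert j S)) = toggle K (c (insert j S)) {T}"
        using ex[OF n(6,3,5)] by blast
      have c4: "insert j (insert i S) = insert i (insert j S)" by auto
      have "c (insert i S) \<noteq> c (insert j S)" using inj[OF S(4) n(6)] n by blast
      then have PQ: "lab i \<noteq> Q" using IH Q by metis
      have "c (insert i (insert j S)) \<noteq> c S" using inj[of "insert i (insert j S)" S] S n by blast
      then have "T = lab i"
        using square_labels[OF A o[OF S(1)] IH(1) Q(1), of R T] R T PQ IH Q c4 by simp
      then show ?case using T by simp
    qed
  qed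
  have sub: "lab ` {..<n} \<subseteq> c {}" using lab by auto
  have lab_inj: "inj_on lab {..<n}"
  proof (rule inj_onI)
    fix i j assume ij: "i \<in> {..<n}" "j \<in> {..<n}" "lab i = lab j"
    then have "c {i} = c {j}" using lab by simp
    then show "i = j" using inj[of "{i}" "{j}"] ij by auto
  qed
  have "c S = toggle K (c {}) (lab ` S)" if "S \<subseteq> {..<n}" for S
  proof -
    have "finite S" using that finite_subset by blast
    then show ?thesis using that
    proof (induction S rule: finite_induct)
      case (insert i S)
      have o0: "orientation K A (c {})" using o by simp
      have S: "S \<subseteq> {..<n}" "i < n" "i \<notin> S" using insert by auto
      have l1: "lab i \<in> c {}" using lab S by blast
      have l2: "lab i \<notin> lab ` S" using inj_on_image_mem_iff[OF lab_inj, of i S] S by simp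
      have "lab i \<notin> co K ` lab ` S"
      proof
        assume "lab i \<in> co K ` lab ` S"
        then obtain j where "j \<in> S" "lab i = co K (lab j)" by blast
        then have "lab j \<in> c {}" "co K (lab j) \<in> c {}" using l1 lab[of j] S(1) by auto
          then show False using orientationD(2)[OF o0 orientationD(1)[OF o0]] by blast
      qed
      then have "toggle K (toggle K (c {}) (lab ` S)) {lab i} = toggle K (c {}) (lab ` insert i S)"
        using l2 unfolding toggle_def by auto
      then show ?case using step[OF S] insert by simp
    qed simp
  qed
  then show thesis using that lab_inj sub by blast
qed

section \<open>Cells of the Sageev complex\<close>

lemma toggle_set_cube:
  assumes A: "co_closed A" and v: "orientation K A v" and e: "bij_betw e {..<n} L" "L \<subseteq> v"
  shows "set_cube A n (\<lambda>S. toggle K v (e ` S))" "bij_betw (\<lambda>S. toggle K v (e ` S)) (Pow {..<n}) (toggle K v ` Pow L)"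
proof -
  let ?c = "\<lambda>S. toggle K v (e ` S)"
  have im: "e ` {..<n} = L" "inj_on e {..<n}" using e by (auto simp: bij_betw_def)
  have sub: "e ` S \<subseteq> v" if "S \<subseteq> {..<n}" for S using im e(2) that by blast
  have inj: "inj_on ?c (Pow {..<n})"
  proof (rule inj_onI)
    fix S T assume ST: "S \<in> Pow {..<n}" "T \<in> Pow {..<n}" "toggle K v (e ` S) = toggle K v (e ` T)"
    then have "e ` S = e ` T" using toggle_inj[OF A v sub sub] by blast
    then show "S = T" using ST im(2) by (simp add: inj_on_image_eq_iff)
  qed
  have "sageev_edge K (toggle K v (e ` S)) (toggle K v (e ` insert i S))"
    if "S \<subseteq> {..<n}" "i < n" "i \<notin> S" for S i
  proof -
    have "e i \<notin> e ` S" using that im(2) unfolding inj_on_def by blast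
    moreover have "e i \<in> v" using sub[of "{i}"] that by auto
    ultimately show ?thesis using toggle_edge[OF A v sub[OF that(1)]] by simp
  qed
  then show "set_cube A n ?c"
    unfolding set_cube_def using inj toggle_orientation[OF A v sub] by blast
  have "?c ` Pow {..<n} = toggle K v ` (\<lambda>S. e ` S) ` Pow {..<n}" by (simp only: image_image)
  also have "(\<lambda>S. e ` S) ` Pow {..<n} = Pow L" using image_Pow_surj[OF im(1)] .
  finally show "bij_betw ?c (Pow {..<n}) (toggle K v ` Pow L)"
    using inj by (simp add: bij_betw_def)
qed

text \<open>Normal form used from here on in place of parametrizations: a corner \<open>v\<close>
  and the half-spaces toggled at it.\<close>

lemma sageev_iff:
  assumes A: "co_closed A"
  shows "C \<in> sageev K A \<longleftrightarrow>
    (\<exists>v L. finite L \<and> L \<subseteq> v \<and> v \<in> sageev_verts K A \<and> C = toggle K v ` Pow L \<and> C \<subseteq> sageev_verts K A)" (is "_ \<longleftrightarrow> ?rhs")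
proof
  assume "C \<in> sageev K A"
  then obtain n :: nat and c where c: "bij_betw c (Pow {..<n}) C" "C \<subseteq> sageev_verts K A"
    "\<And>S i. S \<subseteq> {..<n} \<Longrightarrow> i < n \<Longrightarrow> i \<notin> S \<Longrightarrow> sageev_edge K (c S) (c (insert i S))"
    unfolding sageev_def by blast
  have mem: "c S \<in> C" if "S \<subseteq> {..<n}" for S using bij_betwE[OF c(1)] that by blast
  have "orientation K A (c S)" if "S \<subseteq> {..<n}" for S
    using sageev_verts_orientation mem[OF that] c(2) by blast
  moreover have "inj_on c (Pow {..<n})" using c(1) by (simp add: bij_betw_def)
  ultimately have "set_cube A n c" unfolding set_cube_def using c(3) by blast
  then obtain lab where lab: "inj_on lab {..<n}" "lab ` {..<n} \<subseteq> c {}"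
    "\<And>S. S \<subseteq> {..<n} \<Longrightarrow> c S = toggle K (c {}) (lab ` S)" using set_cube_labels[OF A] by blast
  have "C = c ` Pow {..<n}" using c(1) by (simp add: bij_betw_def)
  also have "\<dots> = (\<lambda>S. toggle K (c {}) (lab ` S)) ` Pow {..<n}" by (intro image_cong refl lab(3)) blast
  also have "\<dots> = toggle K (c {}) ` (\<lambda>S. lab ` S) ` Pow {..<n}" by (simp only: image_image)
  also have "(\<lambda>S. lab ` S) ` Pow {..<n} = Pow (lab ` {..<n})" by (rule image_Pow_surj) simp
  finally have "C = toggle K (c {}) ` Pow (lab ` {..<n})" .
  moreover have "c {} \<in> sageev_verts K A" using mem[of "{}"] c(2) by auto
  ultimately show ?rhs
    using lab(2) c(2) by (intro exI[of _ "c {}"] exI[of _ "lab ` {..<n}"]) auto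
next
  assume ?rhs
  then obtain v L where vL: "finite L" "L \<subseteq> v" "v \<in> sageev_verts K A" "C = toggle K v ` Pow L" "C \<subseteq> sageev_verts K A"
    by blast
  obtain e where e: "bij_betw e {..<card L} L" using ex_bij_betw_nat_finite[OF vL(1)] atLeast0LessThan by auto
  show "C \<in> sageev K A"
    using toggle_set_cube[OF A sageev_verts_orientation[OF vL(3)] e vL(2)] vL(4,5)
    unfolding sageev_def set_cube_def by blast
qed

text \<open>Describes a cube by the half-spaces on which its corners agree, which makes cubes given
  at different corners comparable.\<close>

lemma cube_char:
  assumes A: "co_closed A" and v: "orientation K A v" and L: "L \<subseteq> v"
  shows "toggle K v ` Pow L = {w. orientation K A w \<and> (\<forall>H\<in>A. H \<notin> L \<and> co K H \<notin> L \<longrightarrow> (H \<in> w \<longleftrightarrow> H \<in> v))}"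
    (is "_ = ?rhs")
proof (intro equalityI subsetI)
  fix w assume "w \<in> toggle K v ` Pow L"
  then obtain F where F: "F \<subseteq> L" "w = toggle K v F" by auto
  then have Fv: "F \<subseteq> v" using L by blast
  then show "w \<in> ?rhs"
    using toggle_orientation[OF A v Fv] mem_toggle[OF A v Fv] F by (auto split: if_splits)
next
  fix w assume "w \<in> ?rhs"
  then have w: "orientation K A w" and ag: "\<And>H. H \<in> A \<Longrightarrow> H \<notin> L \<Longrightarrow> co K H \<notin> L \<Longrightarrow> (H \<in> w \<longleftrightarrow> H \<in> v)" by auto
  have sub: "L - w \<subseteq> v" using L by blast
  have "w = toggle K v (L - w)"
  proof (rule orientation_eqI[OF w toggle_orientation[OF A v sub]])
    fix H assume H: "H \<in> A"
    have o: "(H \<in> w) \<noteq> (co K H \<in> w)" "(H \<in> v) \<noteq> (co K H \<in> v)" using w v H unfolding orientation_def by auto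
    show "H \<in> w \<longleftrightarrow> H \<in> toggle K v (L - w)"
      using mem_toggle[OF A v sub H] ag[OF H] o L by (auto split: if_splits)
  qed
  then show "w \<in> toggle K v ` Pow L" by blast
qed

text \<open>Dimension is defined through charts, so the parametrization by subsets of
  \<open>L\<close> has to be shown to recognize all cells inside \<open>C\<close> as
  intervals.\<close>

lemma sageev_cube_chart:
  assumes A: "co_closed A" and C: "C \<in> sageev K A" and L: "finite L" "L \<subseteq> v" "v \<in> sageev_verts K A"
    "C = toggle K v ` Pow L"
  shows "\<exists>c. cube_chart (sageev K A) (card L) c C"
proof -
  have v: "orientation K A v" using sageev_verts_orientation[OF L(3)] .
  have Cs: "C \<subseteq> sageev_verts K A" using C unfolding sageev_def by blast
  obtain e where e: "bij_betw e {..<card L} L" using ex_bij_betw_nat_finite[OF L(1)] atLeast0LessThan by auto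
  have im: "e ` {..<card L} = L" "inj_on e {..<card L}" using e by (auto simp: bij_betw_def)
  let ?c = "\<lambda>S. toggle K v (e ` S)"
  have bij: "bij_betw ?c (Pow {..<card L}) C" using toggle_set_cube[OF A v e L(2)] L(4) by simp
  have face: "D \<in> sageev K A \<longleftrightarrow> (\<exists>P Q. P \<subseteq> Q \<and> Q \<subseteq> L \<and> D = toggle K v ` {P..Q})" if D: "D \<subseteq> C" for D
  proof
    assume "\<exists>P Q. P \<subseteq> Q \<and> Q \<subseteq> L \<and> D = toggle K v ` {P..Q}"
    then obtain P Q where PQ: "P \<subseteq> Q" "Q \<subseteq> L" "D = toggle K v ` {P..Q}" by blast
    have Pv: "P \<subseteq> v" "Q - P \<subseteq> toggle K v P" using PQ L unfolding toggle_def by auto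
    have "{P..Q} = (\<lambda>F. P \<union> F) ` Pow (Q - P)"
    proof (intro equalityI subsetI)
      fix F assume "F \<in> {P..Q}"
      then have "F = P \<union> (F - P)" "F - P \<in> Pow (Q - P)" by auto
      then show "F \<in> (\<lambda>F. P \<union> F) ` Pow (Q - P)" by blast
    next
      fix F assume "F \<in> (\<lambda>F. P \<union> F) ` Pow (Q - P)"
      then show "F \<in> {P..Q}" using PQ(1) by auto
    qed
    then have "D = (\<lambda>F. toggle K v (P \<union> F)) ` Pow (Q - P)" using PQ(3) by auto
    also have "\<dots> = toggle K (toggle K v P) ` Pow (Q - P)"
    proof (intro image_cong refl)
      fix F assume F: "F \<in> Pow (Q - P)"
      have "co K ` P \<inter> F = {}"
      proof -
        have "co K H \<notin> v" if "H \<in> P" for H using that Pv orientationD[OF v] by blast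
        then show ?thesis using F PQ L by blast
      qed
      then show "toggle K v (P \<union> F) = toggle K (toggle K v P) F" unfolding toggle_def by blast
    qed
    finally have D': "D = toggle K (toggle K v P) ` Pow (Q - P)" .
    have "toggle K v P \<in> D" using PQ by auto
    then have "toggle K v P \<in> sageev_verts K A" using D Cs by blast
    moreover have "finite (Q - P)" using PQ L finite_subset by blast
    moreover have "D \<subseteq> sageev_verts K A" using D Cs by (rule subset_trans)
    ultimately show "D \<in> sageev K A" unfolding sageev_iff[OF A] using D' Pv(2)
      by (intro exI[of _ "toggle K v P"] exI[of _ "Q - P"] conjI)
  next
    assume "D \<in> sageev K A"
    then obtain v' L' where v': "finite L'" "L' \<subseteq> v'" "v' \<in> sageev_verts K A" "D = toggle K v' ` Pow L'"
      unfolding sageev_iff[OF A] by blast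
    have o': "orientation K A v'" using v' sageev_verts_orientation by blast
    have Dc: "D = {w. orientation K A w \<and> (\<forall>H\<in>A. H \<notin> L' \<and> co K H \<notin> L' \<longrightarrow> (H \<in> w \<longleftrightarrow> H \<in> v'))}"
      using cube_char[OF A o' v'(2)] v'(4) by simp
    have Cc: "C = {w. orientation K A w \<and> (\<forall>H\<in>A. H \<notin> L \<and> co K H \<notin> L \<longrightarrow> (H \<in> w \<longleftrightarrow> H \<in> v))}"
      using cube_char[OF A v L(2)] L(4) by simp
    have "toggle K v' {} \<in> D" unfolding v'(4) by blast
    then have v'C: "v' \<in> C" using D by (metis subsetD toggle_empty)
    \<comment> \<open>Among the directions of \<open>C\<close>, those in \<open>?E\<close> vary on
      \<open>D\<close>. The others are constant there and equal to their value at \<open>v'\<close>: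
      toggled with respect to \<open>v\<close> if in \<open>?P\<close>, untouched if outside
      \<open>?Q\<close>.\<close>
    let ?E = "{H \<in> L. H \<in> L' \<or> co K H \<in> L'}"
    let ?P = "{H \<in> L - ?E. H \<notin> v'}" and ?Q = "L - {H \<in> L - ?E. H \<in> v'}"
    have eq: "toggle K v F \<in> D \<longleftrightarrow> ?P \<subseteq> F \<and> F \<subseteq> ?Q" if F: "F \<subseteq> L" for F
    proof -
      let ?w = "toggle K v F"
      have Fv: "F \<subseteq> v" using F L by blast
      have oF: "orientation K A ?w" using toggle_orientation[OF A v Fv] .
      have wC: "?w \<in> C" using L(4) F by blast
      have "?w \<in> D \<longleftrightarrow> (\<forall>H\<in>L - ?E. H \<in> ?w \<longleftrightarrow> H \<in> v')"
      proof
        assume "?w \<in> D"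
        then show "\<forall>H\<in>L - ?E. H \<in> ?w \<longleftrightarrow> H \<in> v'" unfolding Dc using L(2) orientationD(1)[OF v] by blast
      next
        assume a: "\<forall>H\<in>L - ?E. H \<in> ?w \<longleftrightarrow> H \<in> v'"
        have "H \<in> ?w \<longleftrightarrow> H \<in> v'" if H: "H \<in> A" "H \<notin> L'" "co K H \<notin> L'" for H
        proof -
          note cH = co_closedD[OF A H(1)]
          consider "H \<in> L" | "co K H \<in> L" | "H \<notin> L" "co K H \<notin> L" by blast
          then show ?thesis
          proof cases
            case 1
            then show ?thesis using a H by blast
          next
            case 2
            then have "co K H \<in> ?w \<longleftrightarrow> co K H \<in> v'" using a H cH by auto
            then show ?thesis using orientationD(2)[OF oF H(1)] orientationD(2)[OF o' H(1)] by blast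
          next
            case 3
            then show ?thesis using wC v'C H unfolding Cc by blast
          qed
        qed
        then show "?w \<in> D" unfolding Dc using oF by blast
      qed
      also have "\<dots> \<longleftrightarrow> (\<forall>H\<in>L - ?E. H \<notin> F \<longleftrightarrow> H \<in> v')"
      proof -
        have "H \<in> ?w \<longleftrightarrow> H \<notin> F" if "H \<in> L" for H
        proof -
          have "H \<in> v" "H \<in> A" using that L(2) orientationD(1)[OF v] by auto
          moreover from this have "co K H \<notin> F" using orientationD(2)[OF v, of H] Fv by blast
          ultimately show ?thesis using mem_toggle[OF A v Fv, of H] by auto
        qed
        then show ?thesis by blast
      qed
      also have "\<dots> \<longleftrightarrow> ?P \<subseteq> F \<and> F \<subseteq> ?Q" using F by blast
      finally show ?thesis .
    qed
    have "D = toggle K v ` {?P..?Q}"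
    proof (intro equalityI subsetI)
      fix w assume w: "w \<in> D"
      then obtain F where "F \<subseteq> L" "w = toggle K v F" using D L(4) by blast
      then show "w \<in> toggle K v ` {?P..?Q}" using eq w by auto
    next
      fix w assume "w \<in> toggle K v ` {?P..?Q}"
      then obtain F where F: "w = toggle K v F" "?P \<subseteq> F" "F \<subseteq> ?Q" by auto
      then have "F \<subseteq> L" by blast
      then show "w \<in> D" using eq F by blast
    qed
    moreover have "?P \<subseteq> ?Q" "?Q \<subseteq> L" by auto
    ultimately show "\<exists>P Q. P \<subseteq> Q \<and> Q \<subseteq> L \<and> D = toggle K v ` {P..Q}" by blast
  qed
  have pull: "?c ` {S..T} = toggle K v ` {e ` S..e ` T}" if "S \<subseteq> T" "T \<subseteq> {..<card L}" for S T
  proof -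
    have "(\<lambda>S. e ` S) ` {S..T} = {e ` S..e ` T}"
    proof (intro equalityI subsetI)
      fix F assume "F \<in> {e ` S..e ` T}"
      then have F: "e ` S \<subseteq> F" "F \<subseteq> e ` T" by auto
      let ?U = "{i \<in> T. e i \<in> F}"
      have "F = e ` ?U" using F by blast
      moreover have "S \<subseteq> ?U" "?U \<subseteq> T" using F that by auto
      ultimately show "F \<in> (\<lambda>S. e ` S) ` {S..T}" by auto
    next
      fix F assume "F \<in> (\<lambda>S. e ` S) ` {S..T}"
      then obtain U where "S \<subseteq> U" "U \<subseteq> T" "F = e ` U" by auto
      then show "F \<in> {e ` S..e ` T}" using image_mono[of S U e] image_mono[of U T e] by simp
    qed
    then have "toggle K v ` (\<lambda>S. e ` S) ` {S..T} = toggle K v ` {e ` S..e ` T}" by simp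
    then show ?thesis by (simp only: image_image)
  qed
  have "D \<in> sageev K A \<longleftrightarrow> (\<exists>S T. S \<subseteq> T \<and> T \<subseteq> {..<card L} \<and> D = ?c ` {S..T})" if D: "D \<subseteq> C" for D
  proof
    assume "D \<in> sageev K A"
    from iffD1[OF face[OF D] this] obtain P Q where PQ: "P \<subseteq> Q" "Q \<subseteq> L" "D = toggle K v ` {P..Q}"
      by (elim exE conjE)
    let ?S = "{i \<in> {..<card L}. e i \<in> P}" and ?T = "{i \<in> {..<card L}. e i \<in> Q}"
    have onto: "e ` {i \<in> {..<card L}. e i \<in> R} = R" if "R \<subseteq> L" for R
    proof (intro equalityI subsetI)
      fix H assume H: "H \<in> R"
      then have "H \<in> e ` {..<card L}" using that im(1) by auto
      then obtain i where "i \<in> {..<card L}" "H = e i" by (rule imageE)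
      then show "H \<in> e ` {i \<in> {..<card L}. e i \<in> R}" using H by simp
    qed auto
    have ST: "?S \<subseteq> ?T" "?T \<subseteq> {..<card L}" using PQ(1) by auto
    have "D = ?c ` {?S..?T}"
      unfolding pull[OF ST] onto[OF PQ(2)] onto[OF subset_trans[OF PQ(1,2)]] PQ(3) ..
    moreover note ST
    ultimately show "\<exists>S T. S \<subseteq> T \<and> T \<subseteq> {..<card L} \<and> D = ?c ` {S..T}" by blast
  next
    assume "\<exists>S T. S \<subseteq> T \<and> T \<subseteq> {..<card L} \<and> D = ?c ` {S..T}"
    then obtain S T where ST: "S \<subseteq> T" "T \<subseteq> {..<card L}" "D = ?c ` {S..T}" by (elim exE conjE)
    have "D = toggle K v ` {e ` S..e ` T}" unfolding ST(3) by (rule pull[OF ST(1,2)])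
    moreover have "e ` S \<subseteq> e ` T" using ST(1) by (rule image_mono)
    moreover have "e ` T \<subseteq> L" using image_mono[OF ST(2), of e] im(1) by simp
    ultimately show "D \<in> sageev K A" by (intro iffD2[OF face[OF D]]) blast
  qed
  then show ?thesis unfolding cube_chart_def using bij by blast
qed

section \<open>Cells of the given complex in terms of half-spaces\<close>

lemma edge_sageev_edge:
  assumes "edge K x y"
  shows "sageev_edge K (hs_of K x) (hs_of K y)"
  unfolding sageev_edge_def hs_of_diff
  using seps_edge[OF assms] seps_edge[OF edge_sym[OF assms]] co_side[OF edge_sym[OF assms]] by auto

lemma hs_of_orientation: "x \<in> verts K \<Longrightarrow> orientation K (half_spaces K) (hs_of K x)"
  using co_half_space by (auto simp: orientation_def hs_of_def co_def)

lemma cell_toggle: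
  assumes C: "C \<in> K" and y: "y \<in> C"
  obtains L where "finite L" "L \<subseteq> hs_of K y" "hs_of K ` C = toggle K (hs_of K y) ` Pow L"
proof -
  obtain n c where nc: "cube_frame K n c C" "c {} = y" using frame_at[OF C y] by blast
  have bij: "bij_betw c (Pow {..<n}) C"
    and edge: "\<And>S T. S \<subseteq> {..<n} \<Longrightarrow> T \<subseteq> {..<n} \<Longrightarrow> (edge K (c S) (c T) \<longleftrightarrow> (\<exists>i<n. T = sd S {i}))"
    using nc(1) unfolding cube_frame_def by auto
  have cv: "c S \<in> verts K" if "S \<subseteq> {..<n}" for S
    using bij_betwE[OF bij] that C unfolding verts_def by blast
  have "inj_on (hs_of K) C" using hs_of_inj C unfolding inj_on_def verts_def by blast
  then have "inj_on (hs_of K \<circ> c) (Pow {..<n})" using bij comp_inj_on unfolding bij_betw_def by blast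
  moreover have "sageev_edge K (hs_of K (c S)) (hs_of K (c (insert i S)))" if "S \<subseteq> {..<n}" "i < n" "i \<notin> S" for S i
  proof -
    have "insert i S = sd S {i}" "insert i S \<subseteq> {..<n}" using that by auto
    then have "edge K (c S) (c (insert i S))" using edge[OF that(1)] that(2) by blast
    then show ?thesis by (rule edge_sageev_edge)
  qed
  ultimately have "set_cube (half_spaces K) n (hs_of K \<circ> c)"
    unfolding set_cube_def using hs_of_orientation cv by simp
  then obtain lab where lab: "inj_on lab {..<n}" "lab ` {..<n} \<subseteq> (hs_of K \<circ> c) {}"
    "\<And>S. S \<subseteq> {..<n} \<Longrightarrow> (hs_of K \<circ> c) S = toggle K ((hs_of K \<circ> c) {}) (lab ` S)"
    using set_cube_labels[OF co_closed_half_spaces] by blast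
  have "hs_of K ` C = (hs_of K \<circ> c) ` Pow {..<n}" using bij by (auto simp: bij_betw_def)
  also have "\<dots> = (\<lambda>S. toggle K (hs_of K y) (lab ` S)) ` Pow {..<n}" using nc(2) by (intro image_cong refl) (simp add: lab(3)[unfolded o_apply])
  also have "\<dots> = toggle K (hs_of K y) ` (\<lambda>S. lab ` S) ` Pow {..<n}" by (simp only: image_image)
  also have "(\<lambda>S. lab ` S) ` Pow {..<n} = Pow (lab ` {..<n})" by (rule image_Pow_surj) simp
  finally show thesis using that[of "lab ` {..<n}"] lab(2) nc(2) by simp
qed

text \<open>Seen from the corner \<open>p {H, H'}\<close>, the quadrangle condition puts the
  neighbours \<open>p {H}\<close> and \<open>p {H'}\<close> of \<open>y\<close> on a square at
  \<open>y\<close>. Flagness then gives a cell with exactly these directions; it has the same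
  labels, hence the same corners as \<open>C\<close>.\<close>

lemma toggle_cell:
  assumes C: "C \<subseteq> verts K" and y: "y \<in> verts K" and L: "finite L" "L \<subseteq> hs_of K y"
    and eq: "hs_of K ` C = toggle K (hs_of K y) ` Pow L"
  shows "C \<in> K"
proof -
  note A = co_closed_half_spaces
  have oy: "orientation K (half_spaces K) (hs_of K y)" using hs_of_orientation y .
  have inj: "inj_on (hs_of K) (verts K)" using hs_of_inj unfolding inj_on_def by blast
  have "\<forall>F. \<exists>x. F \<subseteq> L \<longrightarrow> x \<in> C \<and> hs_of K x = toggle K (hs_of K y) F"
    using eq by (metis Pow_iff imageE image_eqI)
  then obtain p where p: "\<And>F. F \<subseteq> L \<Longrightarrow> p F \<in> C \<and> hs_of K (p F) = toggle K (hs_of K y) F" by metis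
  have pv: "p F \<in> verts K" if "F \<subseteq> L" for F using p that C by blast
  have py: "p {} = y" using p[of "{}"] pv[of "{}"] hs_of_inj y by simp
  have dist_insert: "edge K (p F) (p (insert H F))" if "insert H F \<subseteq> L" "H \<notin> F" for H F
  proof -
    have "sageev_edge K (hs_of K (p F)) (hs_of K (p (insert H F)))"
      using toggle_edge[OF A oy, of F H] p that L by auto
    then have "card (seps K (p F) (p (insert H F))) = 1" unfolding sageev_edge_def hs_of_diff by auto
    then show ?thesis using card_seps dist_1_edge pv that by auto
  qed
  let ?N = "(\<lambda>H. p {H}) ` L"
  have e1: "edge K y (p {H})" if "H \<in> L" for H using dist_insert[of H "{}"] that py by simp
  have sq: "{p {H}, p {H'}} \<in> link K y" if HH: "H \<in> L" "H' \<in> L" for H H'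
  proof (cases "H = H'")
    case True
    then show ?thesis using edge_link e1 HH by simp
  next
    case False
    let ?z = "p {H, H'}"
    have zv: "?z \<in> verts K" using pv HH by simp
    have c: "{H', H} = {H, H'}" by (rule insert_commute)
    have e2: "edge K (p {H}) ?z" using dist_insert[of H' "{H}"] False HH unfolding c by simp
    have e3: "edge K (p {H'}) ?z" using dist_insert[of H "{H'}"] False HH by simp
    have d1: "vdist K ?z (p {H}) = 1" "vdist K ?z (p {H'}) = 1"
      by (rule dist_edge[OF edge_sym[OF e2]], rule dist_edge[OF edge_sym[OF e3]])
    have ne: "p {H} \<noteq> p {H'}"
    proof
      assume "p {H} = p {H'}"
      then have "toggle K (hs_of K y) {H} = toggle K (hs_of K y) {H'}" using p[of "{H}"] p[of "{H'}"] HH by simp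
      then have "{H} = {H'}" using toggle_inj[OF A oy, of "{H}" "{H'}"] HH L by blast
      then show False using False by simp
    qed
    have "?z \<noteq> y"
    proof
      assume "?z = y"
      then have "toggle K (hs_of K y) {H, H'} = toggle K (hs_of K y) {}" using p[of "{H,H'}"] HH by simp
      then show False using toggle_inj[OF A oy, of "{H,H'}" "{}"] HH L by blast
    qed
    then have "vdist K ?z y \<noteq> 0" using dist_eq_0 zv y by simp
    then have d2: "vdist K ?z y = 2" using dist_parity[OF zv e1[OF HH(1)]] d1 by auto
    have d3: "vdist K ?z y = Suc (vdist K ?z (p {H}))" "vdist K ?z y = Suc (vdist K ?z (p {H'}))"
      using d1 d2 by simp_all
    obtain u where "square K u (p {H}) y (p {H'})"
      by (rule quadrangle[OF zv edge_sym[OF e1[OF HH(1)]] edge_sym[OF e1[OF HH(2)]] ne d3])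
    then have "square K (p {H}) u (p {H'}) y" by (rule square_perms(5))
    then show ?thesis by (rule square_link)
  qed
  have "?N \<subseteq> \<Union> (link K y)" using sq by blast
  moreover have "finite ?N" using L by simp
  moreover have "\<forall>a\<in>?N. \<forall>b\<in>?N. {a, b} \<in> link K y" using sq by blast
  ultimately have "?N \<in> link K y" using flag_links[OF y] unfolding flag_def by blast
  then obtain C' where C': "C' \<in> K" "y \<in> C'" "?N = {z \<in> C'. edge K y z}" unfolding link_def by blast
  obtain L' where L': "finite L'" "L' \<subseteq> hs_of K y" "hs_of K ` C' = toggle K (hs_of K y) ` Pow L'"
    using cell_toggle[OF C'(1,2)] by blast
  have C'v: "C' \<subseteq> verts K" using C' unfolding verts_def by blast
  have "L = L'"
  proof (intro equalityI subsetI)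
    fix H assume H: "H \<in> L"
    then have "p {H} \<in> C'" using C'(3) by blast
    then have "toggle K (hs_of K y) {H} \<in> hs_of K ` C'" using p[of "{H}"] H by force
    then obtain F where F: "F \<subseteq> L'" "toggle K (hs_of K y) {H} = toggle K (hs_of K y) F" using L'(3) by auto
    then have "{H} = F" using toggle_inj[OF A oy, of "{H}" F] H L L'(2) by blast
    then show "H \<in> L'" using F by blast
  next
    fix H assume H: "H \<in> L'"
    then have "toggle K (hs_of K y) {H} \<in> hs_of K ` C'" unfolding L'(3) by blast
    then obtain x where x: "x \<in> C'" "hs_of K x = toggle K (hs_of K y) {H}" by auto
    have "sageev_edge K (hs_of K y) (hs_of K x)"
      using toggle_edge[OF A oy, of "{}" H] H L'(2) x(2) by auto
    then have "card (seps K y x) = 1" unfolding sageev_edge_def hs_of_diff by auto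
    then have "edge K y x" using card_seps dist_1_edge y x(1) C'v by (metis subsetD)
    then have "x \<in> ?N" using x C'(3) by blast
    then obtain H2 where H2: "H2 \<in> L" "x = p {H2}" by blast
    then have "toggle K (hs_of K y) {H2} = toggle K (hs_of K y) {H}" using p[of "{H2}"] x(2) by auto
    then have "{H2} = {H}" using toggle_inj[OF A oy, of "{H2}" "{H}"] H H2 L L'(2) by blast
    then show "H \<in> L" using H2 by blast
  qed
  then have "hs_of K ` C = hs_of K ` C'" using eq L' by simp
  then have "C = C'" using inj_on_image_eq_iff[OF inj C C'v] by simp
  then show ?thesis using C' by simp
qed

end

section \<open>Axes\<close>

lemma int_cut:
  fixes P :: "int \<Rightarrow> bool"
  assumes "a \<le> b" "\<not> P a" "P b"
  obtains c where "\<not> P c" "P (c + 1)"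
proof -
  have "P b \<longrightarrow> (\<exists>c. \<not> P c \<and> P (c + 1))"
    using assms(1) by (induction b rule: int_ge_induct) (use assms(2) in auto)
  then show thesis using assms(3) that by blast
qed

text \<open>Only the cyclic group matters: \<open>t m\<close> is the action of the
  \<open>m\<close>-th power, and negative times supply the inverses.\<close>

locale cat0_flow = cat0 K for K :: "'v set set" +
  fixes t :: "int \<Rightarrow> 'v \<Rightarrow> 'v"
  assumes t_verts: "x \<in> verts K \<Longrightarrow> t m x \<in> verts K"
    and t_0: "x \<in> verts K \<Longrightarrow> t 0 x = x"
    and t_add: "x \<in> verts K \<Longrightarrow> t (m + n) x = t m (t n x)"
    and t_cell: "C \<in> K \<Longrightarrow> t m ` C \<in> K"
begin

section \<open>Automorphisms and half-spaces\<close>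

lemma t_inv: "x \<in> verts K \<Longrightarrow> t (- m) (t m x) = x" "x \<in> verts K \<Longrightarrow> t m (t (- m) x) = x"
  using t_add[of x "- m" m] t_add[of x m "- m"] t_0 by auto

lemma t_edge:
  assumes "edge K x y"
  shows "edge K (t m x) (t m y)"
proof -
  have "t m x \<noteq> t m y" using t_inv(1) edge_verts[OF assms] assms by (metis edge_def)
  moreover have "t m ` {x, y} \<in> K" using t_cell assms unfolding edge_def by blast
  ultimately show ?thesis unfolding edge_def by simp
qed

lemma t_relpowp: "(edge K ^^ n) x y \<Longrightarrow> (edge K ^^ n) (t m x) (t m y)"
proof (induction n arbitrary: y)
  case (Suc n)
  then obtain z where "(edge K ^^ n) x z" "edge K z y" by auto
  then show ?case using Suc.IH t_edge relpowp_Suc_I by metis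
qed auto

lemma t_dist: "x \<in> verts K \<Longrightarrow> y \<in> verts K \<Longrightarrow> vdist K (t m x) (t m y) = vdist K x y"
proof -
  have le: "vdist K (t m x) (t m y) \<le> vdist K x y" if "x \<in> verts K" "y \<in> verts K" for x y m
    using dist_le[OF t_relpowp[OF dist_path[OF that]]] .
  assume xy: "x \<in> verts K" "y \<in> verts K"
  then show ?thesis
    using le[OF xy, of m] le[OF t_verts[OF xy(1)] t_verts[OF xy(2)], of "- m" m m] t_inv(1) by simp
qed

lemma mem_t_image:
  assumes "H \<subseteq> verts K" "x \<in> verts K"
  shows "x \<in> t m ` H \<longleftrightarrow> t (- m) x \<in> H"
proof
  assume "x \<in> t m ` H"
  then obtain y where "y \<in> H" "x = t m y" by blast
  then show "t (- m) x \<in> H" using t_inv(1) assms by auto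
next
  assume "t (- m) x \<in> H"
  then have "t m (t (- m) x) \<in> t m ` H" by blast
  then show "x \<in> t m ` H" using t_inv(2) assms by simp
qed

lemma t_image_sub: "H \<subseteq> verts K \<Longrightarrow> t m ` H \<subseteq> verts K"
  using t_verts by blast

lemma t_side:
  assumes "edge K x y"
  shows "t m ` side K x y = side K (t m x) (t m y)"
proof (intro equalityI subsetI)
  note v = edge_verts[OF assms]
  have s: "side K x y \<subseteq> verts K" by (auto simp: side_def)
  { fix w assume w: "w \<in> verts K"
    have "vdist K (t (- m) w) a = vdist K w (t m a)" if "a \<in> verts K" for a
      using t_dist[of "t (- m) w" a m] that w t_verts t_inv(2) by simp
    then have "w \<in> t m ` side K x y \<longleftrightarrow> w \<in> side K (t m x) (t m y)"
      using mem_t_image[OF s w] v w t_verts by (simp add: side_def) }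
  note eq = this
  fix w
  { assume "w \<in> t m ` side K x y" then show "w \<in> side K (t m x) (t m y)"
      using eq t_image_sub[OF s] by blast }
  { assume "w \<in> side K (t m x) (t m y)" then show "w \<in> t m ` side K x y"
      using eq by (auto simp: side_def) }
qed

lemma t_half_space: "H \<in> half_spaces K \<Longrightarrow> t m ` H \<in> half_spaces K"
  unfolding half_spaces_eq using t_side t_edge by blast

lemma t_co:
  assumes "H \<in> half_spaces K"
  shows "t m ` co K H = co K (t m ` H)"
proof -
  obtain x y where xy: "edge K x y" "H = side K x y" using assms unfolding half_spaces_eq by blast
  show ?thesis unfolding xy(2) co_side[OF xy(1)] t_side[OF xy(1)] t_side[OF edge_sym[OF xy(1)]]
      co_side[OF t_edge[OF xy(1)]] ..
qed

text \<open>An axis of \<open>t k\<close> whose shift \<open>L\<close> is a parameter and is only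
  later shown to be the translation length. In this form an axis passes to powers without further
  argument.\<close>

definition line :: "(int \<Rightarrow> 'v) \<Rightarrow> int \<Rightarrow> int \<Rightarrow> bool" where
  "line p k L \<longleftrightarrow> range p \<subseteq> verts K \<and> (\<forall>i j. vdist K (p i) (p j) = nat \<bar>i - j\<bar>) \<and>
     (\<forall>i. t k (p i) = p (i + L)) \<and> k > 0 \<and> L > 0"

definition cut :: "(int \<Rightarrow> 'v) \<Rightarrow> int \<Rightarrow> 'v set" where
  "cut p j = side K (p j) (p (j + 1))"

definition cuts :: "(int \<Rightarrow> 'v) \<Rightarrow> 'v set set" where
  "cuts p = range (cut p) \<union> co K ` range (cut p)"

section \<open>Half-spaces crossed by a line\<close>

context
  fixes p :: "int \<Rightarrow> 'v" and k L :: int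
  assumes l: "line p k L"
begin

lemma line_verts: "p i \<in> verts K"
  using l unfolding line_def by blast

lemma line_edge: "edge K (p i) (p (i + 1))"
  using l dist_1_edge line_verts unfolding line_def by auto

lemma L_pos: "L > 0" and k_pos: "k > 0"
  using l unfolding line_def by auto

lemma mem_cut: "p i \<in> cut p j \<longleftrightarrow> j < i"
  using l unfolding cut_def side_def line_def by auto

lemma cut_hs: "cut p j \<in> half_spaces K"
  unfolding cut_def using side_half_space line_edge by blast

lemma cut_sub: "cut p j \<subseteq> verts K"
  using cut_hs half_space_sub by blast

lemma cut_inj: "cut p i = cut p j \<Longrightarrow> i = j"
  using mem_cut[of "i + 1" i] mem_cut[of "i + 1" j] mem_cut[of "j + 1" i] mem_cut[of "j + 1" j]
  by simp

lemma co_cut_ne: "co K (cut p i) \<noteq> cut p j"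
  using mem_cut[of "max i j + 1" i] mem_cut[of "max i j + 1" j] by (auto simp: co_def)

lemma t_line: "t (k * m) (p i) = p (i + L * m)"
proof -
  have s: "t k (p i) = p (i + L)" for i using l unfolding line_def by blast
  have s': "t (- k) (p i) = p (i - L)" for i
    using s[of "i - L"] t_inv(1)[OF line_verts[of "i - L"], of k] by simp
  show ?thesis
  proof (induction m rule: int_induct[where k = 0])
    case base
    then show ?case using t_0 line_verts by simp
  next
    case (step1 m)
    have "t (k * (m + 1)) (p i) = t k (t (k * m) (p i))"
      using t_add[OF line_verts, of k "k * m" i] by (simp add: algebra_simps)
    then show ?case using step1 s by (simp add: algebra_simps)
  next
    case (step2 m)
    have "t (k * (m - 1)) (p i) = t (- k) (t (k * m) (p i))"
      using t_add[OF line_verts, of "- k" "k * m" i] by (simp add: algebra_simps)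
    then show ?case using step2 s' by (simp add: algebra_simps)
  qed
qed

lemma t_cut: "t (k * m) ` cut p j = cut p (j + L * m)"
  unfolding cut_def t_side[OF line_edge] t_line by (simp add: algebra_simps)

lemma mem_cut_shift: "x \<in> verts K \<Longrightarrow> t (k * m) x \<in> cut p j \<longleftrightarrow> x \<in> cut p (j - L * m)"
  using mem_t_image[OF cut_sub, of x "k * (- m)" j] t_cut[of "- m" j] by simp

lemma finite_cuts:
  assumes x: "x \<in> verts K"
  shows "finite {i. i < 0 \<and> x \<notin> cut p i}" "finite {i. i \<ge> 0 \<and> x \<in> cut p i}"
proof -
  have inj: "inj_on (cut p) S" for S using cut_inj by (auto intro: inj_onI)
  have "cut p ` {i. i < 0 \<and> x \<notin> cut p i} \<subseteq> seps K x (p 0)"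
    unfolding seps_def using cut_hs mem_cut by auto
  then show "finite {i. i < 0 \<and> x \<notin> cut p i}"
    using finite_seps[OF x line_verts] inj finite_imageD finite_subset by metis
  have "cut p ` {i. i \<ge> 0 \<and> x \<in> cut p i} \<subseteq> seps K (p 0) x"
    unfolding seps_def using cut_hs mem_cut by auto
  then show "finite {i. i \<ge> 0 \<and> x \<in> cut p i}"
    using finite_seps[OF line_verts x] inj finite_imageD finite_subset by metis
qed

lemma cuts_bounded:
  assumes x: "x \<in> verts K"
  obtains M where "M > 0" "\<And>i. i \<le> - M \<Longrightarrow> x \<in> cut p i" "\<And>i. i \<ge> M \<Longrightarrow> x \<notin> cut p i"
proof -
  let ?S = "{i. i < 0 \<and> x \<notin> cut p i} \<union> {i. i \<ge> 0 \<and> x \<in> cut p i}"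
  have "finite ((\<lambda>i. \<bar>i\<bar>) ` ?S)" using finite_cuts[OF x] by simp
  then obtain B where B: "\<And>i. i \<in> ?S \<Longrightarrow> \<bar>i\<bar> \<le> B"
    by (meson bdd_above_finite bdd_above.unfold imageI)
  show thesis
  proof (rule that[of "max 1 (B + 1)"])
    fix i assume i: "i \<le> - max 1 (B + 1)"
    show "x \<in> cut p i"
    proof (rule ccontr)
      assume "x \<notin> cut p i"
      then have "\<bar>i\<bar> \<le> B" using B[of i] i by auto
      then show False using i by auto
    qed
  next
    fix i assume i: "i \<ge> max 1 (B + 1)"
    show "x \<notin> cut p i"
    proof
      assume "x \<in> cut p i"
      then have "\<bar>i\<bar> \<le> B" using B[of i] i by auto
      then show False using i by auto
    qed
  qed auto
qed

lemma crossed_eq: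
  assumes "H \<in> half_spaces K" "i \<le> j" "p i \<notin> H" "p j \<in> H"
  shows "H \<in> range (cut p)"
proof -
  obtain c where "p c \<notin> H" "p (c + 1) \<in> H" using int_cut[of i j "\<lambda>i. p i \<in> H"] assms by blast
  then have "H = cut p c" unfolding cut_def using crossed_half_space assms line_edge by blast
  then show ?thesis by blast
qed

text \<open>The vertex \<open>x\<close> lies in all cuts of sufficiently negative index and in none
  of sufficiently large index, so it changes sides somewhere along the orbit of
  \<open>cut p i\<close>.\<close>

lemma switch_ex:
  assumes x: "x \<in> verts K"
  shows "\<exists>m. x \<notin> cut p (i - L * m) \<and> x \<in> cut p (i - L * (m + 1))"
proof -
  obtain M where M: "M > 0" "\<And>i. i \<le> - M \<Longrightarrow> x \<in> cut p i" "\<And>i. i \<ge> M \<Longrightarrow> x \<notin> cut p i"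
    using cuts_bounded[OF x] by blast
  let ?m = "M + \<bar>i\<bar>"
  have "?m \<le> L * ?m" using mult_right_mono[of 1 L ?m] L_pos M(1) by simp
  then have "x \<in> cut p (i - L * ?m)" "x \<notin> cut p (i - L * (- ?m))"
    using M(2)[of "i - L * ?m"] M(3)[of "i - L * (- ?m)"] by linarith+
  then show ?thesis using int_cut[of "- ?m" ?m "\<lambda>m. x \<in> cut p (i - L * m)"] M(1) by auto
qed

section \<open>Displacement of a vertex\<close>

lemma seps_cut:
  assumes "x \<in> verts K"
  shows "cut p j \<in> seps K x (t k x) \<longleftrightarrow> x \<notin> cut p j \<and> x \<in> cut p (j - L)"
  using mem_cut_shift[OF assms, of 1 j] cut_hs by (auto simp: seps_def)

text \<open>One switch is chosen in each residue class modulo \<open>L\<close>. A switch from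
  \<open>cut p (j - L)\<close> to \<open>cut p j\<close> means that \<open>cut p j\<close> separates
  \<open>x\<close> from its image.\<close>

lemma cut_seps_ex:
  assumes x: "x \<in> verts K"
  obtains S where "S \<subseteq> seps K x (t k x)" "S \<subseteq> range (cut p)" "card S = nat L"
proof -
  obtain m where m: "\<And>i. x \<notin> cut p (i - L * m i) \<and> x \<in> cut p (i - L * (m i + 1))"
    using switch_ex[OF x] by metis
  let ?f = "\<lambda>i. cut p (i - L * m i)"
  have "inj_on ?f {0..<L}"
  proof (rule inj_onI)
    fix i j assume ij: "i \<in> {0..<L}" "j \<in> {0..<L}" "?f i = ?f j"
    then have "i - L * m i = j - L * m j" using cut_inj by blast
    then have "(i - L * m i) mod L = (j - L * m j) mod L" by simp
    then have "i mod L = j mod L" by (metis mod_diff_right_eq mod_mult_self1_is_0 diff_zero)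
    then show "i = j" using ij by simp
  qed
  then have "card (?f ` {0..<L}) = nat L" by (simp add: card_image)
  moreover have "?f i \<in> seps K x (t k x)" for i
    using m[of i] seps_cut[OF x, of "i - L * m i"] by (simp add: algebra_simps)
  ultimately show thesis using that[of "?f ` {0..<L}"] by auto
qed

lemma displacement_ge: "x \<in> verts K \<Longrightarrow> vdist K x (t k x) \<ge> nat L"
  using cut_seps_ex card_seps finite_seps t_verts card_mono by metis

lemma translation_length_line: "translation_length K (t k) = nat L"
  unfolding translation_length_def
proof (rule Least_equality)
  have "t k (p 0) = p L" using t_line[of 1 0] by simp
  moreover have "vdist K (p 0) (p L) = nat L" using l unfolding line_def by simp
  ultimately show "\<exists>x\<in>verts K. vdist K x (t k x) = nat L" using line_verts by metis
qed (use displacement_ge in auto)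

lemma mono_iterate:
  assumes "\<And>j. x \<in> cut p (j + L) \<Longrightarrow> x \<in> cut p j"
  shows "x \<in> cut p (j + L * int n) \<Longrightarrow> x \<in> cut p j"
proof (induction n)
  case (Suc n)
  then show ?case using assms[of "j + L * int n"] by (simp add: algebra_simps)
qed simp

lemma cuts_iff:
  assumes "H \<in> half_spaces K"
  shows "H \<in> cuts p \<longleftrightarrow> H \<in> range (cut p) \<or> co K H \<in> range (cut p)"
proof -
  have "H \<in> co K ` range (cut p) \<longleftrightarrow> co K H \<in> range (cut p)"
    using co_co[OF assms] co_co[OF cut_hs] by (metis (no_types, lifting) image_iff)
  then show ?thesis unfolding cuts_def by blast
qed

text \<open>
  Each of the \<open>L\<close> orbits of half-spaces cut by the axis contributes an odd number of hyperplanes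
  separating \<open>x\<close> from \<open>t k x\<close>, namely one for each change of side along the orbit.
\<close>

lemma min_iff:
  assumes x: "x \<in> verts K"
  shows "vdist K x (t k x) = translation_length K (t k) \<longleftrightarrow>
    (\<forall>j. x \<in> cut p (j + L) \<longrightarrow> x \<in> cut p j) \<and>
    (\<forall>H\<in>half_spaces K - cuts p. x \<in> H \<longleftrightarrow> t k x \<in> H)"
    (is "_ \<longleftrightarrow> ?mono \<and> ?rest")
  unfolding translation_length_line
proof
  note tx = t_verts[OF x, of k]
  assume d: "vdist K x (t k x) = nat L"
  obtain S where S: "S \<subseteq> seps K x (t k x)" "S \<subseteq> range (cut p)" "card S = nat L"
    using cut_seps_ex[OF x] by blast
  \<comment> \<open>The \<open>L\<close> cuts that always separate \<open>x\<close> from its image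
    already account for the whole distance, so no other half-space does.\<close>
  then have "S = seps K x (t k x)" using d card_seps[OF x tx] finite_seps[OF x tx] card_subset_eq by metis
  then have sub: "seps K x (t k x) \<subseteq> range (cut p)" using S by blast
  have r: "x \<in> H \<Longrightarrow> t k x \<notin> H \<Longrightarrow> H \<in> half_spaces K \<Longrightarrow> co K H \<in> range (cut p)" for H
    using sub co_half_space x tx unfolding seps_def co_def by auto
  have "x \<in> cut p j" if "x \<in> cut p (j + L)" for j
  proof (rule ccontr)
    assume "x \<notin> cut p j"
    then have "t k x \<notin> cut p (j + L)" using mem_cut_shift[OF x, of 1 "j + L"] by simp
    then show False using r[OF that _ cut_hs] co_cut_ne by auto
  qed
  moreover have ?rest
  proof
    fix H assume H: "H \<in> half_spaces K - cuts p"
    then have "H \<notin> range (cut p)" "co K H \<notin> range (cut p)" using cuts_iff by auto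
    then show "x \<in> H \<longleftrightarrow> t k x \<in> H" using r[of H] sub H unfolding seps_def by blast
  qed
  ultimately show "?mono \<and> ?rest" by blast
next
  note tx = t_verts[OF x, of k]
  assume a: "?mono \<and> ?rest"
  then have mono: "\<And>j. x \<in> cut p (j + L) \<Longrightarrow> x \<in> cut p j" by blast
  let ?J = "{j. x \<notin> cut p j \<and> x \<in> cut p (j - L)}"
  have "seps K x (t k x) \<subseteq> cut p ` ?J"
  proof
    fix H assume H: "H \<in> seps K x (t k x)"
    then have h: "H \<in> half_spaces K" "x \<notin> H" "t k x \<in> H" by (auto simp: seps_def)
    have "co K H \<notin> range (cut p)"
    proof
      assume "co K H \<in> range (cut p)"
      then obtain j where j: "co K H = cut p j" by auto
      then have "x \<in> cut p j" using h x by (auto simp: co_def)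
      then have "t k x \<in> cut p j" using mono[of "j - L"] mem_cut_shift[OF x, of 1 j] by simp
      then show False using j h by (auto simp: co_def)
    qed
    then have "H \<in> range (cut p)" using a h cuts_iff[OF h(1)] by blast
    then show "H \<in> cut p ` ?J" using H seps_cut[OF x] by auto
  qed
  then have sub: "seps K x (t k x) \<subseteq> cut p ` ?J" .
  \<comment> \<open>By monotonicity an orbit has at most one switch: if \<open>i < j\<close> are
    switches in one residue class, then \<open>x\<close> lies in \<open>cut p (j - L)\<close> and
    hence in \<open>cut p i\<close>.\<close>
  have inj: "inj_on (\<lambda>j. j mod L) ?J"
  proof -
    have nlt: "\<not> i < j" if ij: "i \<in> ?J" "j \<in> ?J" "i mod L = j mod L" for i j
    proof
      assume "i < j"
      obtain m where m: "j - i = L * m" using ij(3)[symmetric] unfolding mod_eq_dvd_iff dvd_def by blast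
      then have "m > 0" using \<open>i < j\<close> L_pos by (metis diff_gt_0_iff_gt zero_less_mult_pos)
      then have "j - L = i + L * int (nat (m - 1))" using m by (simp add: algebra_simps)
      then have "x \<in> cut p i" using mono_iterate[OF mono, of i "nat (m - 1)"] ij(2) by simp
      then show False using ij(1) by blast
    qed
    show ?thesis
    proof (rule inj_onI)
      fix i j assume "i \<in> ?J" "j \<in> ?J" "i mod L = j mod L"
      then show "i = j" using nlt[of i j] nlt[of j i] by linarith
    qed
  qed
  have J: "(\<lambda>j. j mod L) ` ?J \<subseteq> {0..<L}" using L_pos by auto
  have fin: "finite ?J" by (rule inj_on_finite[OF inj J]) simp
  have "card ?J \<le> nat L" using card_inj_on_le[OF inj J] by simp
  moreover have "card (cut p ` ?J) \<le> card ?J" by (rule card_image_le[OF fin])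
  moreover have "card (seps K x (t k x)) \<le> card (cut p ` ?J)"
    by (rule card_mono[OF finite_imageI[OF fin] sub])
  ultimately have "card (seps K x (t k x)) \<le> nat L" by linarith
  then show "vdist K x (t k x) = nat L" using displacement_ge[OF x] card_seps[OF x tx] by simp
qed

end

text \<open>The translates of \<open>p 0\<close> lie outside \<open>cut q j\<close> far back and
  inside it far ahead. So \<open>p\<close> crosses this half-space in the positive direction and has
  it as one of its own cuts.\<close>

lemma cut_range_sub:
  assumes l: "line p k L" and l': "line q k L'"
  shows "range (cut q) \<subseteq> range (cut p)"
proof
  fix H assume "H \<in> range (cut q)"
  then obtain j where j: "H = cut q j" by blast
  obtain M where M: "M > 0" "\<And>i. i \<le> - M \<Longrightarrow> p 0 \<in> cut q i" "\<And>i. i \<ge> M \<Longrightarrow> p 0 \<notin> cut q i"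
    using cuts_bounded[OF l' line_verts[OF l]] by blast
  let ?m = "M + \<bar>j\<bar>"
  have "?m \<le> L' * ?m" using mult_right_mono[of 1 L' ?m] L_pos[OF l'] M(1) by simp
  then have "p 0 \<in> cut q (j - L' * ?m)" "p 0 \<notin> cut q (j - L' * (- ?m))"
    using M(2)[of "j - L' * ?m"] M(3)[of "j - L' * (- ?m)"] by linarith+
  then have "p (L * ?m) \<in> H" "p (L * (- ?m)) \<notin> H"
    using mem_cut_shift[OF l' line_verts[OF l], of ?m 0 j] mem_cut_shift[OF l' line_verts[OF l], of "- ?m" 0 j]
      t_line[OF l, of _ 0] j by auto
  moreover have "L * (- ?m) \<le> L * ?m" using L_pos[OF l] M(1) by (intro mult_left_mono) auto
  ultimately show "H \<in> range (cut p)" using crossed_eq[OF l] cut_hs[OF l'] j by blast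
qed

lemma line_power:
  assumes l: "line p k L" and m: "m > 0"
  shows "line p (k * m) (L * m)"
  using l t_line[OF l, of m] m unfolding line_def by simp

lemma axis_line:
  assumes "combinatorial_axis K (t k) p" "translation_length K (t k) > 0" "k > 0"
  shows "line p k (int (translation_length K (t k)))"
  using assms unfolding combinatorial_axis_def line_def by auto

lemma char_set_pos_line:
  assumes l: "line p k L"
  shows "char_set_pos K (t k) = range (cut p)"
proof (intro equalityI subsetI)
  note tl = translation_length_line[OF l]
  have pos: "translation_length K (t k) > 0" "k > 0" using tl L_pos[OF l] k_pos[OF l] by auto
  { fix H assume "H \<in> char_set_pos K (t k)"
    then obtain q i where d: "combinatorial_axis K (t k) q" "H = dual_half_space K (q i) (q (i + 1))"
      unfolding char_set_pos_def by blast
    note l' = axis_line[OF d(1) pos]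
    have "H = cut q i" unfolding d(2) cut_def using dual_half_space_side line_edge[OF l'] by blast
    then show "H \<in> range (cut p)" using cut_range_sub[OF l l'] by blast }
  { fix H assume "H \<in> range (cut p)"
    then obtain i where "H = cut p i" by blast
    then have "H = dual_half_space K (p i) (p (i + 1))"
      unfolding cut_def using dual_half_space_side line_edge[OF l] by simp
    moreover have "combinatorial_axis K (t k) p"
      using l tl L_pos[OF l] unfolding combinatorial_axis_def line_def by auto
    ultimately show "H \<in> char_set_pos K (t k)" unfolding char_set_pos_def by blast }
qed

end

section \<open>Cubes from transverse families\<close>

text \<open>On each of the \<open>M\<close> residue classes \<open>P\<close> is closed downwards and
  fails somewhere, hence is bounded above.\<close>

lemma finite_nonneg_of_shift:
  fixes P :: "int \<Rightarrow> bool"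
  assumes M: "M > 0" and shift: "\<And>j. P (j + M) \<Longrightarrow> P j" and ex: "\<And>r. \<exists>n::nat. \<not> P (r + int n * M)"
  shows "finite {j. j \<ge> 0 \<and> P j}"
proof -
  obtain n where n: "\<And>r. \<not> P (r + int (n r) * M)" using ex by metis
  have down: "P (j + int i * M) \<Longrightarrow> P j" for i j
    by (induction i) (use shift[of "j + int _ * M"] in \<open>auto simp: algebra_simps\<close>)
  have "j \<in> (\<Union>r\<in>{0..<M}. {0..r + int (n r) * M})" if j: "j \<ge> 0" "P j" for j
  proof -
    let ?r = "j mod M"
    have e: "j = ?r + (j div M) * M" by simp
    have "j div M \<le> int (n ?r)"
    proof (rule ccontr)
      assume "\<not> j div M \<le> int (n ?r)"
      then have "?r + int (n ?r) * M + int (nat (j div M - int (n ?r))) * M = j"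
        using e by (simp add: algebra_simps)
      then show False using down[of "?r + int (n ?r) * M" "nat (j div M - int (n ?r))"] n[of ?r] j by simp
    qed
    then have "(j div M) * M \<le> int (n ?r) * M" using M by (intro mult_right_mono) auto
    then have "j \<le> ?r + int (n ?r) * M" using e by linarith
    then show ?thesis using j M by (intro UN_I[of ?r]) auto
  qed
  then have "{j. j \<ge> 0 \<and> P j} \<subseteq> (\<Union>r\<in>{0..<M}. {0..r + int (n r) * M})" by blast
  then show ?thesis by (rule finite_subset) auto
qed

context cat0
begin

text \<open>A vertex \<open>y\<close> outside \<open>s 0\<close> is separated from \<open>x\<close>
  by every member of the chain, but only finitely many half-spaces separate two vertices.\<close>

lemma hs_of_dcc:
  assumes x: "x \<in> verts K" and s: "\<And>n. s n \<in> hs_of K x" "\<And>n::nat. s (Suc n) \<subset> s n"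
  shows False
proof -
  have dec: "s (n + Suc i) \<subset> s n" for n i
    by (induction i) (use s(2) in auto)
  have inj: "inj s"
  proof (rule injI)
    fix a b :: nat assume e: "s a = s b"
    have "\<not> a < b" if "s a = s b" for a b
    proof
      assume "a < b"
      then obtain i where "b = a + Suc i" using less_imp_Suc_add by auto
      then show False using dec[of a i] that by auto
    qed
    then show "a = b" using e by (metis linorder_neqE_nat)
  qed
  have h: "s n \<in> half_spaces K" "x \<in> s n" for n using s(1) by (auto simp: hs_of_def)
  have "co K (s 0) \<noteq> {}" using half_space_ne co_half_space h by blast
  then obtain y where y: "y \<in> verts K" "y \<notin> s 0" by (auto simp: co_def)
  have "s n \<subseteq> s 0" for n using dec[of 0] by (cases n) auto
  then have "range s \<subseteq> seps K y x" using h y by (auto simp: seps_def)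
  then show False using finite_seps[OF y(1) x] inj finite_subset finite_imageD infinite_UNIV_nat by metis
qed

lemma hs_of_sageev_vert:
  assumes A: "co_closed A" and x: "x \<in> verts K"
  shows "hs_of K x \<inter> A \<in> sageev_verts K A"
  unfolding sageev_verts_def
proof (intro CollectI conjI ballI)
  fix H assume H: "H \<in> A"
  show "(H \<in> hs_of K x \<inter> A) \<noteq> (co K H \<in> hs_of K x \<inter> A)"
    using co_closedD[OF A H] co_closedD(3)[OF A co_closedD(1)[OF A H]] H x by (auto simp: hs_of_def co_mem)
next
  fix H H' assume "H \<in> hs_of K x \<inter> A" "H' \<in> hs_of K x \<inter> A"
  then show "H \<inter> H' \<noteq> {}" by (auto simp: hs_of_def)
next
  show "\<nexists>s::nat \<Rightarrow> 'v set. \<forall>n. s n \<in> hs_of K x \<inter> A \<and> s (Suc n) \<subset> s n"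
    using hs_of_dcc[OF x] by blast
qed auto

text \<open>
  Once a choice \<open>e\<close> is made on the transverse family, every half-space properly containing a member
  of the family is forced; all others are oriented towards \<open>x\<close>.
\<close>

lemma transverse_orientation_vert:
  assumes A: "co_closed A" and x: "x \<in> verts K" and T: "finite T" "T \<subseteq> A" "\<And>S. S \<in> T \<Longrightarrow> co K S \<in> T"
    and tr: "\<And>S S'. S \<in> T \<Longrightarrow> S' \<in> T \<Longrightarrow> S' \<noteq> co K S \<Longrightarrow> S \<inter> S' \<noteq> {}"
    and e: "e \<subseteq> T" "\<And>S. S \<in> T \<Longrightarrow> (S \<in> e) \<noteq> (co K S \<in> e)"
  shows "e \<union> {H \<in> A - T. (\<exists>S\<in>T. S \<subset> H) \<or> (\<not> (\<exists>S\<in>T. S \<subset> co K H) \<and> x \<in> H)} \<in> sageev_verts K A" (is "?w \<in> _")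
proof -
  define forced where "forced H \<longleftrightarrow> (\<exists>S\<in>T. S \<subset> H)" for H
  define w where "w = ?w"
  have wm: "H \<in> w \<longleftrightarrow> H \<in> e \<or> (H \<in> A - T \<and> (forced H \<or> (\<not> forced (co K H) \<and> x \<in> H)))" for H
    unfolding forced_def w_def by blast
  have sub: "H \<subseteq> verts K" if "H \<in> A" for H using co_closedD(3)[OF A that] half_space_sub by blast
  have disj: "H \<inter> H' = {} \<longleftrightarrow> H \<subseteq> co K H'" if "H \<in> A" for H H'
    using sub[OF that] by (auto simp: co_def)
  have anti: "H \<subset> H' \<Longrightarrow> co K H' \<subseteq> co K H" for H H' by (auto simp: co_def)
  have not_both: False if H: "H \<in> A" "forced H" "forced (co K H)" for H
  proof -
    obtain S S' where S: "S \<in> T" "S \<subset> H" "S' \<in> T" "S' \<subset> co K H" using H unfolding forced_def by blast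
    \<comment> \<open>Disjoint members of the family can only be complementary, and complements
      reverse inclusions, so that \<open>H \<subseteq> S \<subset> H\<close>.\<close>
    have "S \<inter> S' = {}" using S by (auto simp: co_def)
    then have "S' = co K S" using tr S by blast
    then have "co K S \<subset> co K H" using S by blast
    then have "H \<subseteq> S" using anti co_closedD(2)[OF A] H(1) S(1) T(2) by blast
    then show False using S by blast
  qed
  have coT: "H \<in> T \<longleftrightarrow> co K H \<in> T" if "H \<in> A" for H using T(3) co_closedD(2)[OF A that] by metis
  have orient: "(H \<in> w) \<noteq> (co K H \<in> w)" if H: "H \<in> A" for H
  proof (cases "H \<in> T")
    case True
    then show ?thesis using e T(3) wm by blast
  next
    case False
    then have n: "co K H \<notin> T" "H \<notin> e" "co K H \<notin> e" using coT[OF H] e(1) by auto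
    have "x \<in> co K H \<longleftrightarrow> x \<notin> H" using co_mem[OF x] .
    then show ?thesis using wm[of H] wm[of "co K H"] not_both[OF H] n False H co_closedD[OF A H] by auto
  qed
  have inA: "H \<in> w \<Longrightarrow> H \<in> A" for H using wm e(1) T(2) by blast
  have inter: "H \<inter> H' \<noteq> {}" if H: "H \<in> w" "H' \<in> w" for H H'
  proof
    assume d: "H \<inter> H' = {}"
    have d': "H' \<inter> H = {}" using d by blast
    have key: False if K: "H \<in> w" "H' \<in> w" "H \<inter> H' = {}" "H \<in> e \<or> forced H" for H H'
    proof -
      have HA: "H \<in> A" "H' \<in> A" using inA K by auto
      have s: "H \<subseteq> co K H'" using disj[OF HA(1)] K(3) by simp
      obtain S where S: "S \<in> T" "S \<subseteq> H" "S = H \<or> S \<subset> H" using K(4) e(1) unfolding forced_def by blast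
      show False
      proof (cases "H' \<in> T")
        case True
        then have "H' \<in> e" using K(2) wm by blast
        have "S \<inter> H' = {}" using S K(3) by blast
        then have "H' = co K S" using tr[OF S(1) True] by blast
        moreover have "S \<noteq> H"
        proof
          assume "S = H"
          then have "H \<in> e" using K(1) wm S by blast
          then show False using \<open>H' \<in> e\<close> \<open>H' = co K S\<close> \<open>S = H\<close> e(2)[OF S(1)] by blast
        qed
        ultimately have "S \<subset> H" "H \<subseteq> co K (co K S)" using S s by auto
        then show False using co_closedD(2)[OF A] S(1) T(2) by blast
      next
        case False
        then have "co K H' \<notin> T" using coT HA by blast
        then have "S \<subset> co K H'" using S s by blast
        then have f: "forced (co K H')" using S(1) unfolding forced_def by blast
        then have "forced H'" using K(2) False wm e(1) by blast
        then show False using not_both HA f by blast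
      qed
    qed
    have "\<not> (H \<in> e \<or> forced H)" "\<not> (H' \<in> e \<or> forced H')" using key[OF H d] key[OF H(2,1) d'] by auto
    then have "x \<in> H" "x \<in> H'" using H wm by auto
    then show False using d by blast
  qed
  have dcc: False if s: "\<And>n::nat. s n \<in> w \<and> s (Suc n) \<subset> s n" for s
  proof -
    \<comment> \<open>Every member of \<open>w\<close> contains \<open>x\<close> or one of finitely
      many chosen points, one in each member of \<open>T\<close>. In a descending chain one of them
      occurs infinitely often, hence throughout, and the chain lives in \<open>hs_of\<close> of a
      single vertex.\<close>
    obtain pt where pt: "\<And>S. S \<in> T \<Longrightarrow> pt S \<in> S"
      using half_space_ne co_closedD(3)[OF A] T(2) by (metis all_not_in_conv subsetD)
    let ?P = "insert x (pt ` T)"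
    have "\<exists>p\<in>?P. p \<in> s n" for n
    proof -
      have "s n \<in> e \<or> forced (s n) \<or> x \<in> s n" using s[of n] wm[of "s n"] by blast
      then show ?thesis using pt e(1) unfolding forced_def by blast
    qed
    then obtain p where p: "\<And>n. p n \<in> ?P \<and> p n \<in> s n" by metis
    have "finite (p ` UNIV)" using p T(1) by (meson finite_imageI finite_insert finite_subset image_subsetI)
    then obtain n0 where n0: "infinite {n. p n = p n0}" using pigeonhole_infinite[of UNIV p] by auto
    have dec: "m \<le> n \<Longrightarrow> s n \<subseteq> s m" for m n
      by (rule lift_Suc_antimono_le[of s]) (use s in blast)+
    have "p n0 \<in> s m" for m
    proof -
      obtain n where "n \<ge> m" "p n = p n0"
        using n0 unfolding finite_nat_set_iff_bounded_le by (metis linear mem_Collect_eq)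
      then show ?thesis using p[of n] dec[of m n] by auto
    qed
    moreover have "s n \<in> half_spaces K" for n using co_closedD(3)[OF A inA] s by blast
    moreover from calculation have "p n0 \<in> verts K" using half_space_sub by blast
    ultimately show False using hs_of_dcc[of "p n0" s] s by (auto simp: hs_of_def)
  qed
  have "w \<in> sageev_verts K A" unfolding sageev_verts_def
  proof (intro CollectI conjI ballI)
    show "\<nexists>s::nat \<Rightarrow> 'v set. \<forall>n. s n \<in> w \<and> s (Suc n) \<subset> s n" using dcc by blast
  qed (use inA orient inter in auto)
  then show ?thesis unfolding w_def .
qed

text \<open>The orientation \<open>?R\<close> outside the family depends on \<open>?T\<close> alone
  and not on the choice made within it. All choices are therefore toggles of a single
  vertex.\<close>

lemma transverse_family_cube:
  assumes A: "co_closed A" and L: "finite L" "L \<subseteq> A"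
    and tr: "\<And>H H'. H \<in> L \<Longrightarrow> H' \<in> L \<Longrightarrow> H \<noteq> H' \<Longrightarrow>
      transverse K H H'"
    and x: "x \<in> verts K"
  obtains v where "L \<subseteq> v" "v \<in> sageev_verts K A" "toggle K v ` Pow L \<in> sageev K A"
proof -
  let ?T = "L \<union> co K ` L"
  let ?R = "{H \<in> A - ?T. (\<exists>S\<in>?T. S \<subset> H) \<or> (\<not> (\<exists>S\<in>?T. S \<subset> co K H) \<and> x \<in> H)}"
  have coL: "co K H \<notin> L" if "H \<in> L" for H
  proof
    assume c: "co K H \<in> L"
    have "co K H \<noteq> H" using co_closedD(4)[OF A] that L by blast
    then show False using tr[OF that c] by (auto simp: transverse_def co_def)
  qed
  have cc: "co K (co K H) = H" if "H \<in> L" for H using co_closedD(2)[OF A] that L by blast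
  have T: "finite ?T" "?T \<subseteq> A" "\<And>S. S \<in> ?T \<Longrightarrow> co K S \<in> ?T"
    using L co_closedD(1)[OF A] cc by auto
  have ne: "H \<noteq> {}" if "H \<in> ?T" for H using half_space_ne co_closedD(3)[OF A] T(2) that by blast
  have trT: "S \<inter> S' \<noteq> {}" if S: "S \<in> ?T" "S' \<in> ?T" "S' \<noteq> co K S" for S S'
  proof -
    obtain H where H: "H \<in> L" "S = H \<or> S = co K H" using S(1) by blast
    obtain H' where H': "H' \<in> L" "S' = H' \<or> S' = co K H'" using S(2) by blast
    show ?thesis
    proof (cases "H = H'")
      case True
      then have "S = S'" using H H' S(3) cc by auto
      then show ?thesis using ne S by blast
    next
      case False
      then show ?thesis using tr[OF H(1) H'(1)] H(2) H'(2) unfolding transverse_def by blast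
    qed
  qed
  have vert: "((L - F) \<union> co K ` F) \<union> ?R \<in> sageev_verts K A" if F: "F \<subseteq> L" for F
  proof (rule transverse_orientation_vert[OF A x T trT])
    let ?e = "(L - F) \<union> co K ` F"
    show "?e \<subseteq> ?T" using F by blast
    fix S assume "S \<in> ?T"
    then obtain H where H: "H \<in> L" "S = H \<or> S = co K H" by blast
    have a: "H \<in> ?e \<longleftrightarrow> H \<notin> F" using H(1) coL F by blast
    have "co K H \<in> co K ` F \<longleftrightarrow> H \<in> F" using cc F H(1) by (metis (no_types, lifting) image_iff subsetD)
    then have b: "co K H \<in> ?e \<longleftrightarrow> H \<in> F" using coL[OF H(1)] by blast
    show "(S \<in> ?e) \<noteq> (co K S \<in> ?e)" using H(2) a b cc[OF H(1)] by auto
  qed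
  let ?v = "L \<union> ?R"
  have tog: "toggle K ?v F = ((L - F) \<union> co K ` F) \<union> ?R" if "F \<subseteq> L" for F
    unfolding toggle_def using that by blast
  have v: "?v \<in> sageev_verts K A" using vert[of "{}"] by simp
  have "toggle K ?v ` Pow L \<subseteq> sageev_verts K A" using tog vert by auto
  then have "toggle K ?v ` Pow L \<in> sageev K A" unfolding sageev_iff[OF A] using L(1) v by blast
  then show thesis using that[OF _ v] by blast
qed

lemma singleton_sageev: "co_closed A \<Longrightarrow> v \<in> sageev_verts K A \<Longrightarrow> {v} \<in> sageev K A"
  unfolding sageev_iff by (rule exI[of _ v], rule exI[of _ "{}"]) auto

lemma verts_sageev: "co_closed A \<Longrightarrow> verts (sageev K A) = sageev_verts K A"
  unfolding verts_def by (intro equalityI subsetI UnionI[OF singleton_sageev]) (auto simp: sageev_def)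

end

section \<open>The equivalences\<close>

context cat0_flow
begin

lemma cell_ne: "C \<in> K \<Longrightarrow> C \<noteq> {}"
  using card_cell by fastforce

definition nested :: "(int \<Rightarrow> 'v) \<Rightarrow> int \<Rightarrow> bool" where
  "nested p L \<longleftrightarrow> (\<forall>j. cut p (j + L) \<subseteq> cut p j)"

lemma char_set_line: "line p k L \<Longrightarrow> char_set K (t k) = cuts p"
  unfolding char_set_def cuts_def using char_set_pos_line by simp

section \<open>Transversality in the Sageev complex\<close>

lemma sageev_half_space_eq:
  "co_closed A \<Longrightarrow> sageev_half_space K A H = {v \<in> sageev_verts K A. H \<in> v}"
  unfolding sageev_half_space_def using verts_sageev by simp

lemma co_sageev_half_space:
  assumes A: "co_closed A" and H: "H \<in> A"
  shows "co (sageev K A) (sageev_half_space K A H) = {v \<in> sageev_verts K A. co K H \<in> v}"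
  using sageev_half_space_eq[OF A] verts_sageev[OF A] orientationD(2)[OF sageev_verts_orientation H]
  by (auto simp: co_def[of "sageev K A"])

lemma transverse_sageevI:
  assumes A: "co_closed A" and H: "H \<in> A" "H' \<in> A"
    and v: "v1 \<in> sageev_verts K A" "H \<in> v1" "H' \<in> v1" "v2 \<in> sageev_verts K A" "H \<in> v2" "co K H' \<in> v2"
      "v3 \<in> sageev_verts K A" "co K H \<in> v3" "H' \<in> v3" "v4 \<in> sageev_verts K A" "co K H \<in> v4" "co K H' \<in> v4"
  shows "transverse (sageev K A) (sageev_half_space K A H) (sageev_half_space K A H')"
proof -
  have "v1 \<in> sageev_half_space K A H \<inter> sageev_half_space K A H'"
    "v2 \<in> sageev_half_space K A H \<inter> co (sageev K A) (sageev_half_space K A H')"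
    "v3 \<in> co (sageev K A) (sageev_half_space K A H) \<inter> sageev_half_space K A H'"
    "v4 \<in> co (sageev K A) (sageev_half_space K A H) \<inter> co (sageev K A) (sageev_half_space K A H')"
    unfolding co_sageev_half_space[OF A H(1)] co_sageev_half_space[OF A H(2)]
    unfolding sageev_half_space_eq[OF A] using v by simp_all
  then show ?thesis unfolding transverse_def by blast
qed

lemma sageev_verts_meet: "v \<in> sageev_verts K A \<Longrightarrow> H \<in> v \<Longrightarrow> H' \<in> v \<Longrightarrow> H \<inter> H' \<noteq> {}"
  unfolding sageev_verts_def by blast

context
  fixes p :: "int \<Rightarrow> 'v" and k L :: int
  assumes l: "line p k L"
begin

lemma cuts_co_closed: "co_closed (cuts p)"
proof -
  have "co K (co K (cut p j)) = cut p j" for j using co_co cut_hs[OF l] by blast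
  then show ?thesis unfolding co_closed_def cuts_def
    using cut_hs[OF l] co_half_space by auto
qed

lemma cut_dual: "cut p j \<in> cuts p" "co K (cut p j) \<in> cuts p"
  unfolding cuts_def by auto

lemma cuts_cases:
  assumes "H \<in> cuts p"
  obtains j where "H = cut p j \<or> H = co K (cut p j)"
  using assms unfolding cuts_def by blast

lemma t_cut1: "t k ` cut p j = cut p (j + L)"
  using t_cut[OF l, of 1 j] by simp

lemma ess_vert: "x \<in> verts K \<Longrightarrow> hs_of K x \<inter> cuts p \<in> sageev_verts K (cuts p)"
  using hs_of_sageev_vert cuts_co_closed by blast

lemma nested_no_vert:
  assumes n: "nested p L" and v: "v \<in> sageev_verts K (cuts p)"
  shows "cut p (j + L) \<in> v \<Longrightarrow> co K (cut p j) \<notin> v"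
    using sageev_verts_meet[OF v] n unfolding nested_def co_def by blast

lemma nested_mono:
  assumes n: "nested p L" and v: "v \<in> sageev_verts K (cuts p)"
  shows "cut p (j + L) \<in> v \<Longrightarrow> cut p j \<in> v"
    "co K (cut p j) \<in> v \<Longrightarrow> co K (cut p (j + L)) \<in> v"
  using nested_no_vert[OF n v, of j] orientationD(2)[OF sageev_verts_orientation[OF v] cut_dual(1)] by blast+

text \<open>Axis vertices on either side of and between the two hyperplanes occupy three of the four
  quadrants of \<open>cut p j\<close> and \<open>cut p (j + L)\<close>. The fourth is occupied by
  any \<open>x\<close> violating the inclusion, and if the inclusion holds, no vertex can contain
  the two disjoint half-spaces defining it.\<close>

lemma nontransverse_iff:
  "(\<forall>H\<in>cuts p. \<not> transverse (sageev K (cuts p)) (sageev_half_space K (cuts p) H)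
     (sageev_half_space K (cuts p) (t k ` H))) \<longleftrightarrow> nested p L" (is "?nt \<longleftrightarrow> _")
proof
  note A = cuts_co_closed
  let ?A = "cuts p"
  have mem: "H \<in> hs_of K x \<inter> ?A \<longleftrightarrow> x \<in> H" if "H \<in> ?A" for x H
    using that co_closedD(3)[OF A that] by (auto simp: hs_of_def)
  { assume nt: ?nt
    have "cut p (j + L) \<subseteq> cut p j" for j
    proof (rule ccontr)
      assume "\<not> ?thesis"
      then obtain x where x: "x \<in> cut p (j + L)" "x \<notin> cut p j" by blast
      have xv: "x \<in> verts K" using cut_sub[OF l] x by blast
      let ?s = "\<lambda>x. hs_of K x \<inter> ?A"
      have cm: "y \<in> co K H \<longleftrightarrow> y \<notin> H" if "y \<in> verts K" for y H using co_mem[OF that] .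
      note lv = line_verts[OF l]
      note mc = mem_cut[OF l]
      have in_s: "cut p i \<in> ?s y \<longleftrightarrow> y \<in> cut p i" "co K (cut p i) \<in> ?s y \<longleftrightarrow> y \<notin> cut p i"
        if "y \<in> verts K" for y i
        using mem[OF cut_dual(1)] mem[OF cut_dual(2)] cm[OF that] by simp_all
      have "transverse (sageev K ?A) (sageev_half_space K ?A (cut p j)) (sageev_half_space K ?A (cut p (j + L)))"
        by (rule transverse_sageevI[OF A cut_dual(1) cut_dual(1),
              of "?s (p (j + L + 1))" _ _ "?s (p (j + 1))" "?s x" "?s (p j)"])
          (use ess_vert[OF lv] ess_vert[OF xv] L_pos[OF l] x in \<open>auto simp only: in_s[OF lv] in_s[OF xv] mc\<close>)
      moreover have "\<not> transverse (sageev K ?A) (sageev_half_space K ?A (cut p j)) (sageev_half_space K ?A (t k ` cut p j))"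
        using nt cut_dual(1) by blast
      ultimately show False unfolding t_cut1 by blast
    qed
    then show "nested p L" unfolding nested_def by blast }
  { assume n: "nested p L"
    show ?nt
    proof
      fix H assume "H \<in> ?A"
      then obtain j where j: "H = cut p j \<or> H = co K (cut p j)" by (rule cuts_cases)
      show "\<not> transverse (sageev K ?A) (sageev_half_space K ?A H) (sageev_half_space K ?A (t k ` H))"
        using j
      proof
        assume H: "H = cut p j"
        have "co (sageev K ?A) (sageev_half_space K ?A H) \<inter> sageev_half_space K ?A (t k ` H) = {}"
          unfolding H t_cut1 co_sageev_half_space[OF A cut_dual(1)]
          unfolding sageev_half_space_eq[OF A]
          using nested_no_vert[OF n] by blast
        then show ?thesis unfolding transverse_def by blast
      next
        assume H: "H = co K (cut p j)"
        have tH: "t k ` H = co K (cut p (j + L))" unfolding H t_co[OF cut_hs[OF l]] t_cut1 ..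
        have "sageev_half_space K ?A H \<inter> co (sageev K ?A) (sageev_half_space K ?A (t k ` H)) = {}"
          unfolding tH co_sageev_half_space[OF A cut_dual(2)] co_co[OF cut_hs[OF l]]
          unfolding H sageev_half_space_eq[OF A]
          using nested_no_vert[OF n] by blast
        then show ?thesis unfolding transverse_def by blast
      qed
    qed }
qed

section \<open>Lifting the essential complex into the minimal set\<close>

lemma ess_proj_eq: "ess_proj K (t k) x = hs_of K x \<inter> cuts p"
  unfolding ess_proj_def hs_of_def char_set_line[OF l] ..

text \<open>The members of \<open>v\<close> missing \<open>p 0\<close> are cuts of index at least 0
  or complements of cuts of index below 0. Nestedness makes either kind closed under shifts towards
  \<open>p 0\<close>, so infinitely many in one orbit would form a descending chain.\<close>

lemma nested_finite_differences:
  assumes n: "nested p L" and v: "v \<in> sageev_verts K (cuts p)"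
  shows "finite {H \<in> v. p 0 \<notin> H}"
proof -
  note L = L_pos[OF l]
  have ns: "cut p (j + L) \<subset> cut p j" for j
  proof -
    have "cut p (j + L) \<noteq> cut p j" using cut_inj[OF l, of "j + L" j] L by auto
    then show ?thesis using n unfolding nested_def by blast
  qed
  have nco: "co K (cut p j) \<subset> co K (cut p (j + L))" for j
    using ns[of j] cut_sub[OF l, of j] by (auto simp: co_def)
  have dcc: "\<not> (\<forall>n. s n \<in> v \<and> s (Suc n) \<subset> s n)" for s :: "nat \<Rightarrow> 'v set"
    using v unfolding sageev_verts_def by blast
  have f1: "finite {j. j \<ge> 0 \<and> cut p j \<in> v}"
  proof (rule finite_nonneg_of_shift[OF L])
    show "cut p (j + L) \<in> v \<Longrightarrow> cut p j \<in> v" for j using nested_mono(1)[OF n v] .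
    show "\<exists>n::nat. cut p (r + int n * L) \<notin> v" for r
    proof (rule ccontr)
      assume "\<nexists>n::nat. cut p (r + int n * L) \<notin> v"
      moreover have "cut p (r + int (Suc n) * L) \<subset> cut p (r + int n * L)" for n
        using ns[of "r + int n * L"] by (simp add: algebra_simps)
      ultimately show False using dcc[of "\<lambda>n. cut p (r + int n * L)"] by blast
    qed
  qed
  have f2: "finite {j. j \<ge> 0 \<and> co K (cut p (- j)) \<in> v}"
  proof (rule finite_nonneg_of_shift[OF L])
    show "co K (cut p (- (j + L))) \<in> v \<Longrightarrow> co K (cut p (- j)) \<in> v" for j
      using nested_mono(2)[OF n v, of "- j - L"] by simp
    show "\<exists>n::nat. co K (cut p (- (r + int n * L))) \<notin> v" for r
    proof (rule ccontr)
      assume "\<nexists>n::nat. co K (cut p (- (r + int n * L))) \<notin> v"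
      moreover have "co K (cut p (- (r + int (Suc n) * L))) \<subset> co K (cut p (- (r + int n * L)))" for n
        using nco[of "- (r + int (Suc n) * L)"] by (simp add: algebra_simps)
      ultimately show False using dcc[of "\<lambda>n. co K (cut p (- (r + int n * L)))"] by blast
    qed
  qed
  have "{H \<in> v. p 0 \<notin> H} \<subseteq> cut p ` {j. j \<ge> 0 \<and> cut p j \<in> v} \<union>
    (\<lambda>j. co K (cut p (- j))) ` {j. j \<ge> 0 \<and> co K (cut p (- j)) \<in> v}" (is "_ \<subseteq> ?S")
  proof
    fix H assume H: "H \<in> {H \<in> v. p 0 \<notin> H}"
    then have "H \<in> cuts p" using orientationD(1)[OF sageev_verts_orientation[OF v]] by blast
    then obtain j where "H = cut p j \<or> H = co K (cut p j)" by (rule cuts_cases)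
    then show "H \<in> ?S"
    proof
      assume j: "H = cut p j"
      then have "j \<ge> 0" using H mem_cut[OF l, of 0 j] by auto
      then show ?thesis using j H by blast
    next
      assume j: "H = co K (cut p j)"
      then have "p 0 \<in> cut p j" using H co_mem[OF line_verts[OF l]] by auto
      then have "- j \<ge> 0" "H = co K (cut p (- (- j)))" using mem_cut[OF l, of 0 j] j by auto
      then show ?thesis using H by blast
    qed
  qed
  then show ?thesis using f1 f2 finite_subset by blast
qed

lemma line_one_sided:
  assumes "H \<in> half_spaces K - cuts p"
  shows "p i \<in> H \<longleftrightarrow> p j \<in> H"
proof -
  have H: "H \<in> half_spaces K" "H \<notin> range (cut p)" using assms unfolding cuts_def by auto
  have cH: "co K H \<in> half_spaces K" "co K H \<notin> range (cut p)"
    using co_half_space H co_co[OF H(1)] assms unfolding cuts_def by (blast, metis Diff_iff UnCI imageI)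
  have "\<not> (p i \<notin> H \<and> p j \<in> H)" for i j
    using crossed_eq[OF l H(1), of i j] crossed_eq[OF l cH(1), of j i] H(2) cH(2) co_mem[OF line_verts[OF l]]
    by (metis linear)
  then show ?thesis by blast
qed

text \<open>The added half-spaces contain the whole axis, while every member of \<open>v\<close>
  contains some vertex of it; so the union is consistent. It differs finitely from
  \<open>p 0\<close> and is therefore realized.\<close>

lemma nested_lift:
  assumes n: "nested p L" and v: "v \<in> sageev_verts K (cuts p)"
  shows "\<exists>x\<in>verts K. hs_of K x = v \<union> {H \<in> half_spaces K - cuts p. p 0 \<in> H}"
proof (rule realization[OF _ _ _ line_verts[OF l]])
  note A = cuts_co_closed
  let ?A = "cuts p"
  let ?R = "{H \<in> half_spaces K - ?A. p 0 \<in> H}"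
  let ?u = "v \<union> ?R"
  have o: "orientation K ?A v" using sageev_verts_orientation[OF v] .
  show "?u \<subseteq> half_spaces K" using orientationD(1)[OF o] co_closedD(3)[OF A] by blast
  show "(H \<in> ?u) \<noteq> (co K H \<in> ?u)" if H: "H \<in> half_spaces K" for H
  proof (cases "H \<in> ?A")
    case True
    then show ?thesis using o co_closedD(1)[OF A True] unfolding orientation_def by blast
  next
    case False
    then have "co K H \<notin> ?A" using co_closedD(1)[OF A] co_co[OF H] by metis
    then show ?thesis using False H co_half_space[OF H] orientationD(1)[OF o] co_mem[OF line_verts[OF l]] by blast
  qed
  have meets: "\<exists>i. p i \<in> H" if "H \<in> ?A" for H
    using that
  proof (rule cuts_cases)
    fix j assume "H = cut p j \<or> H = co K (cut p j)"
    then show ?thesis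
    proof
      assume "H = cut p j" then show ?thesis using mem_cut[OF l, of "j + 1" j] by auto
    next
      assume "H = co K (cut p j)"
      then show ?thesis using mem_cut[OF l, of j j] co_mem[OF line_verts[OF l]] by blast
    qed
  qed
  have mixed: "H \<inter> H' \<noteq> {}" if H: "H \<in> v" "H' \<in> ?R" for H H'
  proof -
    obtain i where "p i \<in> H" using meets H(1) orientationD(1)[OF o] by blast
    moreover have "p i \<in> H'" using line_one_sided[of H' i 0] H(2) by blast
    ultimately show ?thesis by blast
  qed
  show "H \<inter> H' \<noteq> {}" if "H \<in> ?u" "H' \<in> ?u" for H H'
  proof -
    consider "H \<in> v" "H' \<in> v" | "H \<in> v" "H' \<in> ?R" | "H \<in> ?R" "H' \<in> v" | "H \<in> ?R" "H' \<in> ?R" using \<open>H \<in> ?u\<close> \<open>H' \<in> ?u\<close> by blast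
    then show ?thesis
    proof cases
      case 1 then show ?thesis using sageev_verts_meet[OF v] by blast
    next
      case 2 then show ?thesis using mixed by blast
    next
      case 3 then show ?thesis using mixed[of H' H] by blast
    qed blast
  qed
  have "?u - hs_of K (p 0) \<subseteq> {H \<in> v. p 0 \<notin> H}"
    using orientationD(1)[OF o] co_closedD(3)[OF A] by (auto simp: hs_of_def)
  then show "finite (?u - hs_of K (p 0))" using nested_finite_differences[OF n v] finite_subset by blast
qed

lemma t_cuts:
  assumes H: "H \<in> half_spaces K - cuts p"
  shows "t (- k) ` H \<in> half_spaces K - cuts p"
proof -
  have hH: "H \<in> half_spaces K" using H by blast
  have tt: "t k ` t (- k) ` H = H"
  proof -
    have "t k (t (- k) x) = x" if "x \<in> H" for x using t_inv(2) that half_space_sub[OF hH] by blast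
    then show ?thesis by (simp add: image_image)
  qed
  have "t (- k) ` H \<notin> cuts p"
  proof
    assume "t (- k) ` H \<in> cuts p"
    then obtain j where "t (- k) ` H = cut p j \<or> t (- k) ` H = co K (cut p j)" by (rule cuts_cases)
    then have "H = cut p (j + L) \<or> H = co K (cut p (j + L))"
      using tt t_cut1 t_co[OF cut_hs[OF l]] by metis
    then show False using H cut_dual by blast
  qed
  then show ?thesis using t_half_space[OF hH] by blast
qed

text \<open>Nestedness gives monotonicity on the cuts. Off the axis \<open>x\<close> is oriented
  like \<open>p 0\<close>, and this orientation is invariant because \<open>t k\<close> moves
  \<open>p 0\<close> along the axis.\<close>

lemma lift_min:
  assumes n: "nested p L" and v: "v \<in> sageev_verts K (cuts p)" and x: "x \<in> verts K"
    and hx: "hs_of K x = v \<union> {H \<in> half_spaces K - cuts p. p 0 \<in> H}"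
  shows "vdist K x (t k x) = translation_length K (t k)"
  unfolding min_iff[OF l x]
proof (intro conjI allI ballI impI)
  have mem: "x \<in> H \<longleftrightarrow> H \<in> hs_of K x" if "H \<in> half_spaces K" for H using that by (simp add: hs_of_def)
  show "x \<in> cut p j" if "x \<in> cut p (j + L)" for j
    using n that unfolding nested_def by blast
  fix H assume H: "H \<in> half_spaces K - cuts p"
  have off: "x \<in> H \<longleftrightarrow> p 0 \<in> H" if "H \<in> half_spaces K - cuts p" for H
    using mem[of H] that orientationD(1)[OF sageev_verts_orientation[OF v]] unfolding hx by blast
  have hH: "H \<subseteq> verts K" using H half_space_sub by blast
  have "t k x \<in> H \<longleftrightarrow> x \<in> t (- k) ` H" using mem_t_image[OF hH x, of "- k"] by simp
  also have "\<dots> \<longleftrightarrow> p 0 \<in> t (- k) ` H" using off[OF t_cuts[OF H]] .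
  also have "\<dots> \<longleftrightarrow> t k (p 0) \<in> H" using mem_t_image[OF hH line_verts[OF l, of 0], of "- k"] by simp
  also have "\<dots> \<longleftrightarrow> p 0 \<in> H" using t_line[OF l, of 1 0] line_one_sided[OF H, of L 0] by simp
  finally show "x \<in> H \<longleftrightarrow> t k x \<in> H" using off[OF H] by blast
qed

lemma proj_cell:
  assumes C: "C \<in> K"
  shows "(\<lambda>x. hs_of K x \<inter> cuts p) ` C \<in> sageev K (cuts p)"
proof -
  note A = cuts_co_closed
  let ?A = "cuts p"
  let ?s = "\<lambda>x. hs_of K x \<inter> ?A"
  have Cv: "C \<subseteq> verts K" using C unfolding verts_def by blast
  obtain y where y: "y \<in> C"
    using cell_ne[OF C] by blast
  obtain F where F: "finite F" "F \<subseteq> hs_of K y" "hs_of K ` C = toggle K (hs_of K y) ` Pow F"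
    using cell_toggle[OF C y] by blast
  have tog: "toggle K (hs_of K y) G \<inter> ?A = toggle K (hs_of K y \<inter> ?A) (G \<inter> ?A)" if "G \<subseteq> F" for G
  proof -
    have "co K H \<in> ?A \<longleftrightarrow> H \<in> ?A" if "H \<in> G" for H
    proof -
      have "H \<in> half_spaces K" using that \<open>G \<subseteq> F\<close> F(2) by (auto simp: hs_of_def)
      then show ?thesis using co_closedD(1)[OF A] co_co by metis
    qed
    then have "co K ` G \<inter> ?A = co K ` (G \<inter> ?A)" by blast
    then show ?thesis unfolding toggle_def by blast
  qed
  have "?s ` C = (\<lambda>u. u \<inter> ?A) ` hs_of K ` C" by (simp only: image_image)
  also have "\<dots> = (\<lambda>G. toggle K (hs_of K y) G \<inter> ?A) ` Pow F" unfolding F(3) by (simp only: image_image)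
  also have "\<dots> = (\<lambda>G. toggle K (hs_of K y \<inter> ?A) (G \<inter> ?A)) ` Pow F" using tog by (intro image_cong) auto
  also have "\<dots> = toggle K (hs_of K y \<inter> ?A) ` (\<lambda>G. G \<inter> ?A) ` Pow F" by (simp only: image_image)
  also have "(\<lambda>G. G \<inter> ?A) ` Pow F = Pow (F \<inter> ?A)"
  proof (intro equalityI subsetI)
    fix G assume "G \<in> Pow (F \<inter> ?A)"
    then have "G = G \<inter> ?A" "G \<in> Pow F" by auto
    then show "G \<in> (\<lambda>G. G \<inter> ?A) ` Pow F" by blast
  qed auto
  finally have eq: "?s ` C = toggle K (hs_of K y \<inter> ?A) ` Pow (F \<inter> ?A)" .
  have sub: "?s ` C \<subseteq> sageev_verts K ?A" using ess_vert Cv by blast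
  show ?thesis unfolding sageev_iff[OF A]
  proof (intro exI conjI)
    show "?s ` C = toggle K (hs_of K y \<inter> ?A) ` Pow (F \<inter> ?A)" by (rule eq)
    show "hs_of K y \<inter> ?A \<in> sageev_verts K ?A" using ess_vert y Cv by blast
  qed (use sub F in auto)
qed

text \<open>Toggling cuts commutes with adding the fixed orientation \<open>?R\<close> off the axis.
  The lifted corners of a cube thus form a toggled family at one vertex of \<open>K\<close>, hence a
  cell, and it consists of minimal vertices.\<close>

lemma nested_ess_eq:
  assumes n: "nested p L"
  shows "sageev K (cuts p) = ess_min_set K (t k)"
proof (intro equalityI subsetI)
  note A = cuts_co_closed
  let ?A = "cuts p"
  let ?R = "{H \<in> half_spaces K - ?A. p 0 \<in> H}"
  fix C assume "C \<in> sageev K ?A"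
  then obtain v F where vF: "finite F" "F \<subseteq> v" "v \<in> sageev_verts K ?A" "C = toggle K v ` Pow F"
    "C \<subseteq> sageev_verts K ?A" unfolding sageev_iff[OF A] by blast
  have "\<forall>w. \<exists>x. w \<in> sageev_verts K ?A \<longrightarrow> x \<in> verts K \<and> hs_of K x = w \<union> ?R"
    using nested_lift[OF n] by blast
  then obtain lift where lift: "\<And>w. w \<in> sageev_verts K ?A \<Longrightarrow> lift w \<in> verts K \<and> hs_of K (lift w) = w \<union> ?R"
    by metis
  let ?C = "lift ` C"
  have disj: "v \<inter> ?R = {}" using orientationD(1)[OF sageev_verts_orientation[OF vF(3)]] by blast
  have "hs_of K ` ?C = (\<lambda>w. w \<union> ?R) ` C" unfolding image_image
    using lift vF(5) by (intro image_cong refl) blast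
  also have "\<dots> = (\<lambda>G. toggle K v G \<union> ?R) ` Pow F" unfolding vF(4) by (simp only: image_image)
  also have "\<dots> = toggle K (hs_of K (lift v)) ` Pow F"
  proof (intro image_cong refl)
    fix G assume "G \<in> Pow F"
    then have "G \<subseteq> v" using vF(2) by blast
    then have "toggle K (v \<union> ?R) G = toggle K v G \<union> ?R" using disj unfolding toggle_def by blast
    then show "toggle K v G \<union> ?R = toggle K (hs_of K (lift v)) G" using lift[OF vF(3)] by simp
  qed
  finally have h: "hs_of K ` ?C = toggle K (hs_of K (lift v)) ` Pow F" .
  have Cv: "?C \<subseteq> verts K" using lift vF(5) by blast
  have "F \<subseteq> hs_of K (lift v)" using lift[OF vF(3)] vF(2) by blast
  then have cell: "?C \<in> K" using toggle_cell[OF Cv _ vF(1) _ h] lift[OF vF(3)] by blast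
  have "vdist K (lift w) (t k (lift w)) = translation_length K (t k)" if "w \<in> C" for w
    using lift_min[OF n, of w "lift w"] lift that vF(5) by blast
  then have "?C \<in> min_set K (t k)" unfolding min_set_def full_subcomplex_def using cell Cv by blast
  moreover have "ess_proj K (t k) ` ?C = C"
  proof -
    have "ess_proj K (t k) (lift w) = w" if w: "w \<in> C" for w
      using lift[of w] w vF(5) orientationD(1)[OF sageev_verts_orientation[of w K ?A]]
      unfolding ess_proj_eq by blast
    then show ?thesis by (simp add: image_image)
  qed
  ultimately show "C \<in> ess_min_set K (t k)" unfolding ess_min_set_def by blast
next
  fix C assume "C \<in> ess_min_set K (t k)"
  then obtain C' where "C' \<in> K" "C = ess_proj K (t k) ` C'"
    unfolding ess_min_set_def min_set_def full_subcomplex_def by blast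
  then show "C \<in> sageev K (cuts p)" using proj_cell unfolding ess_proj_eq by blast
qed

text \<open>The projection of \<open>y\<close> is also the projection of a minimal vertex
  \<open>x\<close>, which lies in the same cuts as \<open>y\<close>. Monotonicity of
  \<open>x\<close> along the orbits is then inherited by \<open>y\<close>.\<close>

lemma ess_eq_nested:
  assumes eq: "sageev K (cuts p) = ess_min_set K (t k)"
  shows "nested p L"
  unfolding nested_def
proof (intro allI subsetI)
  note A = cuts_co_closed
  fix j y assume y: "y \<in> cut p (j + L)"
  then have yv: "y \<in> verts K" using cut_sub[OF l] by blast
  let ?v = "hs_of K y \<inter> cuts p"
  have "{?v} \<in> ess_min_set K (t k)" using singleton_sageev[OF A ess_vert[OF yv]] eq by simp
  then obtain C where C: "C \<in> min_set K (t k)" "{?v} = ess_proj K (t k) ` C" unfolding ess_min_set_def by blast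
  have "?v \<in> ess_proj K (t k) ` C" unfolding C(2)[symmetric] by simp
  then obtain x where "x \<in> C" "?v = ess_proj K (t k) x" by (rule imageE)
  then have x: "x \<in> C" "hs_of K x \<inter> cuts p = ?v" by (simp_all add: ess_proj_eq)
  then have xm: "x \<in> verts K" "vdist K x (t k x) = translation_length K (t k)"
    using C(1) unfolding min_set_def full_subcomplex_def by auto
  have mem: "x \<in> cut p i \<longleftrightarrow> y \<in> cut p i" for i
    using x(2) cut_dual(1)[of i] cut_hs[OF l, of i] unfolding hs_of_def by blast
  show "y \<in> cut p j" using xm min_iff[OF l xm(1)] mem y by blast
qed

section \<open>Nestedness and dimension\<close>

lemma nested_card_le:
  assumes n: "nested p L" and F: "finite F" "F \<subseteq> v" "toggle K v ` Pow F \<subseteq> sageev_verts K (cuts p)"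
  shows "card F \<le> nat L"
proof -
  note A = cuts_co_closed
  let ?A = "cuts p"
  have "toggle K v {} \<in> sageev_verts K ?A" using F(3) by blast
  then have o: "orientation K ?A v" using sageev_verts_orientation by simp
  have FA: "F \<subseteq> ?A" using F(2) orientationD(1)[OF o] by blast
  have "\<forall>H. \<exists>j. H \<in> F \<longrightarrow> H = cut p j \<or> H = co K (cut p j)" using FA cuts_cases by (metis subsetD)
  then obtain idx where idx: "\<And>H. H \<in> F \<Longrightarrow> H = cut p (idx H) \<or> H = co K (cut p (idx H))" by metis
  have nle: "cut p (j + L * int i) \<subseteq> cut p j" for i j
  proof (induction i)
    case (Suc i)
    have "cut p (j + L * int (Suc i)) \<subseteq> cut p (j + L * int i)"
      using n[unfolded nested_def, rule_format, of "j + L * int i"] by (simp add: algebra_simps)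
    then show ?case using Suc by blast
  qed simp
  \<comment> \<open>Two directions in the same residue class would be given by nested cuts, but a
    cube has corners for all four combinations of sides, including the empty one.\<close>
  have nlt: "\<not> idx H < idx H'" if H: "H \<in> F" "H' \<in> F" "idx H mod L = idx H' mod L" for H H'
  proof
    assume lt: "idx H < idx H'"
    let ?h = "cut p (idx H)" and ?h' = "cut p (idx H')"
    have "L dvd idx H' - idx H" using H(3)[symmetric] unfolding mod_eq_dvd_iff .
    then obtain m where m: "idx H' - idx H = L * m" unfolding dvd_def by blast
    then have "m > 0" using lt L_pos[OF l] by (metis diff_gt_0_iff_gt zero_less_mult_pos)
    then have sub: "?h' \<subseteq> ?h" using nle[of "idx H" "nat m"] m by (simp add: algebra_simps)
    have ne: "?h \<noteq> ?h'" "co K ?h \<noteq> ?h'" "?h \<noteq> co K ?h'"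
      using cut_inj[OF l, of "idx H" "idx H'"] lt co_cut_ne[OF l, of "idx H" "idx H'"]
        co_cut_ne[OF l, of "idx H'" "idx H"] by auto
    \<comment> \<open>These are the directions to toggle at \<open>v\<close> in order to reach the
      corner that contains the disjoint half-spaces \<open>co K ?h\<close> and
      \<open>?h'\<close>.\<close>
    define G where "G = {X \<in> {H, H'}. X = ?h \<or> X = co K ?h'}"
    have G: "G \<subseteq> F" using H F(2) unfolding G_def by auto
    then have w: "toggle K v G \<in> sageev_verts K ?A" using F(3) by blast
    have cc: "co K (co K ?h) = ?h" "co K (co K ?h') = ?h'" using co_co cut_hs[OF l] by auto
    have c1: "co K ?h' \<noteq> co K ?h" using ne cc by metis
    have Hv: "H \<in> v" "H' \<in> v" using H F(2) by auto
    have tin: "co K X \<in> toggle K v G" if "X \<in> G" for X unfolding toggle_def using that by blast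
    have tout: "X \<in> toggle K v G" if "X \<in> v" "X \<notin> G" for X unfolding toggle_def using that by blast
    have "co K ?h \<in> toggle K v G"
      using idx[OF H(1)]
    proof
      assume e: "H = ?h"
      then have "H \<in> G" unfolding G_def by blast
      from tin[OF this] show ?thesis unfolding e[symmetric] .
    next
      assume e: "H = co K ?h"
      then have "H \<notin> G" using c1 co_closedD(4)[OF A cut_dual(1)[of "idx H"]] unfolding G_def by auto
      from tout[OF Hv(1) this] show ?thesis unfolding e[symmetric] .
    qed
    moreover have "?h' \<in> toggle K v G"
      using idx[OF H(2)]
    proof
      assume e: "H' = ?h'"
      then have "H' \<notin> G" using ne co_closedD(4)[OF A cut_dual(1)[of "idx H'"]] unfolding G_def by auto
      from tout[OF Hv(2) this] show ?thesis unfolding e[symmetric] .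
    next
      assume e: "H' = co K ?h'"
      then have "H' \<in> G" unfolding G_def by blast
      from tin[OF this] show ?thesis using cc(2) e by simp
    qed
    ultimately have "co K ?h \<inter> ?h' \<noteq> {}" using sageev_verts_meet[OF w] by blast
    then show False using sub by (auto simp: co_def)
  qed
  have inj: "inj_on (\<lambda>H. idx H mod L) F"
  proof (rule inj_onI)
    fix H H' assume H: "H \<in> F" "H' \<in> F" "idx H mod L = idx H' mod L"
    then have e: "idx H = idx H'" using nlt[of H H'] nlt[of H' H] by linarith
    have cc: "co K (co K (cut p i)) = cut p i" for i using co_co cut_hs[OF l] by auto
    show "H = H'"
    proof (rule ccontr)
      assume "H \<noteq> H'"
      then have "H' = co K H" using idx[OF H(1)] idx[OF H(2)] e cc by metis
      then show False using orientationD(2)[OF o, of H] H(1,2) F(2) FA by blast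
    qed
  qed
  have "(\<lambda>H. idx H mod L) ` F \<subseteq> {0..<L}" using L_pos[OF l] by auto
  from card_inj_on_le[OF inj this] show ?thesis by simp
qed

lemma nested_finite_dimensional:
  assumes n: "nested p L"
  shows "finite_dimensional (sageev K (cuts p))"
  unfolding finite_dimensional_def
proof (rule exI[of _ "nat L"], rule ballI)
  note A = cuts_co_closed
  fix C assume C: "C \<in> sageev K (cuts p)"
  then obtain v F where vF: "finite F" "F \<subseteq> v" "v \<in> sageev_verts K (cuts p)" "C = toggle K v ` Pow F"
    "C \<subseteq> sageev_verts K (cuts p)" unfolding sageev_iff[OF A] by blast
  have "card F \<le> nat L" using nested_card_le[OF n vF(1,2)] vF(4,5) by simp
  then show "\<exists>m\<le>nat L. \<exists>c. cube_chart (sageev K (cuts p)) m c C"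
    using sageev_cube_chart[OF A C vF(1-4)] by blast
qed

lemma finite_dimensional_nested:
  assumes fd: "finite_dimensional (sageev K (cuts p))"
  shows "\<exists>m>0. nested p (L * int m)"
proof -
  note A = cuts_co_closed
  let ?A = "cuts p"
  obtain N where N: "\<And>C. C \<in> sageev K ?A \<Longrightarrow> \<exists>n\<le>N. \<exists>c. cube_chart (sageev K ?A) n c C"
    using fd unfolding finite_dimensional_def by blast
  \<comment> \<open>Otherwise the cuts of index \<open>j + L * a\<close> with
    \<open>a \<le> N\<close> are pairwise transverse: axis vertices lie in three quadrants, and the
    failing inclusion, translated back to \<open>j\<close>, fills the fourth. They span a cube with
    \<open>2 ^ (N + 1)\<close> corners, too many for a chart of dimension at most
    \<open>N\<close>.\<close>
  have ex: "\<exists>d. 0 < d \<and> d \<le> N \<and> cut p (j + L * int d) \<subseteq> cut p j" for j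
  proof (rule ccontr)
    assume no: "\<not> ?thesis"
    let ?h = "\<lambda>a. cut p (j + L * int a)"
    let ?F = "?h ` {..N}"
    have nsub: "\<not> ?h b \<subseteq> ?h a" if ab: "a < b" "b \<le> N" for a b
    proof
      assume s: "?h b \<subseteq> ?h a"
      have "t (k * (- int a)) ` ?h b \<subseteq> t (k * (- int a)) ` ?h a" using s by (rule image_mono)
      then have "cut p (j + L * int b + L * (- int a)) \<subseteq> cut p (j + L * int a + L * (- int a))"
        unfolding t_cut[OF l] .
      moreover have "j + L * int b + L * (- int a) = j + L * int (b - a)"
        using ab by (simp add: algebra_simps of_nat_diff)
      moreover have "j + L * int a + L * (- int a) = j" by simp
      ultimately have "cut p (j + L * int (b - a)) \<subseteq> cut p j" by metis
      then show False using no ab by (metis diff_le_self le_trans zero_less_diff)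
    qed
    have inj: "inj_on ?h {..N}"
    proof (rule inj_onI)
      fix a b assume "?h a = ?h b"
      then have "j + L * int a = j + L * int b" by (rule cut_inj[OF l])
      then show "a = b" using L_pos[OF l] by simp
    qed
    have tr1: "transverse K (?h a) (?h b)" "transverse K (?h b) (?h a)" if ab: "a < b" "b \<le> N" for a b
    proof -
      have lt: "j + L * int a < j + L * int b" using ab L_pos[OF l] by simp
      note mc = mem_cut[OF l] and cm = co_mem[OF line_verts[OF l]]
      have "p (j + L * int b + 1) \<in> ?h a \<inter> ?h b" using mc lt by auto
      moreover have "p (j + L * int b) \<in> ?h a \<inter> co K (?h b)" using mc lt cm by auto
      moreover have "p (j + L * int a) \<in> co K (?h a) \<inter> co K (?h b)" using mc lt cm by auto
      moreover have "co K (?h a) \<inter> ?h b \<noteq> {}" using nsub[OF ab] cut_sub[OF l] by (auto simp: co_def)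
      ultimately show "transverse K (?h a) (?h b)" "transverse K (?h b) (?h a)"
        unfolding transverse_def by blast+
    qed
    have tr: "transverse K H H'" if H: "H \<in> ?F" "H' \<in> ?F" "H \<noteq> H'" for H H'
    proof -
      obtain a b where ab: "a \<le> N" "b \<le> N" "H = ?h a" "H' = ?h b" using H by blast
      then have "a < b \<or> b < a" using H(3) by (metis linorder_neqE_nat)
      then show ?thesis using tr1[of a b] tr1[of b a] ab by blast
    qed
    have FA: "?F \<subseteq> ?A" using cut_dual(1) by blast
    obtain v where v: "?F \<subseteq> v" "v \<in> sageev_verts K ?A" "toggle K v ` Pow ?F \<in> sageev K ?A"
      using transverse_family_cube[OF A _ FA tr line_verts[OF l]] by blast
    obtain n c where nc: "n \<le> N" "cube_chart (sageev K ?A) n c (toggle K v ` Pow ?F)" using N[OF v(3)] by blast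
    have "card (toggle K v ` Pow ?F) = 2 ^ n"
      using nc(2) unfolding cube_chart_def by (metis bij_betw_same_card card_Pow card_lessThan finite_lessThan)
    moreover have "inj_on (toggle K v) (Pow ?F)"
      using toggle_inj[OF A sageev_verts_orientation[OF v(2)]] v(1) by (intro inj_onI) (meson PowD order_trans)
    then have "card (toggle K v ` Pow ?F) = 2 ^ card ?F" by (simp add: card_image card_Pow)
    moreover have "card ?F = Suc N" using inj by (simp add: card_image)
    ultimately have "(2::nat) ^ n = 2 ^ Suc N" by simp
    then show False using nc(1) power_inject_exp[of "2::nat" n "Suc N"] by simp
  qed
  \<comment> \<open>The step \<open>d\<close> varies with \<open>j\<close>; \<open>fact N\<close> is
    a common multiple of all possible values, and translating the inclusion allows it to be
    iterated.\<close>
  have "cut p (j + L * int (fact N)) \<subseteq> cut p j" for j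
  proof -
    obtain d where d: "0 < d" "d \<le> N" "cut p (j + L * int d) \<subseteq> cut p j" using ex by blast
    have step: "cut p (j + L * int (d * i)) \<subseteq> cut p j" for i
    proof (induction i)
      case (Suc i)
      have "t (k * int (d * i)) ` cut p (j + L * int d) \<subseteq> t (k * int (d * i)) ` cut p j"
        using d(3) by (rule image_mono)
      then have "cut p (j + L * int d + L * int (d * i)) \<subseteq> cut p (j + L * int (d * i))"
        unfolding t_cut[OF l] .
      moreover have "j + L * int d + L * int (d * i) = j + L * int (d * Suc i)" by (simp add: algebra_simps)
      ultimately show ?case using Suc.IH by (metis subset_trans)
    qed simp
    obtain i where "fact N = d * i" using dvd_fact[of d N] d unfolding dvd_def by auto
    then show ?thesis using step[of i] by metis
  qed
  then show ?thesis unfolding nested_def by (intro exI[of _ "fact N"]) simp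
qed

end

section \<open>Passage to powers and conclusion\<close>

lemma equivalences_with_axis:
  assumes l: "line p 1 L"
  shows "((\<exists>k::nat. k > 0 \<and> acts_nontransversely_on_ess K (t 1) (t (int k))) \<longleftrightarrow>
      (\<exists>k::nat. k > 0 \<and> ess K (t 1) = ess_min_set K (t (int k)))) \<and>
    ((\<exists>k::nat. k > 0 \<and> ess K (t 1) = ess_min_set K (t (int k))) \<longleftrightarrow> finite_dimensional (ess K (t 1)))"
proof -
  \<comment> \<open>The path \<open>p\<close> is kept for every power, so \<open>cuts p\<close> and
    the essential complex do not change with \<open>k\<close>; only the shift in
    \<open>nested\<close> does.\<close>
  have lk: "line p (int k) (L * int k)" if "k > 0" for k :: nat
    using line_power[OF l, of "int k"] that by simp
  note e = ess_def[of K "t 1", unfolded char_set_line[OF l]]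
  have 1: "acts_nontransversely_on_ess K (t 1) (t (int k)) \<longleftrightarrow> nested p (L * int k)" if "k > 0" for k :: nat
    unfolding acts_nontransversely_on_ess_def e char_set_line[OF l] by (rule nontransverse_iff[OF lk[OF that]])
  have 2: "ess K (t 1) = ess_min_set K (t (int k)) \<longleftrightarrow> nested p (L * int k)" if "k > 0" for k :: nat
    unfolding e using nested_ess_eq[OF lk[OF that]] ess_eq_nested[OF lk[OF that]] by blast
  have 3: "finite_dimensional (ess K (t 1)) \<longleftrightarrow> (\<exists>k::nat. k > 0 \<and> nested p (L * int k))"
    unfolding e using nested_finite_dimensional[OF lk] finite_dimensional_nested[OF l] by blast
  show ?thesis unfolding 3 using 1 2 by blast
qed

text \<open>
  Without an axis the characteristic set is empty, and the Sageev complex is a single vertex.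
\<close>

lemma equivalences_without_axis:
  assumes e: "char_set K (t 1) = {}"
  shows "acts_nontransversely_on_ess K (t 1) (t 1) \<and> ess K (t 1) = ess_min_set K (t 1) \<and>
    finite_dimensional (ess K (t 1))"
proof -
  have A: "co_closed {}" by (simp add: co_closed_def)
  have sv: "sageev_verts K {} = {{}}" unfolding sageev_verts_def by auto
  have s: "sageev K {} = {{{}}}"
  proof (intro equalityI subsetI)
    fix C assume "C \<in> sageev K {}"
    then show "C \<in> {{{}}}" unfolding sageev_iff[OF A] sv by auto
  next
    fix C :: "'v set set set" assume "C \<in> {{{}}}"
    then show "C \<in> sageev K {}" using singleton_sageev[OF A, of "{}"] sv by simp
  qed
  have es: "ess K (t 1) = {{{}}}" unfolding ess_def e s ..
  have "{{}} \<in> sageev K {}" "{} \<in> sageev_verts K {}" "{{}} = toggle K {} ` Pow {}"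
    unfolding s sv by simp_all
  from sageev_cube_chart[OF A this(1) finite.emptyI empty_subsetI this(2,3)]
  have "\<exists>c. cube_chart (ess K (t 1)) 0 c C" if "C \<in> ess K (t 1)" for C
    using that unfolding es unfolding s card.empty by blast
  then have fd: "finite_dimensional (ess K (t 1))"
    unfolding finite_dimensional_def by blast
  have proj: "ess_proj K (t 1) x = {}" for x unfolding ess_proj_def e by simp
  have "verts K \<noteq> {}" using sc unfolding simply_connected_complex_def connected_complex_def by blast
  then have "\<exists>n. \<exists>x\<in>verts K. vdist K x (t 1 x) = n" by blast
  then have "\<exists>x\<in>verts K. vdist K x (t 1 x) = translation_length K (t 1)"
    unfolding translation_length_def by (rule LeastI_ex)
  then obtain x where x: "x \<in> verts K" "vdist K x (t 1 x) = translation_length K (t 1)" by blast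
  obtain C where C: "C \<in> K" "x \<in> C" using x(1) unfolding verts_def by blast
  obtain n c where nc: "cube_chart K n c C" using cc C unfolding cube_complex_def by blast
  \<comment> \<open>A chart of a cell containing \<open>x\<close> has \<open>x\<close> as the
    degenerate interval \<open>{S..S}\<close>, hence as a face.\<close>
  have "{x} \<in> K"
  proof -
    obtain S where S: "S \<subseteq> {..<n}" "x = c S" using nc C(2) unfolding cube_chart_def bij_betw_def by blast
    have "{x} = c ` {S..S}" using S by auto
    then show ?thesis using nc S(1) C(2) unfolding cube_chart_def by blast
  qed
  then have "{x} \<in> min_set K (t 1)" unfolding min_set_def full_subcomplex_def using x by blast
  then have "ess_proj K (t 1) ` {x} \<in> ess_min_set K (t 1)" unfolding ess_min_set_def by blast
  then have sub: "{{{}}} \<subseteq> ess_min_set K (t 1)" unfolding image_insert image_empty proj by blast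
  have "ess_min_set K (t 1) \<subseteq> {{{}}}"
  proof
    fix D assume "D \<in> ess_min_set K (t 1)"
    then obtain C where C: "C \<in> K" "D = ess_proj K (t 1) ` C"
      unfolding ess_min_set_def min_set_def full_subcomplex_def by blast
    have "C \<noteq> {}" using cell_ne[OF C(1)] .
    then show "D \<in> {{{}}}" using C(2) proj by auto
  qed
  then have "ess K (t 1) = ess_min_set K (t 1)" unfolding es by (rule equalityI[OF sub])
  moreover have "acts_nontransversely_on_ess K (t 1) (t 1)"
    unfolding acts_nontransversely_on_ess_def e by simp
  ultimately show ?thesis using fd by blast
qed

text \<open>If there is an axis, it is a line for the flow and determines the characteristic set. If
  there is none, the union over all axes defining this set is empty, and \<open>k = 1\<close> serves
  in both existential statements.\<close>

theorem equivalences: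
  assumes "translation_length K (t 1) > 0"
  shows "((\<exists>k::nat. k > 0 \<and> acts_nontransversely_on_ess K (t 1) (t (int k))) \<longleftrightarrow>
      (\<exists>k::nat. k > 0 \<and> ess K (t 1) = ess_min_set K (t (int k)))) \<and>
    ((\<exists>k::nat. k > 0 \<and> ess K (t 1) = ess_min_set K (t (int k))) \<longleftrightarrow> finite_dimensional (ess K (t 1)))"
proof (cases "\<exists>p. combinatorial_axis K (t 1) p")
  case True
  then show ?thesis using equivalences_with_axis axis_line[OF _ assms] by (metis zero_less_one)
next
  case False
  then have "char_set K (t 1) = {}" unfolding char_set_def char_set_pos_def by blast
  from equivalences_without_axis[OF this] show ?thesis by (metis of_nat_1 zero_less_one)
qed

end

lemma CAT0_cat0:
  assumes "CAT0_cube_complex K"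
  shows "cat0 K"
  using assms unfolding CAT0_cube_complex_def by unfold_locales auto

lemma group_action_flow:
  fixes G (structure)
  assumes "CAT0_cube_complex X" "acts_on_complex G X \<phi>" "g \<in> carrier G"
  shows "cat0_flow X (\<lambda>m::int. \<phi> (g [^] m))"
proof -
  interpret cat0 X using CAT0_cat0 assms(1) .
  interpret group_action G "verts X" \<phi> using assms(2) unfolding acts_on_complex_def by blast
  interpret group G using group_hom by (simp add: group_hom_def)
  show ?thesis
  proof unfold_locales
    fix x m n assume x: "x \<in> verts X"
    show "\<phi> (g [^] (m::int)) x \<in> verts X" using element_image[OF _ x] assms(3) by auto
    show "\<phi> (g [^] (0::int)) x = x" using id_eq_one x by (metis int_pow_0 restrict_apply')
    show "\<phi> (g [^] (m + n)) x = \<phi> (g [^] m) (\<phi> (g [^] n) x)"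
      using composition_rule[OF x] assms(3) int_pow_mult by simp
  next
    fix C and m :: int assume "C \<in> X"
    then show "\<phi> (g [^] m) ` C \<in> X" using assms(2,3) unfolding acts_on_complex_def by auto
  qed
qed

theorem corollary3p19:
  fixes G :: "('g, 'm) monoid_scheme"
    and X :: "'v set set"
    and \<phi> :: "'g \<Rightarrow> 'v \<Rightarrow> 'v"
    and g :: 'g
  assumes "CAT0_cube_complex X"
    and "acts_on_complex G X \<phi>"
    and "without_inversion G X \<phi>"
    and "g \<in> carrier G"
    and "hyperbolic X (\<phi> g)"
  shows "((\<exists>k::nat. k > 0 \<and> acts_nontransversely_on_ess X (\<phi> g) (\<phi> (g [^]\<^bsub>G\<^esub> k)))
           \<longleftrightarrow> (\<exists>k::nat. k > 0 \<and> ess X (\<phi> g) = ess_min_set X (\<phi> (g [^]\<^bsub>G\<^esub> k))))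
       \<and> ((\<exists>k::nat. k > 0 \<and> ess X (\<phi> g) = ess_min_set X (\<phi> (g [^]\<^bsub>G\<^esub> k)))
           \<longleftrightarrow> finite_dimensional (ess X (\<phi> g)))"
proof -
  interpret cat0_flow X "\<lambda>m::int. \<phi> (g [^]\<^bsub>G\<^esub> m)" by (rule group_action_flow[OF assms(1,2,4)])
  interpret group_action G "verts X" \<phi> using assms(2) unfolding acts_on_complex_def by blast
  interpret group G using group_hom by (simp add: group_hom_def)
  have 1: "g [^]\<^bsub>G\<^esub> (1::int) = g" using int_pow_1 assms(4) by blast
  have k: "g [^]\<^bsub>G\<^esub> (int k) = g [^]\<^bsub>G\<^esub> k" for k by (rule int_pow_int)
  have "translation_length X (\<phi> (g [^]\<^bsub>G\<^esub> (1::int))) > 0"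
    using assms(5) unfolding hyperbolic_def 1 .
  from equivalences[OF this] show ?thesis unfolding 1 k .
qed

end
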